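(* Let $\Omega\subset\mathbb{H}^N$ be a bounded extension domain and let $f:\Omega\times\mathbb{R}\to\mathbb{R}$ be a Carathéodory function such that, with $Q^*=\frac{2Q}{Q-2s}$ and $F(\xi,l)=\int_0^l f(\xi,\tau)\,d\tau$: (1) there exist $a_1,a_2>0$ and $q\in(2,Q^* )$ with $|f(\xi,l)|\le a_1+a_2|l|^{q-1}$ for a.e. $\xi\in\Omega$ and all $l\in\mathbb{R}$; (2) $\lim_{|l|\to0}\frac{f(\xi,l)}{|l|}=0$ uniformly in $\xi\in\Omega$; (3) there exist $\vartheta>2$ and $\mathcal R>0$ such that for a.e. $\xi\in\Omega$ and all $l\in\mathbb{R}$ with $|l|>\mathcal R$, $0<\vartheta F(\xi,l)\le l f(\xi,l)$. Then the problem $$-\mathfrak{L}_{\mathcal K}u=f(\xi,u)\ \text{in }\Omega,\qquad u=0\ \text{in }\mathbb{H}^N\setminus\Omega,$$ has a mountain pass type (weak) solution $u\in\mathcal Z_0$ which is not identically zero; here weak solution means $$\int_{\mathcal S}(u(\xi)-u(\eta))(v(\xi)-v(\eta))\mathcal K(\eta^{-1}\xi)\,d\xi\,d\eta=\int_\Omega f(\xi,u(\xi))v(\xi)\,d\xi\qquad\text{for all }v\in\mathcal Z_0.$$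
   Context: $\mathbb{H}^N=\mathbb{R}^N\times\mathbb{R}^N\times\mathbb{R}$ ($N\ge1$) is the Heisenberg group with law $(x,y,t)\cdot(x',y',t')=(x+x',y+y',t+t'+2(\langle x',y\rangle-\langle x,y'\rangle))$, identity $0$, homogeneous norm $|(x,y,t)|=(t^2+(|x|^2+|y|^2)^2)^{1/4}$, Lebesgue (Haar) measure, and homogeneous dimension $Q=2N+2$. Products $\xi\eta$ and inverses $\eta^{-1}$ are in this group. Fix $s\in(0,1)$ (so $Q>2s$). The kernel $\mathcal K:\mathbb{H}^N\setminus\{0\}\to(0,\infty)$ is measurable and satisfies: $\theta\mathcal K\in L^1(\mathbb{H}^N)$ with $\theta(\xi)=\min\{1,|\xi|^2\}$; there is $\mu>0$ with $\mathcal K(\xi)\ge\mu|\xi|^{-(Q+2s)}$ for all $\xi\ne0$; and $\mathcal K(\xi)=\mathcal K(\xi^{-1})$ for all $\xi\neq 0$. $\Omega^c=\mathbb{H}^N\setminus\Omega$ and $\mathcal S=(\mathbb{H}^N\times\mathbb{H}^N)\setminus(\Omega^c\times\Omega^c)$. $\mathcal Z$ is the space of measurable $u:\mathbb{H}^N\to\mathbb{R}$ with $u\in L^2(\Omega)$ and $(u(\xi)-u(\eta))\sqrt{\mathcal K(\eta^{-1}\xi)}\in L^2(\mathcal S,d\xi\,d\eta)$; $\mathcal Z_0=\{u\in\mathcal Z:u=0\text{ a.e. in }\Omega^c\}$, with norm $\|u\|_{\mathcal Z_0}=\big(\int_{\mathcal S}|u(\xi)-u(\eta)|^2\mathcal K(\eta^{-1}\xi)\,d\xi\,d\eta\big)^{1/2}$.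 The energy functional is $\mathcal H:\mathcal Z_0\to\mathbb{R}$, $\mathcal H(u)=\frac12\|u\|_{\mathcal Z_0}^2-\int_\Omega F(\xi,u(\xi))\,d\xi$. Weak solutions are the critical points of $\mathcal H$. A weak solution $u$ is of mountain pass type if $\mathcal H(u)=\inf_{\gamma\in\Gamma}\max_{\tau\in[0,1]}\mathcal H(\gamma(\tau))$, where $\Gamma=\{\gamma\in C([0,1],\mathcal Z_0):\gamma(0)=0,\gamma(1)=e\}$ for some $e\in\mathcal Z_0$ and $\rho>0$ with $\|e\|_{\mathcal Z_0}>\rho$ and $\max\{\mathcal H(0),\mathcal H(e)\}<\inf_{\|w\|_{\mathcal Z_0}=\rho}\mathcal H(w)$. Extension domain: for an open set $U\subseteq\mathbb{H}^N$, $W^{s,2}(U)$ is the space of $u\in L^2(U)$ with $\int_{U\times U}\frac{|u(\xi)-u(\eta)|^2}{|\eta^{-1}\xi|^{Q+2s}}d\xi d\eta<\infty$, normed by $\|u\|_{W^{s,2}(U)}=\|u\|_{L^2(U)}+\big(\int_{U\times U}\frac{|u(\xi)-u(\eta)|^2}{|\eta^{-1}\xi|^{Q+2s}}d\xi d\eta\big)^{1/2}$. $\Omega$ is an extension domain if it is open and connected and there is $C>0$ such that every $u\in W^{s,2}(\Omega)$ has an extension $\tilde u\in W^{s,2}(\mathbb{H}^N)$ with $\tilde u=u$ a.e. in $\Omega$ and $\|\tilde u\|_{W^{s,2}(\mathbb{H}^N)}\le C\|u\|_{W^{s,2}(\Omega)}$. *)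

theory Defs
  imports "HOL-Analysis.Analysis"
begin

text \<open>\<open>N\<close> is \<open>CARD('n)\<close>. The carrier is a Euclidean space, so \<^const>\<open>lebesgue\<close>, \<^const>\<open>open\<close>,
  \<^const>\<open>connected\<close> and \<^const>\<open>bounded\<close> are the usual notions on \<open>\<real>\<^sup>2\<^sup>N\<^sup>+\<^sup>1\<close>; bounded sets are the same
  for the Euclidean and the homogeneous norm. The additive structure of the product type is
  not the group structure, except that \<open>0\<close> is the identity of both.\<close>

type_synonym 'n heis = "(real^'n) \<times> (real^'n) \<times> real"

fun heis_mult :: "'n::finite heis \<Rightarrow> 'n heis \<Rightarrow> 'n heis" (infixl "\<cdot>\<^sub>H" 70) where
  "(x, y, t) \<cdot>\<^sub>H (x', y', t') = (x + x', y + y', t + t' + 2 * (x' \<bullet> y - x \<bullet> y'))"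

fun heis_inv :: "'n::finite heis \<Rightarrow> 'n heis" where
  "heis_inv (x, y, t) = (- x, - y, - t)"

lemma heis_inv_left: "heis_inv \<xi> \<cdot>\<^sub>H \<xi> = 0"
  by (cases \<xi>) (simp add: zero_prod_def inner_commute)

lemma heis_inv_right: "\<xi> \<cdot>\<^sub>H heis_inv \<xi> = 0"
  by (cases \<xi>) (simp add: zero_prod_def inner_commute)

fun heis_norm :: "'n::finite heis \<Rightarrow> real" where
  "heis_norm (x, y, t) = root 4 (t\<^sup>2 + ((norm x)\<^sup>2 + (norm y)\<^sup>2)\<^sup>2)"

definition hom_dim :: "'n::finite itself \<Rightarrow> real" where
  "hom_dim _ = 2 * real CARD('n) + 2"

text \<open>Elements of the function spaces are represented by functions; identification up to
  null sets is made explicit wherever equality of elements is meant.\<close>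

definition in_L2_on :: "'a::euclidean_space set \<Rightarrow> ('a \<Rightarrow> real) \<Rightarrow> bool" where
  "in_L2_on A g \<longleftrightarrow> set_borel_measurable lebesgue A g \<and> set_integrable lebesgue A (\<lambda>x. (g x)\<^sup>2)"

definition L2_norm_on :: "'a::euclidean_space set \<Rightarrow> ('a \<Rightarrow> real) \<Rightarrow> real" where
  "L2_norm_on A g = sqrt (LINT x:A|lebesgue. (g x)\<^sup>2)"

definition gagliardo_integrand ::
    "real \<Rightarrow> ('n::finite heis \<Rightarrow> real) \<Rightarrow> 'n heis \<times> 'n heis \<Rightarrow> real" where
  "gagliardo_integrand s u = (\<lambda>(\<xi>, \<eta>).
     \<bar>u \<xi> - u \<eta>\<bar>\<^sup>2 / heis_norm (heis_inv \<eta> \<cdot>\<^sub>H \<xi>) powr (hom_dim TYPE('n) + 2 * s))"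

definition sobolev_space :: "real \<Rightarrow> 'n::finite heis set \<Rightarrow> ('n heis \<Rightarrow> real) set" where
  "sobolev_space s U =
     {u. in_L2_on U u \<and> set_integrable lebesgue (U \<times> U) (gagliardo_integrand s u)}"

definition sobolev_norm :: "real \<Rightarrow> 'n::finite heis set \<Rightarrow> ('n heis \<Rightarrow> real) \<Rightarrow> real" where
  "sobolev_norm s U u =
     L2_norm_on U u + sqrt (LINT p:U \<times> U|lebesgue. gagliardo_integrand s u p)"

text \<open>A domain is nonempty; \<^term>\<open>connected {}\<close> holds in HOL.\<close>

definition extension_domain :: "real \<Rightarrow> 'n::finite heis set \<Rightarrow> bool" where
  "extension_domain s \<Omega> \<longleftrightarrow> open \<Omega> \<and> connected \<Omega> \<and> \<Omega> \<noteq> {} \<and>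
     (\<exists>C>0. \<forall>u\<in>sobolev_space s \<Omega>. \<exists>v\<in>sobolev_space s UNIV.
        (AE \<xi> in lebesgue. \<xi> \<in> \<Omega> \<longrightarrow> v \<xi> = u \<xi>) \<and>
        sobolev_norm s UNIV v \<le> C * sobolev_norm s \<Omega> u)"

text \<open>A kernel is only constrained off the identity; its value at \<open>0\<close> enters integrals only on
  null sets.\<close>

definition admissible_kernel :: "real \<Rightarrow> ('n::finite heis \<Rightarrow> real) \<Rightarrow> bool" where
  "admissible_kernel s K \<longleftrightarrow>
     K \<in> borel_measurable (lebesgue_on (- {0})) \<and>
     (\<forall>\<xi>. \<xi> \<noteq> 0 \<longrightarrow> K \<xi> > 0) \<and>
     set_integrable lebesgue (- {0}) (\<lambda>\<xi>. min 1 ((heis_norm \<xi>)\<^sup>2) * K \<xi>) \<and>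
     (\<exists>\<mu>>0. \<forall>\<xi>. \<xi> \<noteq> 0 \<longrightarrow> K \<xi> \<ge> \<mu> * heis_norm \<xi> powr (- (hom_dim TYPE('n) + 2 * s))) \<and>
     (\<forall>\<xi>. \<xi> \<noteq> 0 \<longrightarrow> K \<xi> = K (heis_inv \<xi>))"

definition S_set :: "'n::finite heis set \<Rightarrow> ('n heis \<times> 'n heis) set" where
  "S_set \<Omega> = UNIV - ((- \<Omega>) \<times> (- \<Omega>))"

definition Z_space ::
    "('n::finite heis \<Rightarrow> real) \<Rightarrow> 'n heis set \<Rightarrow> ('n heis \<Rightarrow> real) set" where
  "Z_space K \<Omega> = {u. u \<in> borel_measurable lebesgue \<and> in_L2_on \<Omega> u \<and>
     in_L2_on (S_set \<Omega>) (\<lambda>(\<xi>, \<eta>). (u \<xi> - u \<eta>) * sqrt (K (heis_inv \<eta> \<cdot>\<^sub>H \<xi>)))}"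

definition Z0_space ::
    "('n::finite heis \<Rightarrow> real) \<Rightarrow> 'n heis set \<Rightarrow> ('n heis \<Rightarrow> real) set" where
  "Z0_space K \<Omega> = {u \<in> Z_space K \<Omega>. AE \<xi> in lebesgue. \<xi> \<notin> \<Omega> \<longrightarrow> u \<xi> = 0}"

definition Z0_norm ::
    "('n::finite heis \<Rightarrow> real) \<Rightarrow> 'n heis set \<Rightarrow> ('n heis \<Rightarrow> real) \<Rightarrow> real" where
  "Z0_norm K \<Omega> u = sqrt (set_lebesgue_integral lebesgue (S_set \<Omega>)
     (\<lambda>(\<xi>, \<eta>). \<bar>u \<xi> - u \<eta>\<bar>\<^sup>2 * K (heis_inv \<eta> \<cdot>\<^sub>H \<xi>)))"

definition caratheodory :: "'n::finite heis set \<Rightarrow> ('n heis \<Rightarrow> real \<Rightarrow> real) \<Rightarrow> bool" where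
  "caratheodory \<Omega> f \<longleftrightarrow>
     (\<forall>l. (\<lambda>\<xi>. f \<xi> l) \<in> borel_measurable (lebesgue_on \<Omega>)) \<and>
     (AE \<xi> in lebesgue. \<xi> \<in> \<Omega> \<longrightarrow> continuous_on UNIV (f \<xi>))"

text \<open>The interval integral is oriented, so this is also the right primitive for negative \<open>l\<close>.\<close>

definition primitive :: "('n::finite heis \<Rightarrow> real \<Rightarrow> real) \<Rightarrow> 'n heis \<Rightarrow> real \<Rightarrow> real" where
  "primitive f \<xi> l = (LBINT \<tau>=ereal 0..ereal l. f \<xi> \<tau>)"

definition energy ::
    "('n::finite heis \<Rightarrow> real) \<Rightarrow> 'n heis set \<Rightarrow> ('n heis \<Rightarrow> real \<Rightarrow> real) \<Rightarrow>
     ('n heis \<Rightarrow> real) \<Rightarrow> real" where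
  "energy K \<Omega> f u =
     1/2 * (Z0_norm K \<Omega> u)\<^sup>2 - (LINT \<xi>:\<Omega>|lebesgue. primitive f \<xi> (u \<xi>))"

definition weak_solution ::
    "('n::finite heis \<Rightarrow> real) \<Rightarrow> 'n heis set \<Rightarrow> ('n heis \<Rightarrow> real \<Rightarrow> real) \<Rightarrow>
     ('n heis \<Rightarrow> real) \<Rightarrow> bool" where
  "weak_solution K \<Omega> f u \<longleftrightarrow> u \<in> Z0_space K \<Omega> \<and>
     (\<forall>v\<in>Z0_space K \<Omega>.
        let B = (\<lambda>(\<xi>, \<eta>). (u \<xi> - u \<eta>) * (v \<xi> - v \<eta>) * K (heis_inv \<eta> \<cdot>\<^sub>H \<xi>));
            g = (\<lambda>\<xi>. f \<xi> (u \<xi>) * v \<xi>)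
        in set_integrable lebesgue (S_set \<Omega>) B \<and> set_integrable lebesgue \<Omega> g \<and>
           set_lebesgue_integral lebesgue (S_set \<Omega>) B = set_lebesgue_integral lebesgue \<Omega> g)"

text \<open>Continuous paths in \<open>Z\<^sub>0\<close> from \<open>0\<close> to \<open>e\<close>; the end points are prescribed as elements of
  \<open>Z\<^sub>0\<close>, i.e. up to null sets.\<close>

definition mp_paths ::
    "('n::finite heis \<Rightarrow> real) \<Rightarrow> 'n heis set \<Rightarrow> ('n heis \<Rightarrow> real) \<Rightarrow>
     (real \<Rightarrow> 'n heis \<Rightarrow> real) set" where
  "mp_paths K \<Omega> e = {\<gamma>.
     (\<forall>\<tau>\<in>{0..1}. \<gamma> \<tau> \<in> Z0_space K \<Omega>) \<and>
     (\<forall>\<tau>\<in>{0..1}. ((\<lambda>\<sigma>. Z0_norm K \<Omega> (\<lambda>\<xi>. \<gamma> \<sigma> \<xi> - \<gamma> \<tau> \<xi>)) \<longlongrightarrow> 0) (at \<tau> within {0..1})) \<and>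
     (AE \<xi> in lebesgue. \<gamma> 0 \<xi> = 0) \<and>
     (AE \<xi> in lebesgue. \<gamma> 1 \<xi> = e \<xi>)}"

text \<open>Infima and suprema are taken in \<^typ>\<open>ereal\<close> so that they are meaningful without
  boundedness or nonemptiness. The supremum along a path is a maximum
  whenever the energy is continuous on \<open>Z\<^sub>0\<close>.\<close>

definition mountain_pass_type ::
    "('n::finite heis \<Rightarrow> real) \<Rightarrow> 'n heis set \<Rightarrow> ('n heis \<Rightarrow> real \<Rightarrow> real) \<Rightarrow>
     ('n heis \<Rightarrow> real) \<Rightarrow> bool" where
  "mountain_pass_type K \<Omega> f u \<longleftrightarrow>
     (\<exists>e\<in>Z0_space K \<Omega>. \<exists>\<rho>>0.
        Z0_norm K \<Omega> e > \<rho> \<and>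
        ereal (max (energy K \<Omega> f (\<lambda>_. 0)) (energy K \<Omega> f e))
          < (INF w\<in>{w \<in> Z0_space K \<Omega>. Z0_norm K \<Omega> w = \<rho>}. ereal (energy K \<Omega> f w)) \<and>
        ereal (energy K \<Omega> f u)
          = (INF \<gamma>\<in>mp_paths K \<Omega> e. SUP \<tau>\<in>{0..1}. ereal (energy K \<Omega> f (\<gamma> \<tau>))))"

end

theory Submission
  imports Defs "HOL-Complex_Analysis.Great_Picard"
    "HOL-Library.Function_Algebras" "HOL-Library.Diagonal_Subsequence"
begin

text \<open>The energy is \<open>H u = N(u)\<^sup>2 / 2 - \<Psi> u\<close> with gradient \<open>G u = u - A u\<close>, where \<open>A\<close> is compact and
  uniformly continuous on bounded sets. The latter makes explicit Euler steps of the normalised,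
  cut-off gradient flow decrease \<open>H\<close> with a step size that is uniform along a given path, so finitely
  many steps push a nearly optimal path below the mountain pass level unless the level is critical.

  Both embedding facts about \<open>Z\<^sub>0\<close> follow from the kernel bound \<open>K \<ge> \<mu> |\<xi>|\<^sup>-\<^sup>(\<^sup>Q\<^sup>+\<^sup>2\<^sup>s\<^sup>)\<close>, left
  invariance and the volume growth \<open>r\<^sup>Q\<close> of balls. With \<open>p = Q\<^sup>*\<close> and \<open>X = \<integral>|u|\<^sup>p\<close>, comparing \<open>u(\<xi>)\<close> with
  the values of \<open>u\<close> on a ball whose radius depends on \<open>|u(\<xi>)|\<close> bounds \<open>|u(\<xi>)|\<^sup>p\<close> by
  \<open>C X\<^sup>2\<^sup>s\<^sup>/\<^sup>Q\<close> times the local energy at \<open>\<xi>\<close>; integration gives the Sobolev inequality.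
  Compactness comes from averaging over small balls and the Arzela--Ascoli theorem.\<close>

section \<open>The mountain pass theorem\<close>

text \<open>The gradient is continuous but need not be locally Lipschitz, so the usual existence
  theory for its flow is out of reach; Euler steps need only a modulus of continuity on bounded
  sets. That modulus comes from a property stronger than compactness:
  \<open>A (u n) - A (w n)\<close> tends to 0 whenever two bounded sequences have the same almost
  everywhere limit. The strict inequality \<open>q < p\<close> matters there, because
  \<open>\<bar>f\<bar> powr p'\<close> with \<open>p' = p / (p - 1)\<close> then grows with an
  exponent below \<open>p\<close>, and its mass on large values is uniformly small.

  The hypotheses on \<open>f\<close> hold only almost everywhere. The problem is therefore posed
  with \<open>f\<close> replaced by 0 off a subset of full measure in \<Omega>, on which they hold
  at every point. Completeness of the space is itself a consequence of the compact embedding and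
  Fatou's lemma. The superquadratic condition acts twice: it bounds sequences with small gradient,
  and it makes the energy negative far out along a ray.\<close>

text \<open>Elements of \<open>Z\<^sub>0\<close> are functions, not classes modulo null sets, so the form is only
  semidefinite.\<close>

locale semi_hilbert =
  fixes V :: "'v::real_vector set" and B :: "'v \<Rightarrow> 'v \<Rightarrow> real"
  assumes subspace_V: "subspace V"
    and B_commute: "u \<in> V \<Longrightarrow> v \<in> V \<Longrightarrow> B u v = B v u"
    and B_add_left: "u \<in> V \<Longrightarrow> v \<in> V \<Longrightarrow> w \<in> V \<Longrightarrow> B (u + v) w = B u w + B v w"
    and B_scale_left: "u \<in> V \<Longrightarrow> v \<in> V \<Longrightarrow> B (a *\<^sub>R u) v = a * B u v"
    and B_nonneg: "u \<in> V \<Longrightarrow> 0 \<le> B u u"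
    and complete: "(\<And>n::nat. x n \<in> V) \<Longrightarrow>
      (\<And>e. e > 0 \<Longrightarrow> \<exists>n0. \<forall>m\<ge>n0. \<forall>n\<ge>n0. sqrt (B (x m - x n) (x m - x n)) < e) \<Longrightarrow>
      \<exists>l\<in>V. (\<lambda>n. sqrt (B (x n - l) (x n - l))) \<longlonglongrightarrow> 0"
begin

definition N :: "'v \<Rightarrow> real" where "N u = sqrt (B u u)"

lemma V_zero [simp, intro]: "0 \<in> V"
  and V_add [simp, intro]: "u \<in> V \<Longrightarrow> v \<in> V \<Longrightarrow> u + v \<in> V"
  and V_diff [simp, intro]: "u \<in> V \<Longrightarrow> v \<in> V \<Longrightarrow> u - v \<in> V"
  and V_scale [simp, intro]: "u \<in> V \<Longrightarrow> a *\<^sub>R u \<in> V"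
  using subspace_V by (auto simp: subspace_0 subspace_add subspace_diff subspace_scale)

lemma B_add_right: "u \<in> V \<Longrightarrow> v \<in> V \<Longrightarrow> w \<in> V \<Longrightarrow> B w (u + v) = B w u + B w v"
  by (metis B_add_left B_commute V_add)

lemma B_scale_right: "u \<in> V \<Longrightarrow> v \<in> V \<Longrightarrow> B v (a *\<^sub>R u) = a * B v u"
  by (metis B_scale_left B_commute V_scale)

lemma B_diff_left: "u \<in> V \<Longrightarrow> v \<in> V \<Longrightarrow> w \<in> V \<Longrightarrow> B (u - v) w = B u w - B v w"
  using B_add_left[of "u - v" v w] by simp

lemma B_diff_right: "u \<in> V \<Longrightarrow> v \<in> V \<Longrightarrow> w \<in> V \<Longrightarrow> B w (u - v) = B w u - B w v"
  using B_add_right[of "u - v" v w] by simp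

lemmas B_linear = B_add_left B_add_right B_diff_left B_diff_right B_scale_left B_scale_right

lemma N_nonneg [simp]: "u \<in> V \<Longrightarrow> 0 \<le> N u"
  by (simp add: N_def B_nonneg)

lemma N_sq: "u \<in> V \<Longrightarrow> (N u)\<^sup>2 = B u u"
  by (simp add: N_def B_nonneg)

lemma N_scale: "u \<in> V \<Longrightarrow> N (a *\<^sub>R u) = \<bar>a\<bar> * N u"
  by (simp add: N_def B_linear real_sqrt_mult flip: mult.assoc power2_eq_square)

lemma N_zero [simp]: "N 0 = 0"
  using N_scale[of 0 0] by simp

lemma Cauchy_Schwarz: assumes "u \<in> V" "v \<in> V" shows "\<bar>B u v\<bar> \<le> N u * N v"
proof -
  define a b c where "a = B u u" and "b = B u v" and "c = B v v"
  have p: "0 \<le> a - 2 * t * b + t\<^sup>2 * c" for t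
    using B_nonneg[of "u - t *\<^sub>R v"] assms
    by (simp add: B_linear a_def b_def c_def B_commute[of v u] algebra_simps power2_eq_square)
  have ac: "0 \<le> a" "0 \<le> c" using assms B_nonneg by (auto simp: a_def c_def)
  have "b\<^sup>2 \<le> a * c"
  proof (cases "c = 0")
    case True
    have "b = 0"
    proof (rule ccontr)
      assume "b \<noteq> 0"
      \<comment> \<open>In the degenerate case \<open>c = 0\<close> the polynomial is affine in
        \<open>t\<close>; at this \<open>t\<close> its value is -1.\<close>
      with p[of "(a + 1) / (2 * b)"] True show False by simp
    qed
    then show ?thesis using True by simp
  next
    case False
    then have "c > 0" using ac by simp
    then show ?thesis using p[of "b / c"]
      by (simp add: field_simps power2_eq_square)
  qed
  then have "sqrt (b\<^sup>2) \<le> sqrt (a * c)" by (rule real_sqrt_le_mono)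
  then show ?thesis by (simp add: N_def real_sqrt_mult a_def b_def c_def)
qed

lemma B_le: "u \<in> V \<Longrightarrow> v \<in> V \<Longrightarrow> B u v \<le> N u * N v"
  using Cauchy_Schwarz[of u v] by linarith

lemma N_triangle: assumes "u \<in> V" "v \<in> V" shows "N (u + v) \<le> N u + N v"
proof (rule power2_le_imp_le)
  have "(N (u + v))\<^sup>2 = (N u)\<^sup>2 + 2 * B u v + (N v)\<^sup>2"
    using assms by (simp add: N_sq B_linear B_commute[of v u])
  also have "\<dots> \<le> (N u + N v)\<^sup>2"
    using B_le[OF assms] by (simp add: power2_eq_square algebra_simps)
  finally show "(N (u + v))\<^sup>2 \<le> (N u + N v)\<^sup>2" .
qed (use assms in auto)

lemma N_minus_commute: "u \<in> V \<Longrightarrow> v \<in> V \<Longrightarrow> N (u - v) = N (v - u)"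
  using N_scale[of "u - v" "-1"] by simp

lemma N_diff_le: "u \<in> V \<Longrightarrow> v \<in> V \<Longrightarrow> N (u - v) \<le> N u + N v"
  using N_triangle[of u "(-1) *\<^sub>R v"] N_scale[of v "-1"] V_scale[of v "-1"] by simp

lemma N_triangle3: "u \<in> V \<Longrightarrow> v \<in> V \<Longrightarrow> w \<in> V \<Longrightarrow> N (u - w) \<le> N (u - v) + N (v - w)"
  using N_triangle[of "u - v" "v - w"] by simp

lemma N_reverse_triangle: assumes "u \<in> V" "v \<in> V" shows "\<bar>N u - N v\<bar> \<le> N (u - v)"
  using N_triangle[of "u - v" v] N_triangle[of "v - u" u] N_minus_commute[of u v] assms by auto

lemma N_eq_of_null: "u \<in> V \<Longrightarrow> v \<in> V \<Longrightarrow> N (u - v) = 0 \<Longrightarrow> N u = N v"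
  using N_reverse_triangle[of u v] by auto

lemma B_null: "u \<in> V \<Longrightarrow> v \<in> V \<Longrightarrow> N u = 0 \<Longrightarrow> B u v = 0"
  using Cauchy_Schwarz[of u v] by simp

lemma Cauchy_converges:
  assumes "\<And>n::nat. x n \<in> V" "\<And>e. e > 0 \<Longrightarrow> \<exists>n0. \<forall>m\<ge>n0. \<forall>n\<ge>n0. N (x m - x n) < e"
  shows "\<exists>l\<in>V. (\<lambda>n. N (x n - l)) \<longlonglongrightarrow> 0"
  using complete[of x] assms by (simp add: N_def)

lemma tendsto_B_right:
  assumes "\<And>n::nat. x n \<in> V" "l \<in> V" "w \<in> V" "(\<lambda>n. N (x n - l)) \<longlonglongrightarrow> 0"
  shows "(\<lambda>n. B (x n) w) \<longlonglongrightarrow> B l w"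
proof (rule LIM_zero_cancel, rule tendsto_rabs_zero_cancel, rule tendsto_sandwich[of "\<lambda>_. 0"])
  show "\<forall>\<^sub>F n in sequentially. \<bar>B (x n) w - B l w\<bar> \<le> N (x n - l) * N w"
    using Cauchy_Schwarz[of "x n - l" w for n] assms by (simp add: B_linear)
  show "(\<lambda>n. N (x n - l) * N w) \<longlonglongrightarrow> 0"
    using tendsto_mult_right[OF assms(4), of "N w"] by simp
qed auto

text \<open>The representing vector is the limit of a minimising sequence of \<open>B v v / 2 - L v\<close>; the
  parallelogram law makes such a sequence Cauchy.\<close>

lemma Riesz_representation:
  assumes L_add: "\<And>u v. u \<in> V \<Longrightarrow> v \<in> V \<Longrightarrow> L (u + v) = L u + L v"
    and L_scale: "\<And>u a. u \<in> V \<Longrightarrow> L (a *\<^sub>R u) = a * (L u :: real)"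
    and bdd: "\<And>u. u \<in> V \<Longrightarrow> \<bar>L u\<bar> \<le> C * N u"
  shows "\<exists>a\<in>V. \<forall>v\<in>V. B a v = L v"
proof -
  define J where "J v = B v v / 2 - L v" for v
  have J_lower: "- C\<^sup>2 / 2 \<le> J v" if "v \<in> V" for v
  proof -
    \<comment> \<open>Completing the square: \<open>J v\<close> is at least
      \<open>N v ^ 2 / 2 - C * N v\<close>.\<close>
    have "0 \<le> (N v - C)\<^sup>2" by simp
    then show ?thesis using bdd[OF that] N_sq[OF that]
      by (simp add: J_def power2_diff algebra_simps)
  qed
  define m where "m = Inf (J ` V)"
  have bb: "bdd_below (J ` V)" using J_lower by (auto intro!: bdd_belowI2)
  have m_le: "m \<le> J v" if "v \<in> V" for v
    unfolding m_def using bb that by (rule cINF_lower)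
  have "\<exists>v\<in>V. J v < m + 1 / Suc n" for n
  proof -
    have "Inf (J ` V) < m + 1 / Suc n" by (simp add: m_def)
    then show ?thesis using cInf_less_iff[of "J ` V"] bb V_zero by blast
  qed
  then obtain x where xV: "\<And>n. x n \<in> V" and xJ: "\<And>n. J (x n) < m + 1 / Suc n" by metis
  have par: "(N (x i - x j))\<^sup>2 \<le> 4 * (1 / Suc i + 1 / Suc j)" for i j
  proof -
    let ?h = "(1/2) *\<^sub>R (x i + x j)"
    have "(N (x i - x j))\<^sup>2 = 4 * (J (x i) + J (x j) - 2 * J ?h)"
      using xV[of i] xV[of j]
      by (simp add: J_def N_sq B_linear L_add L_scale B_commute[of "x j" "x i"] field_simps)
    also have "\<dots> \<le> 4 * (1 / Suc i + 1 / Suc j)"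
      using m_le[of ?h] xJ[of i] xJ[of j] xV by simp
    finally show ?thesis .
  qed
  have "\<exists>l\<in>V. (\<lambda>n. N (x n - l)) \<longlonglongrightarrow> 0"
  proof (rule Cauchy_converges[OF xV])
    fix e :: real assume "e > 0"
    obtain n0 where n0: "8 / e\<^sup>2 < real n0" using reals_Archimedean2 by blast
    show "\<exists>n0. \<forall>i\<ge>n0. \<forall>j\<ge>n0. N (x i - x j) < e"
    proof (intro exI allI impI)
      fix i j assume "i \<ge> n0" "j \<ge> n0"
      have inv: "1 / Suc k < e\<^sup>2 / 8" if "k \<ge> n0" for k
      proof -
        have "8 / e\<^sup>2 < Suc k" using n0 that by linarith
        then show ?thesis using \<open>e > 0\<close> by (simp add: field_simps)
      qed
      have "(N (x i - x j))\<^sup>2 \<le> 4 * (1 / Suc i + 1 / Suc j)" by (rule par)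
      also have "\<dots> < 4 * (e\<^sup>2 / 8 + e\<^sup>2 / 8)"
        by (intro mult_strict_left_mono add_strict_mono inv \<open>i \<ge> n0\<close> \<open>j \<ge> n0\<close>) auto
      finally have "(N (x i - x j))\<^sup>2 < e\<^sup>2" by simp
      then show "N (x i - x j) < e" using \<open>e > 0\<close> by (simp add: power_less_imp_less_base)
    qed
  qed
  then obtain l where l: "l \<in> V" "(\<lambda>n. N (x n - l)) \<longlonglongrightarrow> 0" by blast
  have "B l w = L w" if w: "w \<in> V" for w
  proof -
    have q: "\<bar>B (x n) w - L w\<bar> \<le> sqrt (1 / Suc n) * (1 + B w w / 2)" for n
    proof -
      \<comment> \<open>\<open>x n\<close> minimises \<open>J\<close> up to
        \<open>1 / Suc n\<close>. Perturbing it by \<open>d *\<^sub>R w\<close> with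
        \<open>d\<close> the square root of this defect makes the defect and the quadratic term both
        of order \<open>d * d\<close>, so dividing by \<open>d\<close> leaves an error of order
        \<open>d\<close>.\<close>
      define d where "d = sqrt (1 / real (Suc n))"
      have d: "d > 0" "d\<^sup>2 = 1 / Suc n" by (auto simp: d_def)
      have *: "- d\<^sup>2 \<le> t * (B (x n) w - L w) + t\<^sup>2 * B w w / 2" for t
        using m_le[of "x n + t *\<^sub>R w"] xJ[of n] xV[of n] w d
        by (simp add: J_def B_linear L_add L_scale B_commute[of w "x n"] algebra_simps power2_eq_square)
      have "d * (- d) \<le> d * (B (x n) w - L w + d * B w w / 2)"
        using *[of d] by (simp add: algebra_simps power2_eq_square)
      then have "- d \<le> B (x n) w - L w + d * B w w / 2"
        using d(1) by (rule mult_left_le_imp_le)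
      moreover have "d * (- d) \<le> d * (- (B (x n) w - L w) + d * B w w / 2)"
        using *[of "-d"] by (simp add: algebra_simps power2_eq_square)
      then have "- d \<le> - (B (x n) w - L w) + d * B w w / 2"
        using d(1) by (rule mult_left_le_imp_le)
      ultimately show ?thesis unfolding d_def[symmetric]
        by (simp add: algebra_simps abs_le_iff)
    qed
    have "(\<lambda>n. sqrt (1 / Suc n) * (1 + B w w / 2)) \<longlonglongrightarrow> sqrt 0 * (1 + B w w / 2)"
      by (intro tendsto_intros LIMSEQ_Suc lim_1_over_n)
    then have "(\<lambda>n. sqrt (1 / Suc n) * (1 + B w w / 2)) \<longlonglongrightarrow> 0" by simp
    then have "(\<lambda>n. B (x n) w - L w) \<longlonglongrightarrow> 0"
      by (rule Lim_null_comparison[rotated]) (use q in auto)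
    then have "(\<lambda>n. B (x n) w) \<longlonglongrightarrow> L w" by (rule LIM_zero_cancel)
    then show ?thesis using tendsto_B_right[OF xV l(1) w l(2)] LIMSEQ_unique by blast
  qed
  then show ?thesis using l by blast
qed


section \<open>Paths that are continuous for the seminorm\<close>

definition cpath :: "(real \<Rightarrow> 'v) \<Rightarrow> bool" where
  "cpath \<gamma> \<longleftrightarrow> (\<forall>\<tau>\<in>{0..1}. \<gamma> \<tau> \<in> V) \<and>
     (\<forall>\<tau>\<in>{0..1}. ((\<lambda>\<sigma>. N (\<gamma> \<sigma> - \<gamma> \<tau>)) \<longlongrightarrow> 0) (at \<tau> within {0..1}))"

lemma cpath_in: "cpath \<gamma> \<Longrightarrow> \<tau> \<in> {0..1} \<Longrightarrow> \<gamma> \<tau> \<in> V"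
  by (auto simp: cpath_def)

text \<open>The type \<open>'v\<close> carries no topology, so continuity of a functional is
  expressed through \<open>N\<close>; this rule turns it into ordinary continuity in the path
  parameter.\<close>

lemma cpath_continuous_on:
  fixes \<phi> :: "'v \<Rightarrow> real"
  assumes "cpath \<gamma>"
    and \<phi>: "\<And>w \<epsilon>. w \<in> V \<Longrightarrow> \<epsilon> > 0 \<Longrightarrow> \<exists>\<delta>>0. \<forall>v\<in>V. N (v - w) < \<delta> \<longrightarrow> \<bar>\<phi> v - \<phi> w\<bar> < \<epsilon>"
  shows "continuous_on {0..1} (\<lambda>\<tau>. \<phi> (\<gamma> \<tau>))"
  unfolding continuous_on_def
proof (intro ballI tendstoI)
  fix \<tau> \<epsilon> :: real assume \<tau>: "\<tau> \<in> {0..1}" and "\<epsilon> > 0"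
  obtain \<delta> where \<delta>: "\<delta> > 0" "\<And>v. v \<in> V \<Longrightarrow> N (v - \<gamma> \<tau>) < \<delta> \<Longrightarrow> \<bar>\<phi> v - \<phi> (\<gamma> \<tau>)\<bar> < \<epsilon>"
    using \<phi>[OF cpath_in[OF assms(1) \<tau>] \<open>\<epsilon> > 0\<close>] by blast
  have "((\<lambda>\<sigma>. N (\<gamma> \<sigma> - \<gamma> \<tau>)) \<longlongrightarrow> 0) (at \<tau> within {0..1})"
    using assms(1) \<tau> by (simp add: cpath_def)
  then have "\<forall>\<^sub>F \<sigma> in at \<tau> within {0..1}. N (\<gamma> \<sigma> - \<gamma> \<tau>) < \<delta>"
    using \<delta>(1) by (rule order_tendstoD)
  moreover have "\<forall>\<^sub>F \<sigma> in at \<tau> within {0..1}. \<sigma> \<in> {0..1}"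
    by (auto simp: eventually_at_filter)
  ultimately show "\<forall>\<^sub>F \<sigma> in at \<tau> within {0..1}. dist (\<phi> (\<gamma> \<sigma>)) (\<phi> (\<gamma> \<tau>)) < \<epsilon>"
    by eventually_elim (use \<delta>(2) cpath_in[OF assms(1)] in \<open>auto simp: dist_real_def\<close>)
qed

lemma cpath_map:
  assumes "cpath \<gamma>" and FV: "\<And>w. w \<in> V \<Longrightarrow> F w \<in> V"
    and F: "\<And>w \<epsilon>. w \<in> V \<Longrightarrow> \<epsilon> > 0 \<Longrightarrow> \<exists>\<delta>>0. \<forall>v\<in>V. N (v - w) < \<delta> \<longrightarrow> N (F v - F w) < \<epsilon>"
  shows "cpath (\<lambda>\<tau>. F (\<gamma> \<tau>))"
  unfolding cpath_def
proof (intro conjI ballI tendstoI)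
  fix \<tau> \<epsilon> :: real assume \<tau>: "\<tau> \<in> {0..1}" and "\<epsilon> > 0"
  obtain \<delta> where \<delta>: "\<delta> > 0" "\<And>v. v \<in> V \<Longrightarrow> N (v - \<gamma> \<tau>) < \<delta> \<Longrightarrow> N (F v - F (\<gamma> \<tau>)) < \<epsilon>"
    using F[OF cpath_in[OF assms(1) \<tau>] \<open>\<epsilon> > 0\<close>] by blast
  have "((\<lambda>\<sigma>. N (\<gamma> \<sigma> - \<gamma> \<tau>)) \<longlongrightarrow> 0) (at \<tau> within {0..1})"
    using assms(1) \<tau> by (simp add: cpath_def)
  then have "\<forall>\<^sub>F \<sigma> in at \<tau> within {0..1}. N (\<gamma> \<sigma> - \<gamma> \<tau>) < \<delta>"
    using \<delta>(1) by (rule order_tendstoD)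
  moreover have "\<forall>\<^sub>F \<sigma> in at \<tau> within {0..1}. \<sigma> \<in> {0..1}"
    by (auto simp: eventually_at_filter)
  ultimately show "\<forall>\<^sub>F \<sigma> in at \<tau> within {0..1}. dist (N (F (\<gamma> \<sigma>) - F (\<gamma> \<tau>))) 0 < \<epsilon>"
    by eventually_elim (use \<delta>(2) cpath_in[OF assms(1)] \<tau> FV in \<open>auto simp: dist_real_def\<close>)
qed (use cpath_in[OF assms(1)] FV in auto)

lemma cpath_add:
  assumes "cpath \<gamma>" "cpath \<gamma>'"
  shows "cpath (\<lambda>\<tau>. \<gamma> \<tau> + \<gamma>' \<tau>)"
  unfolding cpath_def
proof (intro conjI ballI)
  fix \<tau> :: real assume \<tau>: "\<tau> \<in> {0..1}"
  have lim: "((\<lambda>\<sigma>. N (\<gamma> \<sigma> - \<gamma> \<tau>) + N (\<gamma>' \<sigma> - \<gamma>' \<tau>)) \<longlongrightarrow> 0 + 0) (at \<tau> within {0..1})"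
    using assms \<tau> by (intro tendsto_add) (auto simp: cpath_def)
  have le: "\<forall>\<^sub>F \<sigma> in at \<tau> within {0..1}. norm (N (\<gamma> \<sigma> + \<gamma>' \<sigma> - (\<gamma> \<tau> + \<gamma>' \<tau>)))
      \<le> N (\<gamma> \<sigma> - \<gamma> \<tau>) + N (\<gamma>' \<sigma> - \<gamma>' \<tau>)"
    unfolding eventually_at_filter
    using N_triangle[of "\<gamma> \<sigma> - \<gamma> \<tau>" "\<gamma>' \<sigma> - \<gamma>' \<tau>" for \<sigma>] cpath_in[OF assms(1)] cpath_in[OF assms(2)] \<tau>
    by (intro always_eventually) (auto simp: algebra_simps)
  show "((\<lambda>\<sigma>. N (\<gamma> \<sigma> + \<gamma>' \<sigma> - (\<gamma> \<tau> + \<gamma>' \<tau>))) \<longlongrightarrow> 0) (at \<tau> within {0..1})"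
    by (rule Lim_null_comparison[OF le]) (use lim in simp)
qed (use cpath_in assms in auto)

lemma cpath_scale:
  assumes "cpath \<gamma>" "continuous_on {0..1} a"
  shows "cpath (\<lambda>\<tau>. a \<tau> *\<^sub>R \<gamma> \<tau>)"
  unfolding cpath_def
proof (intro conjI ballI)
  fix \<tau> :: real assume \<tau>: "\<tau> \<in> {0..1}"
  have a: "(a \<longlongrightarrow> a \<tau>) (at \<tau> within {0..1})"
    using assms(2) \<tau> by (simp add: continuous_on_def)
  have lim: "((\<lambda>\<sigma>. \<bar>a \<sigma>\<bar> * N (\<gamma> \<sigma> - \<gamma> \<tau>) + \<bar>a \<sigma> - a \<tau>\<bar> * N (\<gamma> \<tau>)) \<longlongrightarrow> \<bar>a \<tau>\<bar> * 0 + \<bar>a \<tau> - a \<tau>\<bar> * N (\<gamma> \<tau>))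
      (at \<tau> within {0..1})"
    using assms \<tau> by (intro tendsto_intros a) (auto simp: cpath_def)
  have le: "\<forall>\<^sub>F \<sigma> in at \<tau> within {0..1}. norm (N (a \<sigma> *\<^sub>R \<gamma> \<sigma> - a \<tau> *\<^sub>R \<gamma> \<tau>))
      \<le> \<bar>a \<sigma>\<bar> * N (\<gamma> \<sigma> - \<gamma> \<tau>) + \<bar>a \<sigma> - a \<tau>\<bar> * N (\<gamma> \<tau>)"
    unfolding eventually_at_filter
  proof (intro always_eventually allI impI)
    fix \<sigma> assume "\<sigma> \<in> {0..1::real}"
    then show "norm (N (a \<sigma> *\<^sub>R \<gamma> \<sigma> - a \<tau> *\<^sub>R \<gamma> \<tau>)) \<le> \<bar>a \<sigma>\<bar> * N (\<gamma> \<sigma> - \<gamma> \<tau>) + \<bar>a \<sigma> - a \<tau>\<bar> * N (\<gamma> \<tau>)"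
      using N_triangle[of "a \<sigma> *\<^sub>R (\<gamma> \<sigma> - \<gamma> \<tau>)" "(a \<sigma> - a \<tau>) *\<^sub>R \<gamma> \<tau>"] cpath_in[OF assms(1)] \<tau>
        N_scale[of "\<gamma> \<sigma> - \<gamma> \<tau>" "a \<sigma>"] N_scale[of "\<gamma> \<tau>" "a \<sigma> - a \<tau>"]
      by (simp add: scaleR_diff_left scaleR_diff_right)
  qed
  show "((\<lambda>\<sigma>. N (a \<sigma> *\<^sub>R \<gamma> \<sigma> - a \<tau> *\<^sub>R \<gamma> \<tau>)) \<longlongrightarrow> 0) (at \<tau> within {0..1})"
    by (rule Lim_null_comparison[OF le]) (use lim in simp)
qed (use cpath_in[OF assms(1)] in auto)

lemma N_continuous: "w \<in> V \<Longrightarrow> \<epsilon> > 0 \<Longrightarrow> \<exists>\<delta>>0. \<forall>v\<in>V. N (v - w) < \<delta> \<longrightarrow> \<bar>N v - N w\<bar> < \<epsilon>"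
  using N_reverse_triangle by (intro exI[of _ \<epsilon>]) (auto intro: le_less_trans)

end

text \<open>Only derivatives along lines are assumed for \<Psi>; with \<open>A_uniform\<close> and
  the mean value theorem they give all the smoothness needed. \<open>AR_bound\<close> is the
  integrated Ambrosetti-Rabinowitz inequality: its right side is \<theta> times the energy minus the
  derivative of the energy at \<open>u\<close> in direction \<open>u\<close>.\<close>

locale mountain_pass = semi_hilbert V B
  for V :: "'v::real_vector set" and B +
  fixes A :: "'v \<Rightarrow> 'v" and \<Psi> :: "'v \<Rightarrow> real" and \<rho> \<alpha> \<theta> C :: real and e :: 'v
  assumes A_in [simp, intro]: "u \<in> V \<Longrightarrow> A u \<in> V"
    and deriv_\<Psi>: "u \<in> V \<Longrightarrow> v \<in> V \<Longrightarrow> ((\<lambda>t. \<Psi> (u + t *\<^sub>R v)) has_real_derivative B (A u) v) (at 0)"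
    and A_uniform: "\<epsilon> > 0 \<Longrightarrow> \<exists>\<delta>>0. \<forall>u\<in>V. \<forall>v\<in>V.
        N u \<le> M \<longrightarrow> N v \<le> M \<longrightarrow> N (u - v) < \<delta> \<longrightarrow> N (A u - A v) < \<epsilon>"
    and A_compact: "(\<And>n::nat. x n \<in> V) \<Longrightarrow> (\<And>n. N (x n) \<le> M) \<Longrightarrow>
        \<exists>r::nat \<Rightarrow> nat. strict_mono r \<and>
          (\<forall>\<epsilon>>0. \<exists>n0. \<forall>m\<ge>n0. \<forall>n\<ge>n0. N (A (x (r m)) - A (x (r n))) < \<epsilon>)"
    and \<theta>: "\<theta> > 2"
    and AR_bound: "u \<in> V \<Longrightarrow>
        (\<theta> / 2 - 1) * (N u)\<^sup>2 - C \<le> \<theta> * ((N u)\<^sup>2 / 2 - \<Psi> u) - (B u u - B (A u) u)"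
    and \<rho>: "\<rho> > 0" and \<alpha>: "\<alpha> > 0"
    and sphere: "w \<in> V \<Longrightarrow> N w = \<rho> \<Longrightarrow> \<alpha> \<le> (N w)\<^sup>2 / 2 - \<Psi> w"
    and e_in [simp, intro]: "e \<in> V" and e_far: "N e > \<rho>"
    and e_low: "(N e)\<^sup>2 / 2 - \<Psi> e \<le> 0"
    and \<Psi>_zero: "\<Psi> 0 = 0"
begin

definition H :: "'v \<Rightarrow> real" where "H u = (N u)\<^sup>2 / 2 - \<Psi> u"
definition G :: "'v \<Rightarrow> 'v" where "G u = u - A u"

definition paths :: "(real \<Rightarrow> 'v) set" where
  "paths = {\<gamma>. cpath \<gamma> \<and> N (\<gamma> 0) = 0 \<and> N (\<gamma> 1 - e) = 0}"

definition level :: ereal where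
  "level = (INF \<gamma>\<in>paths. SUP \<tau>\<in>{0..1}. ereal (H (\<gamma> \<tau>)))"

lemma G_in [simp, intro]: "u \<in> V \<Longrightarrow> G u \<in> V"
  by (simp add: G_def)

lemma G_uniform:
  assumes "\<epsilon> > 0"
  shows "\<exists>\<delta>>0. \<forall>u\<in>V. \<forall>v\<in>V. N u \<le> M \<longrightarrow> N v \<le> M \<longrightarrow> N (u - v) < \<delta> \<longrightarrow> N (G u - G v) < \<epsilon>"
proof -
  obtain \<delta> where \<delta>: "\<delta> > 0" "\<And>u v. u \<in> V \<Longrightarrow> v \<in> V \<Longrightarrow> N u \<le> M \<Longrightarrow> N v \<le> M \<Longrightarrow> N (u - v) < \<delta> \<Longrightarrow>
      N (A u - A v) < \<epsilon> / 2"
    using A_uniform[of "\<epsilon>/2" M] assms by auto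
  show ?thesis
  proof (intro exI[of _ "min \<delta> (\<epsilon>/2)"] conjI ballI impI)
    fix u v assume "u \<in> V" "v \<in> V" "N u \<le> M" "N v \<le> M" "N (u - v) < min \<delta> (\<epsilon> / 2)"
    then show "N (G u - G v) < \<epsilon>"
      using N_diff_le[of "u - v" "A u - A v"] \<delta>(2)[of u v] by (auto simp: G_def algebra_simps)
  qed (use \<delta> assms in auto)
qed

lemma G_continuous:
  assumes "w \<in> V" "\<epsilon> > 0"
  shows "\<exists>\<delta>>0. \<forall>v\<in>V. N (v - w) < \<delta> \<longrightarrow> N (G v - G w) < \<epsilon>"
proof -
  obtain \<delta> where \<delta>: "\<delta> > 0" "\<And>u v. u \<in> V \<Longrightarrow> v \<in> V \<Longrightarrow> N u \<le> N w + 1 \<Longrightarrow> N v \<le> N w + 1 \<Longrightarrow>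
      N (u - v) < \<delta> \<Longrightarrow> N (G u - G v) < \<epsilon>"
    using G_uniform[OF assms(2), of "N w + 1"] by auto
  show ?thesis
  proof (intro exI[of _ "min \<delta> 1"] conjI ballI impI)
    fix v assume "v \<in> V" "N (v - w) < min \<delta> 1"
    then show "N (G v - G w) < \<epsilon>"
      using \<delta>(2)[of v w] N_reverse_triangle[of v w] assms by auto
  qed (use \<delta> in auto)
qed

lemma deriv_\<Psi>_at:
  assumes "u \<in> V" "v \<in> V"
  shows "((\<lambda>t. \<Psi> (u + t *\<^sub>R v)) has_real_derivative B (A (u + s *\<^sub>R v)) v) (at s)"
proof -
  have *: "((\<lambda>t. \<Psi> ((u + s *\<^sub>R v) + t *\<^sub>R v)) has_real_derivative B (A (u + s *\<^sub>R v)) v) (at (s - s))"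
    using deriv_\<Psi>[of "u + s *\<^sub>R v" v] assms by simp
  have "((\<lambda>t. t - s) has_real_derivative 1) (at s)"
    by (auto intro!: derivative_eq_intros)
  from DERIV_chain2[OF * this] show ?thesis
    by (simp add: algebra_simps)
qed

lemma deriv_H:
  assumes "u \<in> V" "v \<in> V"
  shows "((\<lambda>t. H (u + t *\<^sub>R v)) has_real_derivative B (G (u + s *\<^sub>R v)) v) (at s)"
proof -
  have eq: "(\<lambda>t. H (u + t *\<^sub>R v)) = (\<lambda>t. (B u u + 2 * t * B u v + t\<^sup>2 * B v v) / 2 - \<Psi> (u + t *\<^sub>R v))"
  proof
    fix t
    have "u + t *\<^sub>R v \<in> V" using assms by simp
    then show "H (u + t *\<^sub>R v) = (B u u + 2 * t * B u v + t\<^sup>2 * B v v) / 2 - \<Psi> (u + t *\<^sub>R v)"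
      using assms by (simp add: H_def N_sq B_linear B_commute[of v u] algebra_simps)
        (simp add: power2_eq_square)
  qed
  have "((\<lambda>t. (B u u + 2 * t * B u v + t\<^sup>2 * B v v) / 2) has_real_derivative B u v + s * B v v) (at s)"
    by (auto intro!: derivative_eq_intros)
  from DERIV_diff[OF this deriv_\<Psi>_at[OF assms]] show ?thesis unfolding eq
    using assms by (simp add: G_def B_linear)
qed

text \<open>This takes the place of Frechet differentiability: the gradient at the intermediate
  point is compared with the one at \<open>u\<close> by uniform continuity.\<close>

lemma H_mvt:
  assumes "u \<in> V" "v \<in> V"
  shows "\<exists>t. 0 < t \<and> t < 1 \<and> H (u + v) - H u = B (G (u + t *\<^sub>R v)) v"
  using MVT2[of 0 1 "\<lambda>t. H (u + t *\<^sub>R v)" "\<lambda>t. B (G (u + t *\<^sub>R v)) v"] deriv_H[OF assms] by auto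

text \<open>Along a sequence with unbounded images no subsequence of the images could be Cauchy,
  since Cauchy sequences are bounded.\<close>

lemma A_bounded: "\<exists>L. \<forall>u\<in>V. N u \<le> M \<longrightarrow> N (A u) \<le> L"
proof (rule ccontr)
  assume "\<nexists>L. \<forall>u\<in>V. N u \<le> M \<longrightarrow> N (A u) \<le> L"
  then have "\<exists>u\<in>V. N u \<le> M \<and> real n < N (A u)" for n by (meson not_le)
  then obtain x where x: "\<And>n. x n \<in> V" "\<And>n. N (x n) \<le> M" "\<And>n. real n < N (A (x n))" by metis
  obtain r :: "nat \<Rightarrow> nat" and n0 where r: "strict_mono r"
      "\<And>m n. m \<ge> n0 \<Longrightarrow> n \<ge> n0 \<Longrightarrow> N (A (x (r m)) - A (x (r n))) < 1"
    using A_compact[of x M] x by (metis zero_less_one)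
  obtain k where k: "N (A (x (r n0))) + 1 < real k" using reals_Archimedean2 by blast
  have "k \<le> r (max n0 k)" using seq_suble[OF r(1), of "max n0 k"] by linarith
  then have "N (A (x (r n0))) + 1 < N (A (x (r (max n0 k))))"
    using k x(3)[of "r (max n0 k)"] by linarith
  moreover have "N (A (x (r (max n0 k))) - A (x (r n0))) < 1" using r(2) by simp
  ultimately show False
    using N_reverse_triangle[of "A (x (r (max n0 k)))" "A (x (r n0))"] x(1) by auto
qed

text \<open>The gradient is bounded on balls and balls are convex, so the intermediate point of the
  mean value theorem stays where the bound holds.\<close>

lemma H_lipschitz:
  shows "\<exists>L\<ge>0. \<forall>u\<in>V. \<forall>v\<in>V. N u \<le> M \<longrightarrow> N v \<le> M \<longrightarrow> \<bar>H u - H v\<bar> \<le> L * N (u - v)"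
proof -
  obtain L where L: "\<And>u. u \<in> V \<Longrightarrow> N u \<le> M \<Longrightarrow> N (A u) \<le> L" using A_bounded by blast
  show ?thesis
  proof (intro exI[of _ "\<bar>M\<bar> + \<bar>L\<bar>"] conjI ballI impI)
    fix u v assume uv: "u \<in> V" "v \<in> V" "N u \<le> M" "N v \<le> M"
    obtain t where t: "0 < t" "t < 1" "H (v + (u - v)) - H v = B (G (v + t *\<^sub>R (u - v))) (u - v)"
      using H_mvt[of v "u - v"] uv by auto
    define w where "w = v + t *\<^sub>R (u - v)"
    have w: "w \<in> V" using uv by (simp add: w_def)
    have "w = (1 - t) *\<^sub>R v + t *\<^sub>R u" by (simp add: w_def algebra_simps)
    then have "N w \<le> (1 - t) * N v + t * N u"
      using N_triangle[of "(1 - t) *\<^sub>R v" "t *\<^sub>R u"] uv t by (simp add: N_scale)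
    also have "\<dots> \<le> (1 - t) * M + t * M" using uv t by (intro add_mono mult_left_mono) auto
    finally have "N w \<le> M" by (simp add: algebra_simps)
    then have "N (G w) \<le> \<bar>M\<bar> + \<bar>L\<bar>"
      using N_diff_le[of w "A w"] L[of w] w by (auto simp: G_def)
    then have "N (G w) * N (u - v) \<le> (\<bar>M\<bar> + \<bar>L\<bar>) * N (u - v)"
      using uv by (intro mult_right_mono) auto
    then show "\<bar>H u - H v\<bar> \<le> (\<bar>M\<bar> + \<bar>L\<bar>) * N (u - v)"
      using Cauchy_Schwarz[of "G w" "u - v"] t(3) w uv by (auto simp: w_def)
  qed auto
qed

lemma H_continuous:
  assumes "w \<in> V" "\<epsilon> > 0"
  shows "\<exists>\<delta>>0. \<forall>v\<in>V. N (v - w) < \<delta> \<longrightarrow> \<bar>H v - H w\<bar> < \<epsilon>"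
proof -
  obtain L where L: "L \<ge> 0" "\<And>u v. u \<in> V \<Longrightarrow> v \<in> V \<Longrightarrow> N u \<le> N w + 1 \<Longrightarrow> N v \<le> N w + 1 \<Longrightarrow>
      \<bar>H u - H v\<bar> \<le> L * N (u - v)"
    using H_lipschitz[of "N w + 1"] by auto
  show ?thesis
  proof (intro exI[of _ "min 1 (\<epsilon> / (L + 1))"] conjI ballI impI)
    fix v assume v: "v \<in> V" "N (v - w) < min 1 (\<epsilon> / (L + 1))"
    then have "\<bar>H v - H w\<bar> \<le> L * N (v - w)"
      using N_reverse_triangle[of v w] assms by (intro L) auto
    also have "\<dots> \<le> (L + 1) * N (v - w)" using v assms by (intro mult_right_mono) auto
    also have "\<dots> < \<epsilon>" using v L by (simp add: field_simps)
    finally show "\<bar>H v - H w\<bar> < \<epsilon>" .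
  qed (use assms L in auto)
qed

text \<open>Paths have their end points prescribed only up to null vectors; this makes the energy at
  the end points well defined.\<close>

lemma H_eq_of_null: assumes "u \<in> V" "v \<in> V" "N (u - v) = 0" shows "H u = H v"
proof -
  obtain t where t: "H (v + (u - v)) - H v = B (G (v + t *\<^sub>R (u - v))) (u - v)"
    using H_mvt[of v "u - v"] assms by auto
  then show ?thesis
    using Cauchy_Schwarz[of "G (v + t *\<^sub>R (u - v))" "u - v"] assms by auto
qed

lemma H_zero [simp]: "H 0 = 0"
  by (simp add: H_def \<Psi>_zero)

text \<open>A path starts at seminorm 0 and ends beyond \<rho>, so by the intermediate value theorem
  it meets the sphere where the energy is at least \<alpha>.\<close>

lemma level_ge: "ereal \<alpha> \<le> level"
  unfolding level_def
proof (rule INF_greatest)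
  fix \<gamma> assume "\<gamma> \<in> paths"
  then have \<gamma>: "cpath \<gamma>" "N (\<gamma> 0) = 0" "N (\<gamma> 1 - e) = 0" by (auto simp: paths_def)
  have "continuous_on {0..1} (\<lambda>\<tau>. N (\<gamma> \<tau>))"
    by (rule cpath_continuous_on[OF \<gamma>(1) N_continuous])
  moreover have "N (\<gamma> 1) > \<rho>"
    using N_eq_of_null[of "\<gamma> 1" e] \<gamma> cpath_in[of \<gamma> 1] e_far by auto
  ultimately obtain \<tau> where \<tau>: "0 \<le> \<tau>" "\<tau> \<le> 1" "N (\<gamma> \<tau>) = \<rho>"
    using IVT'[of "\<lambda>\<tau>. N (\<gamma> \<tau>)" 0 \<rho> 1] \<gamma> \<rho> by auto
  have "\<alpha> \<le> H (\<gamma> \<tau>)" using sphere[of "\<gamma> \<tau>"] \<tau> cpath_in[OF \<gamma>(1), of \<tau>] by (simp add: H_def)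
  then show "ereal \<alpha> \<le> (SUP \<tau>\<in>{0..1}. ereal (H (\<gamma> \<tau>)))"
    using \<tau> by (intro SUP_upper2[of \<tau>]) auto
qed

lemma cpath_H_continuous: "cpath \<gamma> \<Longrightarrow> continuous_on {0..1} (\<lambda>\<tau>. H (\<gamma> \<tau>))"
  by (rule cpath_continuous_on[OF _ H_continuous])

lemma segment_path: "(\<lambda>\<tau>. \<tau> *\<^sub>R e) \<in> paths"
proof -
  have "cpath (\<lambda>_. e)" by (simp add: cpath_def)
  from cpath_scale[OF this, of "\<lambda>\<tau>. \<tau>"] show ?thesis by (simp add: paths_def)
qed

lemma level_less_infinity: "level < \<infinity>"
proof -
  have "continuous_on {0..1} (\<lambda>\<tau>. H (\<tau> *\<^sub>R e))"
    using cpath_H_continuous segment_path by (auto simp: paths_def)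
  then have "compact ((\<lambda>\<tau>. H (\<tau> *\<^sub>R e)) ` {0..1})"
    by (rule compact_continuous_image) simp
  then obtain b where b: "\<And>\<tau>. \<tau> \<in> {0..1} \<Longrightarrow> H (\<tau> *\<^sub>R e) \<le> b"
    using compact_imp_bounded bounded_real by (metis abs_le_D1 imageI)
  have "level \<le> (SUP \<tau>\<in>{0..1}. ereal (H (\<tau> *\<^sub>R e)))"
    unfolding level_def by (rule INF_lower2[OF segment_path]) simp
  also have "\<dots> \<le> ereal b" using b by (intro SUP_least) auto
  finally show ?thesis by (auto simp: less_ereal.simps intro: le_less_trans)
qed

text \<open>The Palais--Smale condition in contrapositive form: along a sequence violating the bound,
  \<open>AR_bound\<close> bounds the norms and compactness of \<open>A\<close> yields a critical point at level \<open>c\<close>.\<close>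

lemma gradient_bounded_below:
  assumes "\<And>u. u \<in> V \<Longrightarrow> H u = c \<Longrightarrow> N (G u) \<noteq> 0"
  shows "\<exists>\<epsilon>>0. \<exists>\<delta>>0. \<forall>u\<in>V. \<bar>H u - c\<bar> \<le> \<epsilon> \<longrightarrow> \<delta> \<le> N (G u)"
proof (rule ccontr)
  assume neg: "\<not> ?thesis"
  have "\<exists>u\<in>V. \<bar>H u - c\<bar> \<le> 1 / Suc n \<and> N (G u) < 1 / Suc n" for n
  proof (rule ccontr)
    assume "\<not> ?thesis"
    then have "\<forall>u\<in>V. \<bar>H u - c\<bar> \<le> 1 / Suc n \<longrightarrow> 1 / Suc n \<le> N (G u)" by (meson not_le)
    moreover have "1 / real (Suc n) > 0" by simp
    ultimately show False using neg by blast
  qed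
  then obtain x where x: "\<And>n. x n \<in> V" "\<And>n. \<bar>H (x n) - c\<bar> \<le> 1 / Suc n" "\<And>n. N (G (x n)) < 1 / Suc n"
    by metis
  have inv1: "1 / real (Suc n) \<le> 1" for n by simp
  define k where "k = \<theta> / 2 - 1"
  have k: "k > 0" using \<theta> by (simp add: k_def)
  \<comment> \<open>Chosen so that \<open>k * (M - 1)\<close> equals the constant term plus 1. Since
    also \<open>M \<ge> 1\<close>, a larger norm makes the quadratic term exceed the constant and
    linear terms together.\<close>
  define M where "M = \<bar>C + \<theta> * (\<bar>c\<bar> + 1)\<bar> / k + 1 / k + 1"
  have M1: "M \<ge> 1" using k by (simp add: M_def)
  have bound: "N (x n) \<le> M" for n
  proof (rule ccontr)
    assume "\<not> N (x n) \<le> M"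
    then have big: "N (x n) > M" by simp
    have "k * (N (x n))\<^sup>2 - C \<le> \<theta> * H (x n) - B (G (x n)) (x n)"
      using AR_bound[OF x(1)[of n]] x(1)[of n] by (simp add: k_def H_def G_def B_linear)
    moreover have "- B (G (x n)) (x n) \<le> 1 * N (x n)"
    proof -
      have "- B (G (x n)) (x n) \<le> N (G (x n)) * N (x n)"
        using Cauchy_Schwarz[of "G (x n)" "x n"] x(1)[of n] by auto
      also have "\<dots> \<le> 1 * N (x n)"
        using less_imp_le[OF less_le_trans[OF x(3)[of n] inv1[of n]]] x(1)[of n]
        by (intro mult_right_mono) auto
      finally show ?thesis .
    qed
    moreover have "\<theta> * H (x n) \<le> \<theta> * (\<bar>c\<bar> + 1)"
      using order_trans[OF x(2)[of n] inv1[of n]] \<theta> by (intro mult_left_mono) auto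
    ultimately have "k * (N (x n))\<^sup>2 \<le> \<bar>C + \<theta> * (\<bar>c\<bar> + 1)\<bar> + N (x n)" by linarith
    also have "\<dots> \<le> \<bar>C + \<theta> * (\<bar>c\<bar> + 1)\<bar> * N (x n) + N (x n)"
      using big M1 mult_left_mono[of 1 "N (x n)" "\<bar>C + \<theta> * (\<bar>c\<bar> + 1)\<bar>"] by simp
    also have "\<dots> = k * ((M - 1) * N (x n))" using k by (simp add: M_def field_simps)
    also have "\<dots> < k * (N (x n))\<^sup>2"
      unfolding power2_eq_square using big M1 k by (intro mult_strict_left_mono mult_strict_right_mono) auto
    finally show False by simp
  qed
  obtain r :: "nat \<Rightarrow> nat" where r: "strict_mono r"
    "\<And>\<epsilon>. \<epsilon> > 0 \<Longrightarrow> \<exists>n0. \<forall>m\<ge>n0. \<forall>n\<ge>n0. N (A (x (r m)) - A (x (r n))) < \<epsilon>"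
    using A_compact[of x M] x(1) bound by metis
  have lim0: "(\<lambda>n. 1 / real (Suc (r n))) \<longlonglongrightarrow> 0"
    using LIMSEQ_subseq_LIMSEQ[OF LIMSEQ_Suc[OF lim_1_over_n] r(1)] by (simp add: o_def)
  have "\<exists>l\<in>V. (\<lambda>n. N (x (r n) - l)) \<longlonglongrightarrow> 0"
  proof (rule Cauchy_converges)
    fix \<epsilon> :: real assume "\<epsilon> > 0"
    obtain n1 where n1: "\<And>m n. m \<ge> n1 \<Longrightarrow> n \<ge> n1 \<Longrightarrow> N (A (x (r m)) - A (x (r n))) < \<epsilon> / 3"
      using r(2)[of "\<epsilon>/3"] \<open>\<epsilon> > 0\<close> by auto
    have "\<forall>\<^sub>F n in sequentially. 1 / real (Suc (r n)) < \<epsilon> / 3"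
      using lim0 \<open>\<epsilon> > 0\<close> by (intro order_tendstoD) auto
    then obtain n2 where n2: "\<And>n. n \<ge> n2 \<Longrightarrow> 1 / real (Suc (r n)) < \<epsilon> / 3"
      by (auto simp: eventually_sequentially)
    show "\<exists>n0. \<forall>m\<ge>n0. \<forall>n\<ge>n0. N (x (r m) - x (r n)) < \<epsilon>"
    proof (intro exI[of _ "max n1 n2"] allI impI)
      fix m n assume mn: "max n1 n2 \<le> m" "max n1 n2 \<le> n"
      let ?u = "x (r m)" and ?v = "x (r n)"
      \<comment> \<open>As \<open>u = G u + A u\<close> and the gradients tend to 0, the Cauchy
        property is inherited from the images under \<open>A\<close>.\<close>
      have "N (?u - ?v) = N ((G ?u - G ?v) + (A ?u - A ?v))" by (simp add: G_def)
      also have "\<dots> \<le> N (G ?u) + N (G ?v) + N (A ?u - A ?v)"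
        using N_triangle[of "G ?u - G ?v" "A ?u - A ?v"] N_diff_le[of "G ?u" "G ?v"] x(1) by auto
      also have "\<dots> < \<epsilon>"
        using n1[of m n] n2[of m] n2[of n] x(3)[of "r m"] x(3)[of "r n"] mn by auto
      finally show "N (?u - ?v) < \<epsilon>" .
    qed
  qed (use x in auto)
  then obtain l where l: "l \<in> V" "(\<lambda>n. N (x (r n) - l)) \<longlonglongrightarrow> 0" by blast
  have "\<bar>H l - c\<bar> < \<epsilon> \<and> N (G l) < \<epsilon>" if "\<epsilon> > 0" for \<epsilon>
  proof -
    have e2: "\<epsilon> / 2 > 0" using that by simp
    obtain d1 where d1: "d1 > 0" "\<And>v. v \<in> V \<Longrightarrow> N (v - l) < d1 \<Longrightarrow> \<bar>H v - H l\<bar> < \<epsilon> / 2"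
      using H_continuous[OF l(1) e2] by blast
    obtain d2 where d2: "d2 > 0" "\<And>v. v \<in> V \<Longrightarrow> N (v - l) < d2 \<Longrightarrow> N (G v - G l) < \<epsilon> / 2"
      using G_continuous[OF l(1) e2] by blast
    have "\<forall>\<^sub>F n in sequentially. N (x (r n) - l) < min d1 d2"
      using l(2) d1 d2 by (intro order_tendstoD) auto
    moreover have "\<forall>\<^sub>F n in sequentially. 1 / real (Suc (r n)) < \<epsilon> / 2"
      using lim0 e2 by (intro order_tendstoD) auto
    ultimately have "\<forall>\<^sub>F n in sequentially. N (x (r n) - l) < min d1 d2 \<and> 1 / real (Suc (r n)) < \<epsilon> / 2"
      by eventually_elim auto
    then obtain n where n: "N (x (r n) - l) < min d1 d2" "1 / real (Suc (r n)) < \<epsilon> / 2"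
      by (auto simp: eventually_sequentially)
    have "\<bar>H (x (r n)) - H l\<bar> < \<epsilon> / 2" "N (G (x (r n)) - G l) < \<epsilon> / 2"
      using d1(2) d2(2) x(1) n(1) by auto
    moreover have "\<bar>H (x (r n)) - c\<bar> < \<epsilon> / 2" "N (G (x (r n))) < \<epsilon> / 2"
      using x(2)[of "r n"] x(3)[of "r n"] n(2) by linarith+
    moreover have "\<bar>N (G (x (r n))) - N (G l)\<bar> \<le> N (G (x (r n)) - G l)"
      using N_reverse_triangle x(1) l(1) by blast
    ultimately show ?thesis by linarith
  qed
  then have "\<bar>H l - c\<bar> \<le> 0" "N (G l) \<le> 0"
    by (meson field_le_epsilon less_imp_le add_0 dense_le_bounded dense_ge)+
  then show False using assms[OF l(1)] l(1) by (simp add: antisym)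
qed

section \<open>Deformation near a level without critical points\<close>

context
  fixes c \<epsilon> \<delta> :: real
  assumes \<epsilon>: "\<epsilon> > 0" and \<delta>: "\<delta> > 0"
    and regular: "\<And>u. u \<in> V \<Longrightarrow> \<bar>H u - c\<bar> \<le> \<epsilon> \<Longrightarrow> \<delta> \<le> N (G u)"
begin

text \<open>The cut-off acts on the energy: it freezes points of energy at most
  \<open>c - \<epsilon>\<close>, hence the end points of paths, and is 1 from
  \<open>c - \<epsilon> / 2\<close> on, so that full steps are taken until that energy is
  reached.\<close>

definition \<kappa> :: "real \<Rightarrow> real" where
  "\<kappa> s = max 0 (min 1 ((s - (c - \<epsilon>)) / (\<epsilon> / 2)))"

text \<open>Where \<open>\<bar>H w - c\<bar> \<le> \<epsilon>\<close> the maximum equals the norm of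
  the gradient, so the direction is a unit vector. Elsewhere the bound \<delta> keeps the quotient
  continuous and its norm at most 1.\<close>

definition dir :: "'v \<Rightarrow> 'v" where
  "dir w = (1 / max \<delta> (N (G w))) *\<^sub>R G w"

definition euler :: "real \<Rightarrow> 'v \<Rightarrow> 'v" where
  "euler h w = w - (h * \<kappa> (H w)) *\<^sub>R dir w"

lemma \<kappa>_bounds: "0 \<le> \<kappa> s" "\<kappa> s \<le> 1"
  by (auto simp: \<kappa>_def)

lemma \<kappa>_low: "s \<le> c - \<epsilon> \<Longrightarrow> \<kappa> s = 0"
  using \<epsilon> by (auto simp: \<kappa>_def field_simps max_def min_def)

lemma \<kappa>_high: "s \<ge> c - \<epsilon> / 2 \<Longrightarrow> \<kappa> s = 1"
  using \<epsilon> by (auto simp: \<kappa>_def field_simps max_def min_def)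

lemma dir_in [simp, intro]: "w \<in> V \<Longrightarrow> dir w \<in> V"
  by (simp add: dir_def)

lemma N_dir_le: "w \<in> V \<Longrightarrow> N (dir w) \<le> 1"
  using \<delta> by (simp add: dir_def N_scale)

lemma euler_in [simp, intro]: "w \<in> V \<Longrightarrow> euler h w \<in> V"
  by (simp add: euler_def)

lemma N_euler_le:
  assumes "w \<in> V" "h \<ge> 0"
  shows "N (euler h w) \<le> N w + h"
proof -
  have "N (euler h w) \<le> N w + (h * \<kappa> (H w)) * N (dir w)"
    using N_diff_le[of w "(h * \<kappa> (H w)) *\<^sub>R dir w"] assms \<kappa>_bounds
    by (simp add: euler_def N_scale abs_mult)
  also have "(h * \<kappa> (H w)) * N (dir w) \<le> h * 1"
    unfolding mult.assoc using assms \<kappa>_bounds N_dir_le by (intro mult_left_mono mult_le_one) auto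
  finally show ?thesis by simp
qed

text \<open>At \<open>w\<close> the slope along the step is at least \<delta> in size. Within one
  step the gradient changes by less than \<open>\<delta> / 2\<close>, so at least half of the first
  order decrease survives. The step size depends on the ball only, not on the point.\<close>

lemma euler_descent:
  shows "\<exists>h0>0. \<forall>h w. 0 \<le> h \<longrightarrow> h \<le> h0 \<longrightarrow> w \<in> V \<longrightarrow> N w \<le> M \<longrightarrow> H w \<le> c + \<epsilon> \<longrightarrow>
    H (euler h w) \<le> H w - h * \<kappa> (H w) * \<delta> / 2"
proof -
  obtain d where d: "d > 0" "\<And>u v. u \<in> V \<Longrightarrow> v \<in> V \<Longrightarrow> N u \<le> M + 1 \<Longrightarrow> N v \<le> M + 1 \<Longrightarrow> N (u - v) < d \<Longrightarrow>
      N (G u - G v) < \<delta> / 2"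
    using G_uniform[of "\<delta>/2" "M + 1"] \<delta> by auto
  show ?thesis
  \<comment> \<open>The 1 keeps the step inside the ball of radius \<open>M + 1\<close> on which
    \<open>d\<close> was chosen; \<open>d / 2\<close> makes the step strictly shorter than
    \<open>d\<close>.\<close>
  proof (intro exI[of _ "min 1 (d/2)"] conjI allI impI)
    fix h w assume h: "0 \<le> h" "h \<le> min 1 (d/2)" and w: "w \<in> V" "N w \<le> M" "H w \<le> c + \<epsilon>"
    show "H (euler h w) \<le> H w - h * \<kappa> (H w) * \<delta> / 2"
    proof (cases "\<kappa> (H w) = 0")
      case True
      then show ?thesis by (simp add: euler_def)
    next
      case False
      then have "H w > c - \<epsilon>" using \<kappa>_low not_le by blast
      then have Gw: "\<delta> \<le> N (G w)" using regular[of w] w by auto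
      define k where "k = h * \<kappa> (H w)"
      have k: "0 \<le> k" "k \<le> h" using h \<kappa>_bounds by (auto simp: k_def mult_left_le)
      define v where "v = (- k) *\<^sub>R dir w"
      have v: "v \<in> V" using w unfolding v_def by blast
      have Nv: "N v \<le> k"
        using N_dir_le[of w] w k N_scale[OF dir_in[OF w(1)], of "-k"]
        unfolding v_def by (simp add: mult_left_le)
      obtain t where t: "0 < t" "t < 1" "H (w + v) - H w = B (G (w + t *\<^sub>R v)) v"
        using H_mvt[OF w(1) v] by auto
      have Ntv: "N (t *\<^sub>R v) \<le> h"
        using mult_left_le_one_le[of "N v" t] t Nv k v by (simp add: N_scale)
      have "N (G (w + t *\<^sub>R v) - G w) < \<delta> / 2"
        using N_triangle[of w "t *\<^sub>R v"] Ntv h w v d(1)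
        by (intro d) auto
      then have "N (G (w + t *\<^sub>R v) - G w) * N v \<le> (\<delta> / 2) * k"
        using Nv w v \<delta> by (intro mult_mono) auto
      then have 1: "B (G (w + t *\<^sub>R v) - G w) v \<le> \<delta> / 2 * k"
        using B_le[of "G (w + t *\<^sub>R v) - G w" v] w v by auto
      have "B (G w) (dir w) = N (G w)"
        using Gw \<delta> w by (simp add: dir_def B_linear max_def power2_eq_square flip: N_sq)
      then have 2: "B (G w) v = - (k * N (G w))"
        using B_scale_right[of "dir w" "G w" "- k"] w by (simp add: v_def)
      have 3: "k * \<delta> \<le> k * N (G w)" using Gw k by (intro mult_left_mono)
      have "H (euler h w) = H (w + v)" by (simp add: euler_def v_def k_def)
      also have "\<dots> = H w + B (G w) v + B (G (w + t *\<^sub>R v) - G w) v"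
        using t(3) w v by (simp add: B_linear)
      also have "\<dots> \<le> H w - k * \<delta> / 2" using 1 2 3 by (simp add: algebra_simps)
      finally show ?thesis by (simp add: k_def)
    qed
  qed (use d in auto)
qed

text \<open>Steps never increase the energy, so once it is below \<open>c - \<epsilon> / 2\<close>
  it stays there; before that the cut-off is 1 and each step gains \<open>h * \<delta> / 2\<close>.
  The maximum records these two possibilities.\<close>

lemma euler_iterate:
  assumes desc: "\<And>w. w \<in> V \<Longrightarrow> N w \<le> M \<Longrightarrow> H w \<le> c + \<epsilon> \<Longrightarrow> H (euler h w) \<le> H w - h * \<kappa> (H w) * \<delta> / 2"
    and h: "h \<ge> 0" and w: "w \<in> V" "N w + real n * h \<le> M" "H w \<le> c + \<epsilon>"
  shows "(euler h ^^ n) w \<in> V \<and> N ((euler h ^^ n) w) \<le> N w + real n * h \<and>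
    H ((euler h ^^ n) w) \<le> c + \<epsilon> \<and>
    H ((euler h ^^ n) w) \<le> max (c - \<epsilon> / 2) (H w - real n * h * \<delta> / 2)"
  using w
proof (induction n)
  case (Suc n)
  define y where "y = (euler h ^^ n) w"
  have "N w + real n * h \<le> M" using Suc.prems h by (simp add: algebra_simps)
  with Suc have y: "y \<in> V" "N y \<le> N w + real n * h" "H y \<le> c + \<epsilon>"
      "H y \<le> max (c - \<epsilon> / 2) (H w - real n * h * \<delta> / 2)" by (auto simp: y_def)
  have "N y \<le> M" using y \<open>N w + real n * h \<le> M\<close> by simp
  then have D: "H (euler h y) \<le> H y - h * \<kappa> (H y) * \<delta> / 2" using desc y by blast
  have nn: "0 \<le> h * \<kappa> (H y) * \<delta> / 2" using h \<delta> \<kappa>_bounds by auto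
  have "H (euler h y) \<le> max (c - \<epsilon> / 2) (H w - real (Suc n) * h * \<delta> / 2)"
  proof (cases "H y \<le> c - \<epsilon> / 2")
    case True
    then show ?thesis using D nn by simp
  next
    case False
    then have "H y \<le> H w - real n * h * \<delta> / 2" "\<kappa> (H y) = 1" using y(4) \<kappa>_high[of "H y"] by auto
    then have "H (euler h y) \<le> H w - real (Suc n) * h * \<delta> / 2" using D by (simp add: field_simps)
    then show ?thesis by simp
  qed
  then show ?case using y D nn N_euler_le[OF y(1) h]
    by (auto simp: y_def[symmetric] algebra_simps)
qed (use w in auto)

lemma euler_cpath:
  assumes "cpath \<gamma>"
  shows "cpath (\<lambda>\<tau>. euler h (\<gamma> \<tau>))"
proof -
  have 1: "cpath (\<lambda>\<tau>. G (\<gamma> \<tau>))" by (rule cpath_map[OF assms _ G_continuous]) auto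
  have 2: "continuous_on {0..1} (\<lambda>\<tau>. N (G (\<gamma> \<tau>)))" by (rule cpath_continuous_on[OF 1 N_continuous])
  have 3: "continuous_on {0..1} (\<lambda>\<tau>. - (h * \<kappa> (H (\<gamma> \<tau>))) * (1 / max \<delta> (N (G (\<gamma> \<tau>)))))"
    unfolding \<kappa>_def using \<delta> \<epsilon>
    by (intro continuous_intros cpath_H_continuous[OF assms] 2) auto
  show ?thesis
    using cpath_add[OF assms cpath_scale[OF 1 3]] by (simp add: euler_def dir_def)
qed

lemma euler_fixed: "H w \<le> c - \<epsilon> \<Longrightarrow> (euler h ^^ n) w = w"
  by (induction n) (simp_all add: euler_def \<kappa>_low)

lemma deformed_path:
  assumes \<gamma>: "\<gamma> \<in> paths" and low: "\<epsilon> \<le> c" and top: "\<And>\<tau>. \<tau> \<in> {0..1} \<Longrightarrow> H (\<gamma> \<tau>) \<le> c + \<epsilon>"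
  shows "\<exists>\<gamma>'\<in>paths. \<forall>\<tau>\<in>{0..1}. H (\<gamma>' \<tau>) \<le> c - \<epsilon> / 2"
proof -
  have cp: "cpath \<gamma>" using \<gamma> by (simp add: paths_def)
  have "compact ((\<lambda>\<tau>. N (\<gamma> \<tau>)) ` {0..1})"
    by (intro compact_continuous_image cpath_continuous_on[OF cp N_continuous]) auto
  then obtain M where M: "\<And>\<tau>. \<tau> \<in> {0..1} \<Longrightarrow> N (\<gamma> \<tau>) \<le> M"
    using compact_imp_bounded bounded_real by (metis abs_le_D1 imageI)
  \<comment> \<open>\<open>L\<close> is the total length of the steps: at rate
    \<open>\<delta> / 2\<close> it produces a decrease of \<open>2 * \<epsilon>\<close>, enough to
    pass from \<open>c + \<epsilon>\<close> to \<open>c - \<epsilon>\<close>. Norms grow by at most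
    \<open>L\<close>, whence the radius \<open>M + L\<close> below.\<close>
  define L where "L = 4 * \<epsilon> / \<delta>"
  have L: "L > 0" using \<epsilon> \<delta> by (simp add: L_def)
  obtain h0 where h0: "h0 > 0" "\<And>h w. 0 \<le> h \<Longrightarrow> h \<le> h0 \<Longrightarrow> w \<in> V \<Longrightarrow> N w \<le> M + L \<Longrightarrow> H w \<le> c + \<epsilon> \<Longrightarrow>
      H (euler h w) \<le> H w - h * \<kappa> (H w) * \<delta> / 2"
    using euler_descent[of "M + L"] by blast
  obtain n where n: "L / h0 < real n" using reals_Archimedean2 by blast
  have n0: "real n > 0" using n L h0 by (meson divide_pos_pos less_trans)
  define h where "h = L / n"
  have h: "0 \<le> h" "h \<le> h0" "real n * h = L"
    using n n0 L h0 by (auto simp: h_def field_simps)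
  define \<gamma>' where "\<gamma>' = (\<lambda>\<tau>. (euler h ^^ n) (\<gamma> \<tau>))"
  have "cpath (\<lambda>\<tau>. (euler h ^^ k) (\<gamma> \<tau>))" for k
  proof (induction k)
    case (Suc k)
    then show ?case using euler_cpath[of "\<lambda>\<tau>. (euler h ^^ k) (\<gamma> \<tau>)"] by simp
  qed (use cp in simp)
  then have cp': "cpath \<gamma>'" by (simp add: \<gamma>'_def)
  have V01: "\<gamma> 0 \<in> V" "\<gamma> 1 \<in> V" using cpath_in[OF cp] by auto
  \<comment> \<open>Both end points have energy at most 0, hence at most
    \<open>c - \<epsilon>\<close>, where the cut-off vanishes and the iteration does not move
    them.\<close>
  have "H (\<gamma> 0) = 0" using H_eq_of_null[of "\<gamma> 0" 0] V01 \<gamma> by (simp add: paths_def)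
  then have e0: "\<gamma>' 0 = \<gamma> 0" using euler_fixed low by (simp add: \<gamma>'_def)
  have "H (\<gamma> 1) = H e" using H_eq_of_null[of "\<gamma> 1" e] V01 \<gamma> by (simp add: paths_def)
  then have e1: "\<gamma>' 1 = \<gamma> 1" using euler_fixed low e_low by (simp add: \<gamma>'_def H_def)
  have "\<gamma>' \<in> paths" using cp' \<gamma> e0 e1 by (simp add: paths_def)
  moreover have "H (\<gamma>' \<tau>) \<le> c - \<epsilon> / 2" if \<tau>: "\<tau> \<in> {0..1}" for \<tau>
  proof -
    have "H (\<gamma>' \<tau>) \<le> max (c - \<epsilon> / 2) (H (\<gamma> \<tau>) - real n * h * \<delta> / 2)"
      using euler_iterate[where w = "\<gamma> \<tau>" and h = h and n = n and M = "M + L"] h0(2)[of h] h M[OF \<tau>] top[OF \<tau>] cpath_in[OF cp \<tau>]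
      by (auto simp: \<gamma>'_def)
    moreover have "real n * h * \<delta> / 2 = 2 * \<epsilon>" using h(3) \<delta> by (simp add: L_def)
    ultimately show ?thesis using top[OF \<tau>] \<epsilon> by auto
  qed
  ultimately show ?thesis by blast
qed

end

theorem critical_point_at_level: "\<exists>u\<in>V. N (G u) = 0 \<and> ereal (H u) = level"
proof (rule ccontr)
  assume neg: "\<not> ?thesis"
  obtain c where c: "level = ereal c"
    using level_ge level_less_infinity by (cases level) auto
  have ca: "\<alpha> \<le> c" using level_ge c by simp
  have "N (G u) \<noteq> 0" if "u \<in> V" "H u = c" for u using neg that c by auto
  from gradient_bounded_below[OF this] obtain \<epsilon>1 \<delta> where
    d: "\<epsilon>1 > 0" "\<delta> > 0" "\<And>u. u \<in> V \<Longrightarrow> \<bar>H u - c\<bar> \<le> \<epsilon>1 \<Longrightarrow> \<delta> \<le> N (G u)" by blast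
  \<comment> \<open>The bound by \<alpha> ensures \<open>\<epsilon> \<le> c\<close>, the condition
    that keeps end points fixed.\<close>
  define \<epsilon> where "\<epsilon> = min \<epsilon>1 \<alpha>"
  have \<epsilon>: "\<epsilon> > 0" "\<epsilon> \<le> \<epsilon>1" "\<epsilon> \<le> c" using d \<alpha> ca by (auto simp: \<epsilon>_def)
  have "level < ereal (c + \<epsilon>)" using c \<epsilon> by simp
  then obtain \<gamma> where \<gamma>: "\<gamma> \<in> paths" "(SUP \<tau>\<in>{0..1}. ereal (H (\<gamma> \<tau>))) < ereal (c + \<epsilon>)"
    unfolding level_def by (auto simp: INF_less_iff)
  have top: "H (\<gamma> \<tau>) \<le> c + \<epsilon>" if "\<tau> \<in> {0..1}" for \<tau>
    using le_less_trans[OF SUP_upper[OF that, of "\<lambda>\<tau>. ereal (H (\<gamma> \<tau>))"] \<gamma>(2)] by simp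
  obtain \<gamma>' where \<gamma>': "\<gamma>' \<in> paths" "\<And>\<tau>. \<tau> \<in> {0..1} \<Longrightarrow> H (\<gamma>' \<tau>) \<le> c - \<epsilon> / 2"
    using deformed_path[OF \<epsilon>(1) d(2) _ \<gamma>(1) \<epsilon>(3) top] d(3) \<epsilon>(2) by (meson order_trans)
  have "level \<le> (SUP \<tau>\<in>{0..1}. ereal (H (\<gamma>' \<tau>)))"
    unfolding level_def by (rule INF_lower[OF \<gamma>'(1)])
  also have "\<dots> \<le> ereal (c - \<epsilon> / 2)" using \<gamma>'(2) by (intro SUP_least) auto
  finally show False using c \<epsilon>(1) by simp
qed

end

section \<open>Semilinear problems for a quadratic difference form\<close>

text \<open>Together with pointwise addition this makes spaces of functions an instance of
  \<open>real_vector\<close>, the class over which \<open>semi_hilbert\<close> is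
  formulated.\<close>

instantiation "fun" :: (type, scaleR) scaleR
begin
definition "scaleR a f = (\<lambda>x. a *\<^sub>R f x)"
instance ..
end

lemma scaleR_fun_apply [simp]: "(a *\<^sub>R f) x = a *\<^sub>R f x"
  by (simp add: scaleR_fun_def)

instance "fun" :: (type, real_vector) real_vector
  by standard (auto simp: fun_eq_iff scaleR_add_right scaleR_add_left)

text \<open>Kernel and domain of integration are both put into the measure \<nu>, so the form
  becomes a plain integral of products of differences.\<close>

definition form_space :: "'a measure \<Rightarrow> 'a set \<Rightarrow> ('a \<times> 'a) measure \<Rightarrow> ('a \<Rightarrow> real) set" where
  "form_space M \<Omega> \<nu> = {u \<in> borel_measurable M. (AE x in M. x \<notin> \<Omega> \<longrightarrow> u x = 0) \<and>
     integrable \<nu> (\<lambda>z. (u (fst z) - u (snd z))\<^sup>2)}"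

definition form :: "('a \<times> 'a) measure \<Rightarrow> ('a \<Rightarrow> real) \<Rightarrow> ('a \<Rightarrow> real) \<Rightarrow> real" where
  "form \<nu> u v = (\<integral>z. (u (fst z) - u (snd z)) * (v (fst z) - v (snd z)) \<partial>\<nu>)"

text \<open>Young's inequality without optimal constants: depending on which of \<open>a\<close> and
  \<open>b powr (p - 1)\<close> is larger, one of the two terms alone dominates the product.\<close>

lemma Young_powr:
  fixes a b p :: real
  assumes "a \<ge> 0" "b \<ge> 0" "p > 1"
  shows "a * b \<le> a powr (p / (p - 1)) + b powr p"
proof (cases "a = 0 \<or> b = 0")
  case True
  then show ?thesis by auto
next
  case False
  then have ab: "a > 0" "b > 0" using assms by auto
  show ?thesis
  proof (cases "a \<le> b powr (p - 1)")
    case True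
    then have "a * b \<le> b powr (p - 1) * b powr 1" using ab by (intro mult_mono) auto
    also have "\<dots> = b powr p" unfolding powr_add[symmetric] by simp
    finally show ?thesis using powr_ge_zero[of a "p / (p - 1)"] by linarith
  next
    case False
    then have "(b powr (p - 1)) powr (1 / (p - 1)) \<le> a powr (1 / (p - 1))"
      using assms by (intro powr_mono2) auto
    then have "b \<le> a powr (1 / (p - 1))" using assms ab by (simp add: powr_powr)
    then have "a * b \<le> a powr 1 * a powr (1 / (p - 1))" using ab by (intro mult_mono) auto
    also have "\<dots> = a powr (p / (p - 1))"
      unfolding powr_add[symmetric] using assms by (simp add: field_simps)
    finally show ?thesis using powr_ge_zero[of b p] by linarith
  qed
qed

lemma powr_sum3_le:
  fixes a b p :: real
  assumes "a \<ge> 0" "b \<ge> 0" "p > 0"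
  shows "(1 + a + b) powr p \<le> 3 powr p * (1 + a powr p + b powr p)"
proof -
  define m where "m = max 1 (max a b)"
  have "(1 + a + b) powr p \<le> (3 * m) powr p"
    using assms by (intro powr_mono2) (auto simp: m_def)
  also have "\<dots> = 3 powr p * m powr p" by (simp add: powr_mult m_def)
  also have "m powr p \<le> 1 + a powr p + b powr p"
    by (auto simp: m_def max_def)
  finally show ?thesis by simp
qed

text \<open>\<open>AE_fst\<close> and \<open>AE_snd\<close> make the form insensitive to changes on
  null sets of \<open>M\<close>. Compactness is stated as almost everywhere convergence of a
  subsequence to a merely measurable limit; Fatou's lemma later puts the limit into the
  space.\<close>

locale dirichlet_form =
  fixes M :: "'a measure" and \<Omega> :: "'a set" and \<nu> :: "('a \<times> 'a) measure" and p CS :: real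
  assumes \<Omega>_sets [measurable]: "\<Omega> \<in> sets M" and \<Omega>_finite: "emeasure M \<Omega> < \<infinity>"
    and fst_measurable: "u \<in> borel_measurable M \<Longrightarrow> (\<lambda>z. u (fst z) :: real) \<in> borel_measurable \<nu>"
    and snd_measurable: "u \<in> borel_measurable M \<Longrightarrow> (\<lambda>z. u (snd z) :: real) \<in> borel_measurable \<nu>"
    and AE_fst: "(AE x in M. P x) \<Longrightarrow> AE z in \<nu>. P (fst z)"
    and AE_snd: "(AE x in M. P x) \<Longrightarrow> AE z in \<nu>. P (snd z)"
    and p: "p > 2" and CS: "CS > 0"
    and sobolev_integrable: "u \<in> form_space M \<Omega> \<nu> \<Longrightarrow> integrable M (\<lambda>x. \<bar>u x\<bar> powr p)"
    and sobolev: "u \<in> form_space M \<Omega> \<nu> \<Longrightarrow>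
        (\<integral>x. \<bar>u x\<bar> powr p \<partial>M) \<le> CS * sqrt (form \<nu> u u) powr p"
    and compact_embedding: "(\<And>n::nat. x n \<in> form_space M \<Omega> \<nu>) \<Longrightarrow>
        (\<And>n. sqrt (form \<nu> (x n) (x n)) \<le> b) \<Longrightarrow>
        \<exists>(r::nat \<Rightarrow> nat) l. strict_mono r \<and> l \<in> borel_measurable M \<and>
          (AE y in M. (\<lambda>n. x (r n) y) \<longlonglongrightarrow> l y)"
begin

abbreviation V where "V \<equiv> form_space M \<Omega> \<nu>"
abbreviation E where "E \<equiv> form \<nu>"

definition D :: "('a \<Rightarrow> real) \<Rightarrow> 'a \<times> 'a \<Rightarrow> real" where "D u z = u (fst z) - u (snd z)"

lemma D_linear: "D (u + v) z = D u z + D v z" "D (u - v) z = D u z - D v z" "D (a *\<^sub>R u) z = a * D u z"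
  by (simp_all add: D_def algebra_simps)

lemma D_measurable [measurable]: "u \<in> borel_measurable M \<Longrightarrow> D u \<in> borel_measurable \<nu>"
  unfolding D_def by (intro borel_measurable_diff fst_measurable snd_measurable)

lemma V_measurable: "u \<in> V \<Longrightarrow> u \<in> borel_measurable M"
  by (simp add: form_space_def)

lemma V_iff: "u \<in> V \<longleftrightarrow> u \<in> borel_measurable M \<and> (AE x in M. x \<notin> \<Omega> \<longrightarrow> u x = 0) \<and>
     integrable \<nu> (\<lambda>z. (D u z)\<^sup>2)"
  by (auto simp: form_space_def D_def)

lemma E_def': "E u v = (\<integral>z. D u z * D v z \<partial>\<nu>)"
  by (simp add: form_def D_def)

lemma D_integrable: assumes "u \<in> V" "v \<in> V" shows "integrable \<nu> (\<lambda>z. D u z * D v z)"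
proof (rule Bochner_Integration.integrable_bound)
  show "integrable \<nu> (\<lambda>z. (D u z)\<^sup>2 + (D v z)\<^sup>2)" using assms by (auto simp: V_iff)
  show "AE z in \<nu>. norm (D u z * D v z) \<le> norm ((D u z)\<^sup>2 + (D v z)\<^sup>2)"
  proof (rule AE_I2)
    fix z
    have "2 * \<bar>D u z\<bar> * \<bar>D v z\<bar> \<le> \<bar>D u z\<bar>\<^sup>2 + \<bar>D v z\<bar>\<^sup>2" by (rule sum_squares_bound)
    moreover have "0 \<le> \<bar>D u z\<bar> * \<bar>D v z\<bar>" by simp
    ultimately have "\<bar>D u z\<bar> * \<bar>D v z\<bar> \<le> (D u z)\<^sup>2 + (D v z)\<^sup>2"
      unfolding power2_abs by linarith
    then show "norm (D u z * D v z) \<le> norm ((D u z)\<^sup>2 + (D v z)\<^sup>2)"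
      by (simp add: abs_mult)
  qed
qed (use assms V_measurable in measurable)

lemma subspace_form_space: "subspace V"
proof (rule subspaceI)
  show "0 \<in> V" by (auto simp: V_iff D_def zero_fun_def)
next
  fix u v assume uv: "u \<in> V" "v \<in> V"
  have "(\<lambda>z. (D (u + v) z)\<^sup>2) = (\<lambda>z. (D u z)\<^sup>2 + (D v z)\<^sup>2 + 2 * (D u z * D v z))"
    by (auto simp: D_linear power2_eq_square algebra_simps)
  moreover have "integrable \<nu> (\<lambda>z. (D u z)\<^sup>2 + (D v z)\<^sup>2 + 2 * (D u z * D v z))"
    using uv D_integrable[OF uv] by (auto simp: V_iff)
  ultimately have "integrable \<nu> (\<lambda>z. (D (u + v) z)\<^sup>2)" by metis
  moreover have "AE x in M. x \<notin> \<Omega> \<longrightarrow> (u + v) x = 0"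
    using uv unfolding V_iff by auto
  moreover have "u + v \<in> borel_measurable M"
    using uv unfolding V_iff plus_fun_def by auto
  ultimately show "u + v \<in> V" by (auto simp: V_iff)
next
  fix a u assume u: "u \<in> V"
  have "integrable \<nu> (\<lambda>z. a\<^sup>2 * (D u z)\<^sup>2)" using u by (auto simp: V_iff)
  moreover have "a *\<^sub>R u \<in> borel_measurable M"
    using u unfolding V_iff scaleR_fun_def by auto
  ultimately show "a *\<^sub>R u \<in> V" using u by (auto simp: V_iff D_linear power_mult_distrib)
qed

lemma nn_integral_D: "u \<in> V \<Longrightarrow> (\<integral>\<^sup>+z. ennreal ((D u z)\<^sup>2) \<partial>\<nu>) = ennreal (E u u)"
  unfolding E_def' power2_eq_square[symmetric] by (rule nn_integral_eq_integral) (auto simp: V_iff)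

text \<open>Almost everywhere convergence of the functions passes to their differences, and Fatou's
  lemma bounds the energy of the limit; that bound is also what makes the limit a member of the
  space.\<close>

lemma form_Fatou:
  assumes y: "\<And>k. y k \<in> V" and l: "l \<in> borel_measurable M" "AE x in M. (\<lambda>k::nat. y k x) \<longlonglongrightarrow> l x"
    and le: "\<And>k. E (y k) (y k) \<le> c"
  shows "l \<in> V" "E l l \<le> c"
proof -
  have [measurable]: "y k \<in> borel_measurable M" for k using y by (rule V_measurable)
  note [measurable] = l(1)
  have c0: "0 \<le> c"
    by (rule order_trans[OF _ le[of 0]]) (auto simp: E_def' intro!: Bochner_Integration.integral_nonneg)
  have "AE z in \<nu>. (\<lambda>k. (D (y k) z)\<^sup>2) \<longlonglongrightarrow> (D l z)\<^sup>2"
    using AE_fst[OF l(2)] AE_snd[OF l(2)]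
  proof eventually_elim
    case (elim z)
    then show ?case unfolding D_def by (intro tendsto_intros)
  qed
  then have "AE z in \<nu>. ennreal ((D l z)\<^sup>2) = liminf (\<lambda>k. ennreal ((D (y k) z)\<^sup>2))"
    by eventually_elim (auto intro!: lim_imp_Liminf[symmetric])
  then have "(\<integral>\<^sup>+z. ennreal ((D l z)\<^sup>2) \<partial>\<nu>) = (\<integral>\<^sup>+z. liminf (\<lambda>k. ennreal ((D (y k) z)\<^sup>2)) \<partial>\<nu>)"
    by (rule nn_integral_cong_AE)
  also have "\<dots> \<le> liminf (\<lambda>k. \<integral>\<^sup>+z. ennreal ((D (y k) z)\<^sup>2) \<partial>\<nu>)"
    by (rule nn_integral_liminf) measurable
  also have "\<dots> \<le> liminf (\<lambda>k. ennreal c)"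
    by (rule Liminf_mono) (simp add: nn_integral_D[OF y] le ennreal_leI)
  finally have bd: "(\<integral>\<^sup>+z. ennreal ((D l z)\<^sup>2) \<partial>\<nu>) \<le> ennreal c" by (simp add: Liminf_const)
  have int: "integrable \<nu> (\<lambda>z. (D l z)\<^sup>2)"
    by (rule integrableI_bounded) (use le_less_trans[OF bd ennreal_less_top] in auto)
  have "AE x in M. \<forall>k. x \<notin> \<Omega> \<longrightarrow> y k x = 0"
    unfolding AE_all_countable using y by (auto simp: V_iff)
  then have "AE x in M. x \<notin> \<Omega> \<longrightarrow> l x = 0"
    using l(2)
  proof eventually_elim
    case (elim x)
    show ?case
    proof
      assume "x \<notin> \<Omega>"
      then have "(\<lambda>k. y k x) = (\<lambda>_. 0)" using elim by auto
      with elim show "l x = 0" using LIMSEQ_unique[OF _ tendsto_const] by metis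
    qed
  qed
  with int show lV: "l \<in> V" using l(1) by (auto simp: V_iff)
  show "E l l \<le> c" using bd c0 unfolding nn_integral_D[OF lV] by simp
qed

text \<open>For completeness, a Cauchy sequence is bounded, so a subsequence has an almost
  everywhere limit; lower semicontinuity of the form then upgrades this to convergence of the whole
  sequence in the seminorm.\<close>

sublocale semi_hilbert V E
proof
  show "subspace V" by (rule subspace_form_space)
next
  fix u v assume "u \<in> V" "v \<in> V" then show "E u v = E v u" by (simp add: E_def' mult.commute)
next
  fix u v w assume "u \<in> V" "v \<in> V" "w \<in> V"
  then show "E (u + v) w = E u w + E v w"
    by (simp add: E_def' D_linear distrib_right D_integrable)
next
  fix u v a assume "u \<in> V" "v \<in> V" then show "E (a *\<^sub>R u) v = a * E u v"
    by (simp add: E_def' D_linear mult.assoc)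
next
  fix u show "0 \<le> E u u" by (auto simp: E_def' intro!: Bochner_Integration.integral_nonneg)
next
  fix x :: "nat \<Rightarrow> 'a \<Rightarrow> real"
  assume xV: "\<And>n. x n \<in> V"
    and Cauchy: "\<And>e. e > 0 \<Longrightarrow> \<exists>n0. \<forall>m\<ge>n0. \<forall>n\<ge>n0. sqrt (E (x m - x n) (x m - x n)) < e"
  have V_diff: "u - v \<in> V" if "u \<in> V" "v \<in> V" for u v
    using subspace_form_space that by (rule subspace_diff)
  have sq: "(D (u - v) z)\<^sup>2 \<ge> 0" for u v z by simp
  have E_nonneg: "0 \<le> E u u" for u by (auto simp: E_def' intro!: Bochner_Integration.integral_nonneg)
  obtain n1 where n1: "\<And>n. n \<ge> n1 \<Longrightarrow> sqrt (E (x n - x n1) (x n - x n1)) < 1"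
    using Cauchy[of 1] by auto
  \<comment> \<open>The shift puts every term within distance 1 of \<open>x n1\<close>, which gives
    the uniform bound that the embedding asks for.\<close>
  define z where "z n = x (n1 + n)" for n
  have zb: "sqrt (E (z n) (z n)) \<le> sqrt (2 + 2 * E (x n1) (x n1))" for n
  proof -
    have "E (z n) (z n) \<le> (\<integral>w. 2 * (D (z n - x n1) w)\<^sup>2 + 2 * (D (x n1) w)\<^sup>2 \<partial>\<nu>)"
      unfolding E_def'
    proof (rule integral_mono)
      show "integrable \<nu> (\<lambda>w. 2 * (D (z n - x n1) w)\<^sup>2 + 2 * (D (x n1) w)\<^sup>2)"
        using V_diff[of "z n" "x n1"] xV by (auto simp: V_iff z_def)
      fix w
      have "0 \<le> (D (z n - x n1) w - D (x n1) w)\<^sup>2" by simp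
      then show "D (z n) w * D (z n) w \<le> 2 * (D (z n - x n1) w)\<^sup>2 + 2 * (D (x n1) w)\<^sup>2"
        by (simp add: D_linear power2_eq_square algebra_simps)
    qed (use D_integrable xV in \<open>auto simp: z_def\<close>)
    also have "\<dots> = 2 * E (z n - x n1) (z n - x n1) + 2 * E (x n1) (x n1)"
      using V_diff[of "z n" "x n1"] xV by (auto simp: V_iff z_def E_def' power2_eq_square)
    also have "E (z n - x n1) (z n - x n1) \<le> 1"
      using n1[of "n1 + n"] by (simp add: z_def)
    finally show ?thesis by simp
  qed
  obtain r l where r: "strict_mono r" and l: "l \<in> borel_measurable M" "AE y in M. (\<lambda>n. z (r n) y) \<longlonglongrightarrow> l y"
    using compact_embedding[of z, OF _ zb] xV by (auto simp: z_def)
  \<comment> \<open>With \<open>n\<close> fixed, Fatou's lemma is applied to the differences of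
    \<open>x n\<close> and later terms of the subsequence. Their energies are below the square of
    the tolerance by the Cauchy property, and so is that of the limit
    \<open>x n - l\<close>.\<close>
  have close: "x n - l \<in> V \<and> sqrt (E (x n - l) (x n - l)) \<le> e"
    if e: "e > 0" and n0: "\<forall>m\<ge>n0. \<forall>n\<ge>n0. sqrt (E (x m - x n) (x m - x n)) < e" and n: "n \<ge> n0" for e n n0
  proof -
    define y where "y k = x n - z (r (n0 + k))" for k
    have yV: "y k \<in> V" for k unfolding y_def z_def by (intro V_diff xV)
    have conv: "AE w in M. (\<lambda>k. y k w) \<longlonglongrightarrow> (x n - l) w"
      using l(2)
    proof eventually_elim
      case (elim w)
      then have "(\<lambda>k. z (r (n0 + k)) w) \<longlonglongrightarrow> l w"
        using LIMSEQ_ignore_initial_segment[of "\<lambda>k. z (r k) w" "l w" n0] by (simp add: add.commute)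
      then show ?case by (auto simp: y_def intro!: tendsto_intros)
    qed
    have meas: "x n - l \<in> borel_measurable M"
      using V_measurable[OF xV[of n]] l(1) by (auto simp: fun_diff_def)
    have Ey: "E (y k) (y k) \<le> e\<^sup>2" for k
    proof -
      have "n0 + k \<le> r (n0 + k)" by (rule seq_suble[OF r])
      then have "sqrt (E (y k) (y k)) < e" using n0 n by (auto simp: y_def z_def)
      then show ?thesis using e E_nonneg real_sqrt_less_iff[of "E (y k) (y k)" "e\<^sup>2"] by simp
    qed
    show ?thesis using form_Fatou[where l = "x n - l", OF yV meas conv Ey] e
      by (auto intro: real_le_lsqrt E_nonneg)
  qed
  obtain n0 where n0: "\<forall>m\<ge>n0. \<forall>n\<ge>n0. sqrt (E (x m - x n) (x m - x n)) < 1" using Cauchy[of 1] by auto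
  have "x n0 - l \<in> V" using close[OF _ n0, of n0] by simp
  then have "l \<in> V" using V_diff[OF xV[of n0], of "x n0 - l"] by simp
  moreover have "(\<lambda>n. sqrt (E (x n - l) (x n - l))) \<longlonglongrightarrow> 0"
  proof (rule LIMSEQ_I)
    fix e :: real assume "e > 0"
    then obtain n0 where n0: "\<forall>m\<ge>n0. \<forall>n\<ge>n0. sqrt (E (x m - x n) (x m - x n)) < e / 2" using Cauchy[of "e/2"] by auto
    have "norm (sqrt (E (x n - l) (x n - l)) - 0) < e" if "n \<ge> n0" for n
      using close[OF _ n0 that] \<open>e > 0\<close> by (auto simp: E_nonneg)
    then show "\<exists>n0. \<forall>n\<ge>n0. norm (sqrt (E (x n - l) (x n - l)) - 0) < e" by blast
  qed
  ultimately show "\<exists>l\<in>V. (\<lambda>n. sqrt (E (x n - l) (x n - l))) \<longlonglongrightarrow> 0" by blast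
qed

lemma sobolev_N: "u \<in> V \<Longrightarrow> (\<integral>x. \<bar>u x\<bar> powr p \<partial>M) \<le> CS * N u powr p"
  using sobolev by (simp add: N_def)

lemma compact_embedding_N:
  assumes "\<And>n::nat. x n \<in> V" "\<And>n. N (x n) \<le> b"
  shows "\<exists>(r::nat \<Rightarrow> nat). \<exists>l\<in>V. strict_mono r \<and> N l \<le> b \<and> (AE y in M. (\<lambda>n. x (r n) y) \<longlonglongrightarrow> l y)"
proof -
  obtain r l where r: "strict_mono r" and l: "l \<in> borel_measurable M" "AE y in M. (\<lambda>n. x (r n) y) \<longlonglongrightarrow> l y"
    using compact_embedding[of x b] assms by (auto simp: N_def)
  have b: "0 \<le> b" using N_nonneg[OF assms(1)] assms(2) order_trans by blast
  have "E (x (r k)) (x (r k)) \<le> b\<^sup>2" for k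
    using power_mono[OF assms(2)[of "r k"], of 2] assms(1) by (simp add: N_sq)
  from form_Fatou[OF _ l this] have "l \<in> V" "E l l \<le> b\<^sup>2" using assms by auto
  moreover have "N l \<le> b" unfolding N_def using \<open>E l l \<le> b\<^sup>2\<close> b by (rule real_le_lsqrt[rotated])
  ultimately show ?thesis using r l by blast
qed

text \<open>With its converse below this identifies the null vectors of the form with the functions
  vanishing almost everywhere, so equality in \<open>Z\<^sub>0\<close> can be tested by the
  seminorm.\<close>

lemma AE_zero_of_N_zero: assumes "u \<in> V" "N u = 0" shows "AE x in M. u x = 0"
proof -
  have "(\<integral>x. \<bar>u x\<bar> powr p \<partial>M) \<le> 0" using sobolev_N[OF assms(1)] assms(2) by simp
  moreover have "(\<integral>x. \<bar>u x\<bar> powr p \<partial>M) \<ge> 0" by simp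
  ultimately have "(\<integral>x. \<bar>u x\<bar> powr p \<partial>M) = 0" by linarith
  then have "AE x in M. \<bar>u x\<bar> powr p = 0"
    using integral_nonneg_eq_0_iff_AE[OF sobolev_integrable[OF assms(1)]] by simp
  then show ?thesis by eventually_elim simp
qed

lemma N_zero_of_AE_zero: assumes "u \<in> V" "AE x in M. u x = 0" shows "N u = 0"
proof -
  have "AE z in \<nu>. D u z * D u z = 0"
    using AE_fst[OF assms(2)] AE_snd[OF assms(2)] by eventually_elim (simp add: D_def)
  then have "E u u = (\<integral>z. 0 \<partial>\<nu>)" unfolding E_def'
    using V_measurable[OF assms(1)] by (intro integral_cong_AE) auto
  then show ?thesis by (simp add: N_def)
qed

text \<open>One majorant for all growth terms. The indicator makes the constant 1 integrable, as
  \<Omega> has finite measure.\<close>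

lemma power_integrable:
  assumes "u \<in> V" "v \<in> V"
  shows "integrable M (\<lambda>x. indicator \<Omega> x * (1 + \<bar>u x\<bar> + \<bar>v x\<bar>) powr p)"
    and "(\<integral>x. indicator \<Omega> x * (1 + \<bar>u x\<bar> + \<bar>v x\<bar>) powr p \<partial>M) \<le>
      3 powr p * (measure M \<Omega> + CS * N u powr p + CS * N v powr p)"
proof -
  have [measurable]: "u \<in> borel_measurable M" "v \<in> borel_measurable M"
    using assms V_measurable by auto
  have 1: "integrable M (indicat_real \<Omega>)" using \<Omega>_finite by (simp add: less_top)
  have 2: "integrable M (\<lambda>x. 3 powr p * (indicat_real \<Omega> x + \<bar>u x\<bar> powr p + \<bar>v x\<bar> powr p))"
    using 1 sobolev_integrable assms by auto
  have le: "indicator \<Omega> x * (1 + \<bar>u x\<bar> + \<bar>v x\<bar>) powr p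
      \<le> 3 powr p * (indicator \<Omega> x + \<bar>u x\<bar> powr p + \<bar>v x\<bar> powr p)" for x
    using powr_sum3_le[of "\<bar>u x\<bar>" "\<bar>v x\<bar>" p] p by (auto simp: indicator_def)
  show I: "integrable M (\<lambda>x. indicator \<Omega> x * (1 + \<bar>u x\<bar> + \<bar>v x\<bar>) powr p)"
    by (rule Bochner_Integration.integrable_bound[OF 2]) (use le in \<open>auto simp: abs_mult\<close>)
  have "(\<integral>x. indicator \<Omega> x * (1 + \<bar>u x\<bar> + \<bar>v x\<bar>) powr p \<partial>M)
      \<le> (\<integral>x. 3 powr p * (indicat_real \<Omega> x + \<bar>u x\<bar> powr p + \<bar>v x\<bar> powr p) \<partial>M)"
    by (rule integral_mono[OF I 2 le])
  also have "\<dots> = 3 powr p * (measure M \<Omega> + (\<integral>x. \<bar>u x\<bar> powr p \<partial>M) + (\<integral>x. \<bar>v x\<bar> powr p \<partial>M))"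
    using 1 sobolev_integrable assms \<Omega>_finite by simp
  also have "\<dots> \<le> 3 powr p * (measure M \<Omega> + CS * N u powr p + CS * N v powr p)"
    using sobolev_N assms by (intro mult_left_mono add_mono) auto
  finally show "(\<integral>x. indicator \<Omega> x * (1 + \<bar>u x\<bar> + \<bar>v x\<bar>) powr p \<partial>M) \<le>
      3 powr p * (measure M \<Omega> + CS * N u powr p + CS * N v powr p)" .
qed

text \<open>The inequality \<open>t ^ 2 \<le> 1 + \<bar>t\<bar> powr p\<close> on \<Omega> gives a
  bound that is not homogeneous; applied to \<open>u\<close> divided by its norm it becomes
  quadratic.\<close>

lemma square_integral_le:
  assumes "u \<in> V"
  shows "integrable M (\<lambda>x. (u x)\<^sup>2)" and "(\<integral>x. (u x)\<^sup>2 \<partial>M) \<le> (measure M \<Omega> + CS) * (N u)\<^sup>2"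
proof -
  note [measurable] = V_measurable[OF assms]
  have 1: "integrable M (indicat_real \<Omega>)" using \<Omega>_finite by (simp add: less_top)
  have gen: "integrable M (\<lambda>x. (v x)\<^sup>2) \<and> (\<integral>x. (v x)\<^sup>2 \<partial>M) \<le> measure M \<Omega> + CS * N v powr p" if v: "v \<in> V" for v
  proof -
    note [measurable] = V_measurable[OF v]
    have 2: "integrable M (\<lambda>x. indicat_real \<Omega> x + \<bar>v x\<bar> powr p)"
      using 1 sobolev_integrable v by auto
    have le: "AE x in M. (v x)\<^sup>2 \<le> indicator \<Omega> x + \<bar>v x\<bar> powr p"
    proof -
      have "AE x in M. x \<notin> \<Omega> \<longrightarrow> v x = 0" using v by (simp add: V_iff)
      then show ?thesis
    proof eventually_elim
      case (elim x)
      show ?case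
      proof (cases "x \<in> \<Omega>")
        case True
        show ?thesis
        proof (cases "\<bar>v x\<bar> \<le> 1")
          case True
          then have "\<bar>v x\<bar>\<^sup>2 \<le> 1" by (intro power_le_one) auto
          then show ?thesis using \<open>x \<in> \<Omega>\<close> by (simp add: add_increasing2)
        next
          case False
          then have "\<bar>v x\<bar> powr 2 \<le> \<bar>v x\<bar> powr p" using p by (intro powr_mono) auto
          then show ?thesis using False \<open>x \<in> \<Omega>\<close> by (simp add: add_increasing)
        qed
      qed (use elim in simp)
    qed
    qed
    have I: "integrable M (\<lambda>x. (v x)\<^sup>2)"
      by (rule Bochner_Integration.integrable_bound[OF 2]) (use le in auto)
    have "(\<integral>x. (v x)\<^sup>2 \<partial>M) \<le> (\<integral>x. indicat_real \<Omega> x + \<bar>v x\<bar> powr p \<partial>M)"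
      by (rule integral_mono_AE[OF I 2 le])
    also have "\<dots> \<le> measure M \<Omega> + CS * N v powr p"
      using 1 sobolev_integrable[OF v] sobolev_N[OF v] \<Omega>_finite by simp
    finally show ?thesis using I by blast
  qed
  show "integrable M (\<lambda>x. (u x)\<^sup>2)" using gen assms by blast
  show "(\<integral>x. (u x)\<^sup>2 \<partial>M) \<le> (measure M \<Omega> + CS) * (N u)\<^sup>2"
  proof (cases "N u = 0")
    case True
    have "AE x in M. (u x)\<^sup>2 = 0" using AE_zero_of_N_zero[OF assms True] by eventually_elim simp
    then have "(\<integral>x. (u x)\<^sup>2 \<partial>M) = (\<integral>x. 0 \<partial>M)" by (intro integral_cong_AE) auto
    then show ?thesis using True by simp
  next
    case False
    then have Nu: "N u > 0" using N_nonneg[OF assms] by linarith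
    have "(\<integral>x. (((1 / N u) *\<^sub>R u) x)\<^sup>2 \<partial>M) \<le> measure M \<Omega> + CS * N ((1 / N u) *\<^sub>R u) powr p"
      using gen assms by blast
    then show ?thesis using Nu assms by (simp add: N_scale power_divide field_simps)
  qed
qed

text \<open>Young's inequality with a free weight \<kappa>, applied to \<open>v\<close> divided by
  its norm, replaces Hoelder's inequality. A small \<kappa> controls the second term, after which a
  small integral of \<open>g\<close> controls the first.\<close>

lemma dual_bound:
  assumes g [measurable]: "g \<in> borel_measurable M"
    and gi: "integrable M (\<lambda>x. \<bar>g x\<bar> powr (p / (p - 1)))" and v: "v \<in> V"
  shows "integrable M (\<lambda>x. g x * v x)"
    and "\<kappa> > 0 \<Longrightarrow> \<bar>\<integral>x. g x * v x \<partial>M\<bar> \<le>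
      (\<kappa> powr (- (p / (p - 1))) * (\<integral>x. \<bar>g x\<bar> powr (p / (p - 1)) \<partial>M) + \<kappa> powr p * CS) * N v"
proof -
  note [measurable] = V_measurable[OF v]
  let ?q = "p / (p - 1)"
  have le: "\<bar>g x * w x\<bar> \<le> \<kappa> powr (- ?q) * \<bar>g x\<bar> powr ?q + \<kappa> powr p * \<bar>w x\<bar> powr p" if "\<kappa> > 0" for \<kappa> x and w :: "'a \<Rightarrow> real"
  proof -
    have "\<bar>g x * w x\<bar> = (\<bar>g x\<bar> / \<kappa>) * (\<kappa> * \<bar>w x\<bar>)" using that by (simp add: abs_mult)
    also have "\<dots> \<le> (\<bar>g x\<bar> / \<kappa>) powr ?q + (\<kappa> * \<bar>w x\<bar>) powr p"
      using that p by (intro Young_powr) auto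
    finally show ?thesis using that by (simp add: powr_mult powr_divide powr_minus_divide)
  qed
  have int: "integrable M (\<lambda>x. g x * w x)" if w: "w \<in> V" for w
  proof (rule Bochner_Integration.integrable_bound)
    note [measurable] = V_measurable[OF w]
    show "integrable M (\<lambda>x. \<bar>g x\<bar> powr ?q + \<bar>w x\<bar> powr p)" using gi sobolev_integrable[OF w] by auto
    show "(\<lambda>x. g x * w x) \<in> borel_measurable M" by measurable
    show "AE x in M. norm (g x * w x) \<le> norm (\<bar>g x\<bar> powr ?q + \<bar>w x\<bar> powr p)"
      using le[of 1 _ w] by auto
  qed
  show "integrable M (\<lambda>x. g x * v x)" using int v .
  assume \<kappa>: "\<kappa> > 0"
  have bd: "\<bar>\<integral>x. g x * w x \<partial>M\<bar> \<le> \<kappa> powr (- ?q) * (\<integral>x. \<bar>g x\<bar> powr ?q \<partial>M) + \<kappa> powr p * (CS * N w powr p)"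
    if w: "w \<in> V" for w
  proof -
    have "\<bar>\<integral>x. g x * w x \<partial>M\<bar> \<le> (\<integral>x. \<bar>g x * w x\<bar> \<partial>M)" by (rule integral_abs_bound)
    also have "\<dots> \<le> (\<integral>x. \<kappa> powr (- ?q) * \<bar>g x\<bar> powr ?q + \<kappa> powr p * \<bar>w x\<bar> powr p \<partial>M)"
      using int[OF w] gi sobolev_integrable[OF w] le[OF \<kappa>] by (intro integral_mono) auto
    also have "\<dots> = \<kappa> powr (- ?q) * (\<integral>x. \<bar>g x\<bar> powr ?q \<partial>M) + \<kappa> powr p * (\<integral>x. \<bar>w x\<bar> powr p \<partial>M)"
      using gi sobolev_integrable[OF w] by simp
    also have "\<dots> \<le> \<kappa> powr (- ?q) * (\<integral>x. \<bar>g x\<bar> powr ?q \<partial>M) + \<kappa> powr p * (CS * N w powr p)"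
      using sobolev_N[OF w] by (intro add_left_mono mult_left_mono) auto
    finally show ?thesis .
  qed
  show "\<bar>\<integral>x. g x * v x \<partial>M\<bar> \<le> (\<kappa> powr (- ?q) * (\<integral>x. \<bar>g x\<bar> powr ?q \<partial>M) + \<kappa> powr p * CS) * N v"
  proof (cases "N v = 0")
    case True
    have "AE x in M. g x * v x = 0" using AE_zero_of_N_zero[OF v True] by eventually_elim simp
    then have "(\<integral>x. g x * v x \<partial>M) = (\<integral>x. 0 \<partial>M)" by (intro integral_cong_AE) auto
    then show ?thesis using True by simp
  next
    case False
    then have Nv: "N v > 0" using N_nonneg[OF v] by linarith
    have "(1 / N v) *\<^sub>R v \<in> V" using v by blast
    from bd[OF this] show ?thesis using Nv v
      by (simp add: N_scale field_simps abs_divide)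
  qed
qed

end

text \<open>All conditions are required at every point, which is achieved later by changing
  \<open>f\<close> on a null set and shrinking \<Omega> accordingly. The bounded nonnegative
  function \<phi> supplies the ray along which the energy becomes negative.\<close>

locale nonlinear_problem = dirichlet_form +
  fixes f F :: "'a \<Rightarrow> real \<Rightarrow> real" and a q \<theta> R b :: real and \<phi> :: "'a \<Rightarrow> real"
  assumes f_measurable: "(\<lambda>x. f x l) \<in> borel_measurable M"
    and f_continuous: "continuous_on UNIV (f x)"
    and f_outside: "x \<notin> \<Omega> \<Longrightarrow> f x l = 0" and F_outside: "x \<notin> \<Omega> \<Longrightarrow> F x l = 0"
    and F_deriv: "(F x has_real_derivative f x l) (at l)" and F_zero: "F x 0 = 0"
    and a: "a > 0" and q: "2 < q" "q < p"
    and growth: "x \<in> \<Omega> \<Longrightarrow> \<bar>f x l\<bar> \<le> a * (1 + \<bar>l\<bar>) powr (q - 1)"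
    and at_zero: "\<epsilon> > 0 \<Longrightarrow> \<exists>\<delta>>0. \<forall>x\<in>\<Omega>. \<forall>l. \<bar>l\<bar> < \<delta> \<longrightarrow> \<bar>f x l\<bar> \<le> \<epsilon> * \<bar>l\<bar>"
    and \<theta>: "\<theta> > 2" and R: "R > 0"
    and AR: "x \<in> \<Omega> \<Longrightarrow> \<bar>l\<bar> > R \<Longrightarrow> 0 < \<theta> * F x l \<and> \<theta> * F x l \<le> l * f x l"
    and \<phi>: "\<phi> \<in> V" "\<And>x. 0 \<le> \<phi> x" "\<And>x. \<phi> x \<le> b" "\<not> (AE x in M. \<phi> x = 0)"
begin

section \<open>Measurability and growth of the nonlinearity\<close>

abbreviation "p' \<equiv> p / (p - 1)"

text \<open>Rounding \<open>v\<close> down to the grid of mesh \<open>1 / Suc n\<close> leaves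
  countably many values, for each of which \<open>f\<close> is measurable; continuity in the second
  argument gives the limit. The map \<open>h\<close> allows use on product spaces.\<close>

lemma caratheodory_measurable:
  assumes [measurable]: "h \<in> measurable M' M" "v \<in> borel_measurable M'"
  shows "(\<lambda>y. f (h y) (v y)) \<in> borel_measurable M'"
proof (rule borel_measurable_LIMSEQ_real)
  fix n :: nat
  have "(\<lambda>y. f (h y) (of_int i / Suc n)) \<in> borel_measurable M'" for i :: int
    using measurable_compose[OF assms(1) f_measurable] .
  moreover have "(\<lambda>y. \<lfloor>real (Suc n) * v y\<rfloor>) \<in> measurable M' (count_space UNIV)" by measurable
  ultimately show "(\<lambda>y. f (h y) (of_int \<lfloor>real (Suc n) * v y\<rfloor> / Suc n)) \<in> borel_measurable M'"
    by (rule measurable_compose_countable)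
next
  fix y
  have "(\<lambda>n. of_int \<lfloor>real (Suc n) * v y\<rfloor> / real (Suc n) - v y) \<longlonglongrightarrow> 0"
  proof (rule Lim_null_comparison)
    show "\<forall>\<^sub>F n in sequentially. norm (of_int \<lfloor>real (Suc n) * v y\<rfloor> / real (Suc n) - v y) \<le> 1 / real (Suc n)"
    proof (rule always_eventually, rule allI)
      fix n
      define k where "k = real (Suc n)"
      have k: "k > 0" by (simp add: k_def)
      have "\<bar>of_int \<lfloor>k * v y\<rfloor> - k * v y\<bar> \<le> 1" by linarith
      moreover have "of_int \<lfloor>k * v y\<rfloor> / k - v y = (of_int \<lfloor>k * v y\<rfloor> - k * v y) / k"
        using k by (simp add: field_simps)
      ultimately show "norm (of_int \<lfloor>real (Suc n) * v y\<rfloor> / real (Suc n) - v y) \<le> 1 / real (Suc n)"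
        using k unfolding k_def[symmetric] by (simp add: divide_right_mono)
    qed
    show "(\<lambda>n. 1 / real (Suc n)) \<longlonglongrightarrow> 0" by (rule LIMSEQ_Suc[OF lim_1_over_n])
  qed
  then have lim: "(\<lambda>n. of_int \<lfloor>real (Suc n) * v y\<rfloor> / real (Suc n)) \<longlonglongrightarrow> v y"
    by (rule LIM_zero_cancel)
  have "isCont (f (h y)) (v y)"
    using f_continuous by (simp add: continuous_on_eq_continuous_at)
  from isCont_tendsto_compose[OF this lim]
  show "(\<lambda>n. f (h y) (of_int \<lfloor>real (Suc n) * v y\<rfloor> / real (Suc n))) \<longlonglongrightarrow> f (h y) (v y)" .
qed

lemma f_comp_measurable [measurable]:
  "u \<in> borel_measurable M \<Longrightarrow> (\<lambda>x. f x (u x)) \<in> borel_measurable M"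
  using caratheodory_measurable[of "\<lambda>x. x" M u] by simp

text \<open>The substitution \<open>F x l = \<integral> l f(x, t l) dt\<close> over the fixed interval \<open>[0, 1]\<close> reduces
  measurability to that of a parameter integral.\<close>

lemma F_comp_measurable [measurable]:
  assumes [measurable]: "u \<in> borel_measurable M"
  shows "(\<lambda>x. F x (u x)) \<in> borel_measurable M"
proof -
  have [measurable]: "(\<lambda>z. f (fst z) (snd z * u (fst z))) \<in> borel_measurable (M \<Otimes>\<^sub>M lborel)"
    by (rule caratheodory_measurable) measurable
  have "F x (u x) = (\<integral>t. indicator {0..1} t * (u x * f x (t * u x)) \<partial>lborel)" for x
  proof -
    have "((\<lambda>t. F x (t * u x)) has_real_derivative u x * f x (t * u x)) (at t)" for t
    proof -
      have "((\<lambda>t. t * u x) has_real_derivative u x) (at t)"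
        by (auto intro!: derivative_eq_intros)
      from DERIV_chain2[where f = "F x" and g = "\<lambda>t. t * u x", OF F_deriv this]
      show ?thesis by (simp add: mult.commute)
    qed
    moreover have "continuous_on UNIV (\<lambda>t. u x * f x (t * u x))"
      by (intro continuous_intros continuous_on_compose2[OF f_continuous[of x]]) auto
    ultimately have "(\<integral>t. u x * f x (t * u x) * indicator {0..1} t \<partial>lborel) = F x (1 * u x) - F x (0 * u x)"
      by (intro integral_FTC_Icc_real) (auto simp: continuous_on_eq_continuous_at)
    then show ?thesis by (simp add: F_zero mult.commute)
  qed
  then show ?thesis by simp
qed

lemma F_increment:
  assumes x: "x \<in> \<Omega>"
  shows "\<bar>F x m - F x l\<bar> \<le> \<bar>m - l\<bar> * (a * (1 + \<bar>l\<bar> + \<bar>m\<bar>) powr (q - 1))"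
proof -
  have 1: "\<bar>F x t - F x s\<bar> \<le> (t - s) * (a * (1 + \<bar>s\<bar> + \<bar>t\<bar>) powr (q - 1))" if st: "s < t" for s t
  proof -
    obtain z where z: "s < z" "z < t" "F x t - F x s = (t - s) * f x z"
      using MVT2[OF st, where f = "F x" and f' = "f x"] F_deriv[of x] by metis
    have "\<bar>f x z\<bar> \<le> a * (1 + \<bar>z\<bar>) powr (q - 1)" by (rule growth[OF x])
    also have "\<dots> \<le> a * (1 + \<bar>s\<bar> + \<bar>t\<bar>) powr (q - 1)"
      using a q z by (intro mult_left_mono powr_mono2) auto
    finally show ?thesis using z st by (simp add: abs_mult mult_left_mono)
  qed
  show ?thesis
    using 1[of l m] 1[of m l] by (cases l m rule: linorder_cases) (auto simp: abs_minus_commute add.commute add.left_commute)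
qed

lemma F_growth: assumes "x \<in> \<Omega>" shows "\<bar>F x l\<bar> \<le> \<bar>l\<bar> * (a * (1 + \<bar>l\<bar>) powr (q - 1))"
  using F_increment[OF assms, of l 0] by (simp add: F_zero)

text \<open>The growth exponent of \<open>\<bar>f x l\<bar> powr p'\<close> in \<open>l\<close>. The
  strict inequality \<open>q < p\<close> is what makes it smaller than \<open>p\<close>.\<close>

definition \<sigma> where "\<sigma> = (q - 1) * p'"

lemma \<sigma>: "0 < \<sigma>" "\<sigma> < p" and p'_pos: "p' > 0"
proof -
  show "p' > 0" using p by simp
  show "0 < \<sigma>" using p q by (simp add: \<sigma>_def)
  have "\<sigma> = p * ((q - 1) / (p - 1))" by (simp add: \<sigma>_def)
  also have "\<dots> < p * 1" using p q by (intro mult_strict_left_mono) auto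
  finally show "\<sigma> < p" by simp
qed

lemma dual_growth:
  "\<bar>f x l - f x m\<bar> powr p' \<le> indicator \<Omega> x * ((2 * a) powr p' * (1 + \<bar>l\<bar> + \<bar>m\<bar>) powr \<sigma>)"
proof (cases "x \<in> \<Omega>")
  case True
  have "\<bar>f x l - f x m\<bar> \<le> a * (1 + \<bar>l\<bar>) powr (q - 1) + a * (1 + \<bar>m\<bar>) powr (q - 1)"
    using growth[OF True, of l] growth[OF True, of m] by linarith
  also have "\<dots> \<le> (2 * a) * (1 + \<bar>l\<bar> + \<bar>m\<bar>) powr (q - 1)"
  proof -
    have "a * (1 + \<bar>l\<bar>) powr (q - 1) \<le> a * (1 + \<bar>l\<bar> + \<bar>m\<bar>) powr (q - 1)"
      "a * (1 + \<bar>m\<bar>) powr (q - 1) \<le> a * (1 + \<bar>l\<bar> + \<bar>m\<bar>) powr (q - 1)"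
      using a q by (auto intro!: mult_left_mono powr_mono2)
    then show ?thesis by linarith
  qed
  finally have "\<bar>f x l - f x m\<bar> powr p' \<le> ((2 * a) * (1 + \<bar>l\<bar> + \<bar>m\<bar>) powr (q - 1)) powr p'"
    using p by (intro powr_mono2) auto
  also have "\<dots> = (2 * a) powr p' * (1 + \<bar>l\<bar> + \<bar>m\<bar>) powr \<sigma>"
    using a by (simp add: powr_mult powr_powr \<sigma>_def)
  finally show ?thesis using True by simp
qed (simp add: f_outside)

lemma dual_integrable:
  assumes "u \<in> V" "w \<in> V"
  shows "integrable M (\<lambda>x. \<bar>f x (u x) - f x (w x)\<bar> powr p')"
proof (rule Bochner_Integration.integrable_bound)
  have [measurable]: "u \<in> borel_measurable M" "w \<in> borel_measurable M" using assms V_measurable by auto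
  show "integrable M (\<lambda>x. (2 * a) powr p' * (indicator \<Omega> x * (1 + \<bar>u x\<bar> + \<bar>w x\<bar>) powr p))"
    using power_integrable(1)[OF assms] by (rule integrable_mult_right)
  show "(\<lambda>x. \<bar>f x (u x) - f x (w x)\<bar> powr p') \<in> borel_measurable M" by measurable
  show "AE x in M. norm (\<bar>f x (u x) - f x (w x)\<bar> powr p') \<le>
      norm ((2 * a) powr p' * (indicator \<Omega> x * (1 + \<bar>u x\<bar> + \<bar>w x\<bar>) powr p))"
  proof (rule AE_I2)
    fix x
    have "indicator \<Omega> x * ((2 * a) powr p' * (1 + \<bar>u x\<bar> + \<bar>w x\<bar>) powr \<sigma>)
       \<le> indicator \<Omega> x * ((2 * a) powr p' * (1 + \<bar>u x\<bar> + \<bar>w x\<bar>) powr p)"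
      using \<sigma> by (intro mult_left_mono powr_mono) auto
    with dual_growth[of x "u x" "w x"]
    show "norm (\<bar>f x (u x) - f x (w x)\<bar> powr p') \<le>
      norm ((2 * a) powr p' * (indicator \<Omega> x * (1 + \<bar>u x\<bar> + \<bar>w x\<bar>) powr p))"
      by (simp add: mult.left_commute)
  qed
qed

lemma at_zero_value: assumes "x \<in> \<Omega>" shows "f x 0 = 0"
proof -
  obtain \<delta> where \<delta>: "\<delta> > 0" "\<And>l. \<bar>l\<bar> < \<delta> \<Longrightarrow> \<bar>f x l\<bar> \<le> 1 * \<bar>l\<bar>"
    using at_zero[OF zero_less_one] assms by blast
  from \<delta>(2)[of 0] \<delta>(1) show ?thesis by simp
qed

lemma f_dual_integrable: "u \<in> V \<Longrightarrow> integrable M (\<lambda>x. \<bar>f x (u x)\<bar> powr p')"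
proof -
  assume "u \<in> V"
  have "f x 0 = 0" for x using at_zero_value f_outside by (cases "x \<in> \<Omega>") auto
  then show ?thesis using dual_integrable[OF \<open>u \<in> V\<close> V_zero] by simp
qed

lemma f_mult_integrable: "u \<in> V \<Longrightarrow> v \<in> V \<Longrightarrow> integrable M (\<lambda>x. f x (u x) * v x)"
  using dual_bound(1) f_dual_integrable V_measurable f_comp_measurable by blast

text \<open>A Vitali argument: where \<open>1 + |u| + |w| > T\<close> the integrand is at most \<open>T powr (\<sigma> - p)\<close> times an
  integrand with bounded integral, elsewhere dominated convergence applies.\<close>

lemma superposition_tendsto:
  assumes uV: "\<And>n::nat. u n \<in> V" "\<And>n. N (u n) \<le> c" and wV: "\<And>n. w n \<in> V" "\<And>n. N (w n) \<le> c"
    and conv: "AE x in M. \<exists>l. (\<lambda>n. u n x) \<longlonglongrightarrow> l \<and> (\<lambda>n. w n x) \<longlonglongrightarrow> l"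
  shows "(\<lambda>n. \<integral>x. \<bar>f x (u n x) - f x (w n x)\<bar> powr p' \<partial>M) \<longlonglongrightarrow> 0"
proof -
  have [measurable]: "u n \<in> borel_measurable M" "w n \<in> borel_measurable M" for n
    using assms V_measurable by auto
  define k where "k = (2 * a) powr p'"
  have k0: "k > 0" using a by (simp add: k_def)
  have c0: "0 \<le> c" using uV N_nonneg order_trans by blast
  define h where "h n x = \<bar>f x (u n x) - f x (w n x)\<bar> powr p'" for n x
  define X where "X n x = 1 + \<bar>u n x\<bar> + \<bar>w n x\<bar>" for n x
  have [measurable]: "h n \<in> borel_measurable M" "X n \<in> borel_measurable M" for n
    unfolding h_def X_def by measurable
  have h_int: "integrable M (h n)" for n unfolding h_def by (rule dual_integrable[OF uV(1) wV(1)])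
  have h0: "h n x \<ge> 0" for n x by (simp add: h_def)
  define K where "K = 3 powr p * (measure M \<Omega> + CS * c powr p + CS * c powr p)"
  have X_int: "integrable M (\<lambda>x. indicator \<Omega> x * X n x powr p)" for n
    unfolding X_def by (rule power_integrable[OF uV(1) wV(1)])
  have X_le: "(\<integral>x. indicator \<Omega> x * X n x powr p \<partial>M) \<le> K" for n
  proof -
    have "3 powr p * (measure M \<Omega> + CS * N (u n) powr p + CS * N (w n) powr p) \<le> K"
      unfolding K_def using uV wV p CS N_nonneg
      by (intro mult_left_mono add_mono powr_mono2) auto
    with power_integrable(2)[OF uV(1)[of n] wV(1)[of n]] show ?thesis by (simp add: X_def)
  qed
  have K0: "K \<ge> 0" using CS by (simp add: K_def)
  have h_X: "h n x \<le> indicator \<Omega> x * (k * X n x powr \<sigma>)" for n x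
    unfolding h_def X_def k_def by (rule dual_growth)
  have split: "h n x \<le> min (h n x) (k * T powr \<sigma>) + k * T powr (\<sigma> - p) * (indicator \<Omega> x * X n x powr p)"
    if T: "T \<ge> 1" for n x T
  proof (cases "X n x \<le> T")
    case True
    have "h n x \<le> k * T powr \<sigma>"
    proof -
      have "h n x \<le> 1 * (k * X n x powr \<sigma>)"
        using h_X[of n x] k0 by (auto intro: order_trans simp: indicator_def split: if_splits)
      also have "\<dots> \<le> k * T powr \<sigma>" using True k0 \<sigma> by (simp add: X_def powr_mono2)
      finally show ?thesis .
    qed
    then show ?thesis using k0 by simp
  next
    case False
    then have X: "X n x > T" "X n x > 0" using T by auto
    have "X n x powr \<sigma> = X n x powr (\<sigma> - p) * X n x powr p"
      unfolding powr_add[symmetric] by simp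
    also have "\<dots> \<le> T powr (\<sigma> - p) * X n x powr p"
      using X T \<sigma> by (intro mult_right_mono powr_mono2') auto
    finally have "indicator \<Omega> x * (k * X n x powr \<sigma>) \<le> indicator \<Omega> x * (k * (T powr (\<sigma> - p) * X n x powr p))"
      using k0 by (intro mult_left_mono) auto
    with h_X[of n x] have "h n x \<le> k * T powr (\<sigma> - p) * (indicator \<Omega> x * X n x powr p)"
      by (simp add: mult.left_commute mult.assoc)
    moreover have "0 \<le> min (h n x) (k * T powr \<sigma>)" using h0 k0 by simp
    ultimately show ?thesis by linarith
  qed
  have minlim: "(\<lambda>n. \<integral>x. min (h n x) (k * T powr \<sigma>) \<partial>M) \<longlonglongrightarrow> 0" for T
  proof -
    have h_out: "h n x = 0" if "x \<notin> \<Omega>" for n x using that by (simp add: h_def f_outside)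
    have "(\<lambda>n. \<integral>x. min (h n x) (k * T powr \<sigma>) \<partial>M) \<longlonglongrightarrow> (\<integral>x. 0 \<partial>M)"
    proof (rule integral_dominated_convergence[where w = "\<lambda>x. k * T powr \<sigma> * indicat_real \<Omega> x"])
      show "integrable M (\<lambda>x. k * T powr \<sigma> * indicat_real \<Omega> x)"
        using \<Omega>_finite by (simp add: less_top)
      show "AE x in M. (\<lambda>n. min (h n x) (k * T powr \<sigma>)) \<longlonglongrightarrow> 0"
        using conv
      proof eventually_elim
        case (elim x)
        then obtain l where l: "(\<lambda>n. u n x) \<longlonglongrightarrow> l" "(\<lambda>n. w n x) \<longlonglongrightarrow> l" by blast
        have "isCont (f x) l" using f_continuous by (simp add: continuous_on_eq_continuous_at)
        then have "(\<lambda>n. \<bar>f x (u n x) - f x (w n x)\<bar>) \<longlonglongrightarrow> \<bar>f x l - f x l\<bar>"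
          by (intro tendsto_intros isCont_tendsto_compose[of l "f x"] l)
        then have "(\<lambda>n. \<bar>f x (u n x) - f x (w n x)\<bar>) \<longlonglongrightarrow> 0" by simp
        then have "(\<lambda>n. h n x) \<longlonglongrightarrow> 0 powr p'"
          unfolding h_def by (rule tendsto_powr') (use p'_pos in auto)
        then have "(\<lambda>n. min (h n x) (k * T powr \<sigma>)) \<longlonglongrightarrow> min (0 powr p') (k * T powr \<sigma>)"
          by (intro tendsto_min tendsto_const)
        then show ?case using k0 by simp
      qed
      show "AE x in M. norm (min (h n x) (k * T powr \<sigma>)) \<le> k * T powr \<sigma> * indicat_real \<Omega> x" for n
      proof (rule AE_I2)
        fix x
        have "0 \<le> min (h n x) (k * T powr \<sigma>)" using h0 k0 by simp
        then show "norm (min (h n x) (k * T powr \<sigma>)) \<le> k * T powr \<sigma> * indicat_real \<Omega> x"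
          using h_out[of x n] k0 by (cases "x \<in> \<Omega>") auto
      qed
    qed auto
    then show ?thesis by simp
  qed
  have "(\<lambda>n. integral\<^sup>L M (h n)) \<longlonglongrightarrow> 0"
  proof (rule LIMSEQ_I)
    fix \<epsilon> :: real assume \<epsilon>: "\<epsilon> > 0"
    have "((\<lambda>T. k * T powr (\<sigma> - p) * K) \<longlongrightarrow> k * 0 * K) at_top"
      by (intro tendsto_intros tendsto_neg_powr filterlim_ident) (use \<sigma> in auto)
    then have "((\<lambda>T. k * T powr (\<sigma> - p) * K) \<longlongrightarrow> 0) at_top" by simp
    then have evT: "\<forall>\<^sub>F T in at_top. k * T powr (\<sigma> - p) * K < \<epsilon> / 2"
      using \<epsilon> by (intro order_tendstoD) auto
    \<comment> \<open>The exponent \<open>\<sigma> - p\<close> is negative and \<open>K\<close> does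
      not depend on \<open>n\<close>, so one \<open>T\<close> makes the contribution of large values
      small for the whole sequence.\<close>
    then obtain T where T: "T \<ge> 1" "k * T powr (\<sigma> - p) * K < \<epsilon> / 2"
      using eventually_happens'[OF trivial_limit_at_top_linorder eventually_conj[OF evT eventually_ge_at_top[of 1]]]
      by blast
    have "\<forall>\<^sub>F n in sequentially. (\<integral>x. min (h n x) (k * T powr \<sigma>) \<partial>M) < \<epsilon> / 2"
      using minlim \<epsilon> by (intro order_tendstoD) auto
    then obtain n0 where n0: "\<And>n. n \<ge> n0 \<Longrightarrow> (\<integral>x. min (h n x) (k * T powr \<sigma>) \<partial>M) < \<epsilon> / 2"
      by (auto simp: eventually_sequentially)
    show "\<exists>n0. \<forall>n\<ge>n0. norm (integral\<^sup>L M (h n) - 0) < \<epsilon>"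
    proof (intro exI allI impI)
      fix n assume n: "n \<ge> n0"
      have mi: "integrable M (\<lambda>x. min (h n x) (k * T powr \<sigma>))"
        by (rule Bochner_Integration.integrable_bound[OF h_int[of n]]) (use h0 k0 in auto)
      have "integral\<^sup>L M (h n) \<le> (\<integral>x. min (h n x) (k * T powr \<sigma>) + k * T powr (\<sigma> - p) * (indicator \<Omega> x * X n x powr p) \<partial>M)"
        using h_int X_int mi split[OF T(1)] by (intro integral_mono) auto
      also have "\<dots> = (\<integral>x. min (h n x) (k * T powr \<sigma>) \<partial>M) + k * T powr (\<sigma> - p) * (\<integral>x. indicator \<Omega> x * X n x powr p \<partial>M)"
        using X_int[of n] mi by simp
      also have "\<dots> < \<epsilon> / 2 + \<epsilon> / 2"
      proof (rule add_strict_mono[OF n0[OF n]])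
        have "k * T powr (\<sigma> - p) * (\<integral>x. indicator \<Omega> x * X n x powr p \<partial>M) \<le> k * T powr (\<sigma> - p) * K"
          by (rule mult_left_mono[OF X_le]) (use k0 in simp)
        with T(2) show "k * T powr (\<sigma> - p) * (\<integral>x. indicator \<Omega> x * X n x powr p \<partial>M) < \<epsilon> / 2"
          by linarith
      qed
      finally show "norm (integral\<^sup>L M (h n) - 0) < \<epsilon>"
        using Bochner_Integration.integral_nonneg[of M "h n"] h0 by simp
    qed
  qed
  then show ?thesis by (simp add: h_def[abs_def])
qed

text \<open>The Riesz representative is determined only up to null vectors, hence a choice.\<close>

definition A :: "('a \<Rightarrow> real) \<Rightarrow> ('a \<Rightarrow> real)" where
  "A u = (SOME r. r \<in> V \<and> (\<forall>v\<in>V. E r v = (\<integral>x. f x (u x) * v x \<partial>M)))"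

lemma A: assumes "u \<in> V" shows "A u \<in> V" "v \<in> V \<Longrightarrow> E (A u) v = (\<integral>x. f x (u x) * v x \<partial>M)"
proof -
  have "\<exists>r\<in>V. \<forall>v\<in>V. E r v = (\<integral>x. f x (u x) * v x \<partial>M)"
  proof (rule Riesz_representation)
    fix v w assume "v \<in> V" "w \<in> V"
    then show "(\<integral>x. f x (u x) * (v + w) x \<partial>M) = (\<integral>x. f x (u x) * v x \<partial>M) + (\<integral>x. f x (u x) * w x \<partial>M)"
      using f_mult_integrable[OF assms] by (simp add: algebra_simps)
  next
    fix v c assume "v \<in> V"
    then show "(\<integral>x. f x (u x) * (c *\<^sub>R v) x \<partial>M) = c * (\<integral>x. f x (u x) * v x \<partial>M)"
      by (simp add: mult.left_commute)
  next
    fix v assume "v \<in> V"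
    with dual_bound(2)[OF f_comp_measurable[OF V_measurable[OF assms]] f_dual_integrable[OF assms], of v 1]
    show "\<bar>\<integral>x. f x (u x) * v x \<partial>M\<bar> \<le> (1 powr (- p') * (\<integral>x. \<bar>f x (u x)\<bar> powr p' \<partial>M) + 1 powr p * CS) * N v"
      by simp
  qed
  then have "\<exists>r. r \<in> V \<and> (\<forall>v\<in>V. E r v = (\<integral>x. f x (u x) * v x \<partial>M))" by blast
  from someI_ex[OF this] show "A u \<in> V" "v \<in> V \<Longrightarrow> E (A u) v = (\<integral>x. f x (u x) * v x \<partial>M)"
    unfolding A_def by blast+
qed

text \<open>The difference is tested against itself, and one factor of its seminorm is
  cancelled.\<close>

lemma A_diff:
  assumes "u \<in> V" "w \<in> V" "\<kappa> > 0"
  shows "N (A u - A w) \<le> \<kappa> powr (- p') * (\<integral>x. \<bar>f x (u x) - f x (w x)\<bar> powr p' \<partial>M) + \<kappa> powr p * CS"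
    (is "_ \<le> ?c")
proof -
  let ?a = "A u - A w"
  have [measurable]: "u \<in> borel_measurable M" "w \<in> borel_measurable M" using assms V_measurable by auto
  have aV: "?a \<in> V" using assms A(1) by blast
  have "(N ?a)\<^sup>2 = (\<integral>x. f x (u x) * ?a x \<partial>M) - (\<integral>x. f x (w x) * ?a x \<partial>M)"
    using aV A assms by (simp add: N_sq B_diff_left[of "A u" "A w"])
  also have "\<dots> = (\<integral>x. (f x (u x) - f x (w x)) * ?a x \<partial>M)"
    using f_mult_integrable[OF assms(1) aV] f_mult_integrable[OF assms(2) aV]
    unfolding left_diff_distrib by (rule Bochner_Integration.integral_diff[symmetric])
  also have "\<dots> \<le> ?c * N ?a"
    using dual_bound(2)[OF _ dual_integrable[OF assms(1,2)] aV assms(3)] by auto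
  finally have le: "N ?a * N ?a \<le> ?c * N ?a" by (simp add: power2_eq_square)
  show ?thesis
  proof (cases "N ?a = 0")
    case True
    then show ?thesis using assms CS by simp
  next
    case False
    then show ?thesis using le N_nonneg[OF aV] by (simp add: mult_le_cancel_right)
  qed
qed

lemma A_tendsto:
  assumes uV: "\<And>n::nat. u n \<in> V" "\<And>n. N (u n) \<le> c" and wV: "\<And>n. w n \<in> V" "\<And>n. N (w n) \<le> c"
    and conv: "AE x in M. \<exists>l. (\<lambda>n. u n x) \<longlonglongrightarrow> l \<and> (\<lambda>n. w n x) \<longlonglongrightarrow> l"
  shows "(\<lambda>n. N (A (u n) - A (w n))) \<longlonglongrightarrow> 0"
proof (rule LIMSEQ_I)
  fix \<epsilon> :: real assume \<epsilon>: "\<epsilon> > 0"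
  \<comment> \<open>This weight makes the second term of \<open>A_diff\<close> equal to
    \<open>\<epsilon> / 2\<close>; it is then fixed while the superposition integrals tend to
    0.\<close>
  define \<kappa> where "\<kappa> = (\<epsilon> / (2 * CS)) powr (1 / p)"
  have \<kappa>: "\<kappa> > 0" "\<kappa> powr p * CS = \<epsilon> / 2" using \<epsilon> CS p by (auto simp: \<kappa>_def powr_powr)
  have "(\<lambda>n. \<kappa> powr (- p') * (\<integral>x. \<bar>f x (u n x) - f x (w n x)\<bar> powr p' \<partial>M)) \<longlonglongrightarrow> \<kappa> powr (- p') * 0"
    by (intro tendsto_intros superposition_tendsto[OF assms])
  then have "(\<lambda>n. \<kappa> powr (- p') * (\<integral>x. \<bar>f x (u n x) - f x (w n x)\<bar> powr p' \<partial>M)) \<longlonglongrightarrow> 0" by simp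
  then have "\<forall>\<^sub>F n in sequentially. \<kappa> powr (- p') * (\<integral>x. \<bar>f x (u n x) - f x (w n x)\<bar> powr p' \<partial>M) < \<epsilon> / 2"
    using \<epsilon> by (intro order_tendstoD) auto
  then obtain n0 where n0: "\<And>n. n \<ge> n0 \<Longrightarrow> \<kappa> powr (- p') * (\<integral>x. \<bar>f x (u n x) - f x (w n x)\<bar> powr p' \<partial>M) < \<epsilon> / 2"
    by (auto simp: eventually_sequentially)
  have "norm (N (A (u n) - A (w n)) - 0) < \<epsilon>" if "n \<ge> n0" for n
  proof -
    have "A (u n) - A (w n) \<in> V" using uV wV A(1) by blast
    then have "0 \<le> N (A (u n) - A (w n))" by simp
    with A_diff[OF uV(1)[of n] wV(1)[of n] \<kappa>(1)] n0[OF that] \<kappa>(2) show ?thesis by simp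
  qed
  then show "\<exists>n0. \<forall>n\<ge>n0. norm (N (A (u n) - A (w n)) - 0) < \<epsilon>" by blast
qed

text \<open>The embedding gives an almost everywhere limit \<open>l\<close> of a subsequence;
  \<open>A_tendsto\<close> with the constant sequence \<open>l\<close> as its second argument yields
  convergence of the images.\<close>

lemma A_compact:
  assumes "\<And>n::nat. x n \<in> V" "\<And>n. N (x n) \<le> c"
  shows "\<exists>r::nat \<Rightarrow> nat. strict_mono r \<and>
    (\<forall>\<epsilon>>0. \<exists>n0. \<forall>m\<ge>n0. \<forall>n\<ge>n0. N (A (x (r m)) - A (x (r n))) < \<epsilon>)"
proof -
  obtain r l where r: "strict_mono r" and l: "l \<in> V" "N l \<le> c" "AE y in M. (\<lambda>n. x (r n) y) \<longlonglongrightarrow> l y"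
    using compact_embedding_N[of x c, OF assms] by blast
  have "AE y in M. \<exists>z. (\<lambda>n. x (r n) y) \<longlonglongrightarrow> z \<and> (\<lambda>n. l y) \<longlonglongrightarrow> z"
    using l(3)
  proof eventually_elim
    case (elim y)
    then show ?case using tendsto_const by blast
  qed
  then have lim: "(\<lambda>n. N (A (x (r n)) - A l)) \<longlonglongrightarrow> 0"
    by (rule A_tendsto[where c = c, rotated 4]) (simp_all add: assms l)
  have "\<exists>n0. \<forall>m\<ge>n0. \<forall>n\<ge>n0. N (A (x (r m)) - A (x (r n))) < \<epsilon>" if "\<epsilon> > 0" for \<epsilon>
  proof -
    have "\<forall>\<^sub>F n in sequentially. N (A (x (r n)) - A l) < \<epsilon> / 2"
      using lim that by (intro order_tendstoD) auto
    then obtain n0 where n0: "\<And>n. n \<ge> n0 \<Longrightarrow> N (A (x (r n)) - A l) < \<epsilon> / 2"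
      by (auto simp: eventually_sequentially)
    show ?thesis
    proof (intro exI allI impI)
      fix m n assume mn: "n0 \<le> m" "n0 \<le> n"
      have V3: "A (x (r m)) \<in> V" "A (x (r n)) \<in> V" "A l \<in> V"
        by (rule A(1), rule assms l)+
      show "N (A (x (r m)) - A (x (r n))) < \<epsilon>"
        using N_triangle3[OF V3(1,3,2)] N_minus_commute[OF V3(3,2)] n0[OF mn(1)] n0[OF mn(2)] by linarith
    qed
  qed
  then show ?thesis using r by blast
qed

text \<open>A counterexample would be a pair of sequences whose difference tends to 0 in the
  seminorm. Subsequences of \<open>u\<close> and of \<open>u - v\<close> converge almost everywhere,
  the latter to 0, so \<open>u\<close> and \<open>v\<close> share their limit and
  \<open>A_tendsto\<close> gives a contradiction.\<close>

lemma A_uniform: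
  assumes "\<epsilon> > 0"
  shows "\<exists>\<delta>>0. \<forall>u\<in>V. \<forall>v\<in>V. N u \<le> c \<longrightarrow> N v \<le> c \<longrightarrow> N (u - v) < \<delta> \<longrightarrow> N (A u - A v) < \<epsilon>"
proof (rule ccontr)
  assume neg: "\<not> ?thesis"
  have "\<exists>u v. u \<in> V \<and> v \<in> V \<and> N u \<le> c \<and> N v \<le> c \<and> N (u - v) < 1 / Suc n \<and> \<epsilon> \<le> N (A u - A v)" for n
  proof -
    have "1 / real (Suc n) > 0" by simp
    with neg show ?thesis by (meson not_le)
  qed
  then obtain u v where uv: "\<And>n. u n \<in> V" "\<And>n. v n \<in> V" "\<And>n. N (u n) \<le> c" "\<And>n. N (v n) \<le> c"
    "\<And>n. N (u n - v n) < 1 / Suc n" "\<And>n. \<epsilon> \<le> N (A (u n) - A (v n))" by metis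
  obtain r l where r: "strict_mono r" and l: "l \<in> V" "N l \<le> c" "AE y in M. (\<lambda>n. u (r n) y) \<longlonglongrightarrow> l y"
    using compact_embedding_N[of u c] uv by blast
  have "N (u (r n) - v (r n)) \<le> 1" for n
  proof -
    have "1 / real (Suc (r n)) \<le> 1" by simp
    then show ?thesis using uv(5)[of "r n"] by linarith
  qed
  then obtain r' d where r': "strict_mono r'" and d: "d \<in> V" "AE y in M. (\<lambda>n. (u (r (r' n)) - v (r (r' n))) y) \<longlonglongrightarrow> d y"
    using compact_embedding_N[of "\<lambda>n. u (r n) - v (r n)" 1] uv
    by blast
  let ?s = "\<lambda>n. r (r' n)"
  have s: "strict_mono ?s" using strict_mono_o[OF r r'] by (simp add: o_def)
  have ul: "AE y in M. (\<lambda>n. u (?s n) y) \<longlonglongrightarrow> l y"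
    using l(3) by eventually_elim (use LIMSEQ_subseq_LIMSEQ[OF _ r'] in \<open>auto simp: o_def\<close>)
  \<comment> \<open>Beyond index \<open>m\<close> all differences have seminorm at most
    \<open>1 / Suc m\<close>; Fatou's lemma passes this to their limit \<open>d\<close>, and
    \<open>m\<close> is arbitrary.\<close>
  have "N d \<le> 1 / Suc m" for m
  proof -
    have "E d d \<le> (1 / Suc m)\<^sup>2"
    proof (rule form_Fatou(2))
      show "u (?s (n + m)) - v (?s (n + m)) \<in> V" for n using uv by blast
      show "d \<in> borel_measurable M" using d V_measurable by blast
      show "AE x in M. (\<lambda>k. (u (?s (k + m)) - v (?s (k + m))) x) \<longlonglongrightarrow> d x"
        using d(2) by eventually_elim (rule LIMSEQ_ignore_initial_segment)
      fix k
      have "m \<le> ?s (k + m)" using seq_suble[OF s, of "k + m"] by linarith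
      then have "1 / Suc (?s (k + m)) \<le> 1 / real (Suc m)" by (intro divide_left_mono) auto
      then have "N (u (?s (k + m)) - v (?s (k + m))) \<le> 1 / Suc m" using uv(5)[of "?s (k + m)"] by linarith
      then have "(N (u (?s (k + m)) - v (?s (k + m))))\<^sup>2 \<le> (1 / Suc m)\<^sup>2"
        using uv by (intro power_mono) auto
      then show "E (u (?s (k + m)) - v (?s (k + m))) (u (?s (k + m)) - v (?s (k + m))) \<le> (1 / Suc m)\<^sup>2"
        using uv by (subst N_sq[symmetric]) auto
    qed
    then show ?thesis unfolding N_def by (intro real_le_lsqrt) auto
  qed
  then have "N d \<le> 0" by (intro LIMSEQ_le_const[OF LIMSEQ_Suc[OF lim_1_over_n]]) auto
  then have "N d = 0" using N_nonneg[OF d(1)] by linarith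
  then have d0: "AE y in M. d y = 0" by (rule AE_zero_of_N_zero[OF d(1)])
  have "AE y in M. \<exists>z. (\<lambda>n. u (?s n) y) \<longlonglongrightarrow> z \<and> (\<lambda>n. v (?s n) y) \<longlonglongrightarrow> z"
    using ul d(2) d0
  proof eventually_elim
    case (elim y)
    have "(\<lambda>n. u (?s n) y - (u (?s n) - v (?s n)) y) \<longlonglongrightarrow> l y - d y"
      by (intro tendsto_intros elim)
    then show ?case using elim by auto
  qed
  then have "(\<lambda>n. N (A (u (?s n)) - A (v (?s n)))) \<longlonglongrightarrow> 0"
    by (rule A_tendsto[where c = c, rotated 4]) (simp_all add: uv)
  then have "\<forall>\<^sub>F n in sequentially. N (A (u (?s n)) - A (v (?s n))) < \<epsilon>"
    using assms by (intro order_tendstoD)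
  then obtain n where "N (A (u (?s n)) - A (v (?s n))) < \<epsilon>" by (auto simp: eventually_sequentially)
  then show False using uv(6)[of "?s n"] by simp
qed

section \<open>The potential and the geometry of the energy\<close>

definition \<Psi> :: "('a \<Rightarrow> real) \<Rightarrow> real" where "\<Psi> u = (\<integral>x. F x (u x) \<partial>M)"

lemma F_bound: "\<bar>F x l\<bar> \<le> indicator \<Omega> x * (a * (1 + \<bar>l\<bar>) powr p)"
proof (cases "x \<in> \<Omega>")
  case True
  have "\<bar>F x l\<bar> \<le> \<bar>l\<bar> * (a * (1 + \<bar>l\<bar>) powr (q - 1))" by (rule F_growth[OF True])
  also have "\<dots> \<le> (1 + \<bar>l\<bar>) powr 1 * (a * (1 + \<bar>l\<bar>) powr (q - 1))"
    using a by (intro mult_right_mono) auto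
  also have "\<dots> = a * (1 + \<bar>l\<bar>) powr q"
    using powr_add[of "1 + \<bar>l\<bar>" 1 "q - 1"] by (simp add: mult.left_commute)
  also have "\<dots> \<le> a * (1 + \<bar>l\<bar>) powr p" using a q by (intro mult_left_mono powr_mono) auto
  finally show ?thesis using True by simp
qed (simp add: F_outside)

lemma F_integrable: assumes "u \<in> V" shows "integrable M (\<lambda>x. F x (u x))"
proof (rule Bochner_Integration.integrable_bound)
  have [measurable]: "u \<in> borel_measurable M" using assms V_measurable by auto
  show "integrable M (\<lambda>x. a * (indicator \<Omega> x * (1 + \<bar>u x\<bar> + \<bar>0 x\<bar>) powr p))"
    using power_integrable(1)[OF assms V_zero] by (rule integrable_mult_right)
  show "(\<lambda>x. F x (u x)) \<in> borel_measurable M" by measurable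
  show "AE x in M. norm (F x (u x)) \<le> norm (a * (indicator \<Omega> x * (1 + \<bar>u x\<bar> + \<bar>0 x\<bar>) powr p))"
    using F_bound a by (intro AE_I2) (simp add: mult.left_commute)
qed

text \<open>The limit of difference quotients is tested along sequences of nonzero times so that
  dominated convergence applies.\<close>

lemma deriv_\<Psi>:
  assumes "u \<in> V" "v \<in> V"
  shows "((\<lambda>t. \<Psi> (u + t *\<^sub>R v)) has_real_derivative E (A u) v) (at 0)"
  unfolding has_field_derivative_iff tendsto_at_iff_sequentially
proof (intro allI impI)
  fix X :: "nat \<Rightarrow> real"
  assume X0: "\<forall>i. X i \<in> UNIV - {0}" and Xlim: "X \<longlonglongrightarrow> 0"
  have [measurable]: "u \<in> borel_measurable M" "v \<in> borel_measurable M" using assms V_measurable by auto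
  obtain c where c: "c > 0" "\<And>i. \<bar>X i\<bar> \<le> c"
    using convergent_imp_Bseq[of X] Xlim by (auto simp: convergent_def Bseq_def)
  have uv: "u + X i *\<^sub>R v \<in> V" for i using assms by blast
  define g where "g i x = (F x (u x + X i * v x) - F x (u x)) / X i" for i x
  have gi: "(\<Psi> (u + X i *\<^sub>R v) - \<Psi> u) / X i = (\<integral>x. g i x \<partial>M)" for i
    using F_integrable[OF uv[of i]] F_integrable[OF assms(1)] by (simp add: \<Psi>_def g_def)
  have [measurable]: "g i \<in> borel_measurable M" for i unfolding g_def by measurable
  have "(\<lambda>i. \<integral>x. g i x \<partial>M) \<longlonglongrightarrow> (\<integral>x. f x (u x) * v x \<partial>M)"
  proof (rule integral_dominated_convergence)
    \<comment> \<open>\<open>F_increment\<close> produces the base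
      \<open>1 + \<bar>u\<bar> + \<bar>u + X i * v\<bar>\<close>, which is at most
      \<open>1 + 2 * \<bar>u\<bar> + c * \<bar>v\<bar>\<close>; the additional
      \<open>\<bar>v\<bar>\<close> lets the same base absorb the factor \<open>\<bar>v\<bar>\<close>
      of the quotient.\<close>
    show "integrable M (\<lambda>x. a * (indicator \<Omega> x * (1 + \<bar>(2 *\<^sub>R u) x\<bar> + \<bar>((c + 1) *\<^sub>R v) x\<bar>) powr p))"
      using assms by (intro integrable_mult_right power_integrable(1)) blast+
    show "AE x in M. (\<lambda>i. g i x) \<longlonglongrightarrow> f x (u x) * v x"
    proof (rule AE_I2)
      fix x
      have "((\<lambda>t. u x + t * v x) has_real_derivative v x) (at 0)" by (auto intro!: derivative_eq_intros)
      from DERIV_chain2[where f = "F x" and g = "\<lambda>t. u x + t * v x", OF F_deriv this]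
      have "((\<lambda>t. (F x (u x + t * v x) - F x (u x)) / t) \<longlongrightarrow> f x (u x) * v x) (at 0)"
        by (simp add: has_field_derivative_iff)
      then show "(\<lambda>i. g i x) \<longlonglongrightarrow> f x (u x) * v x"
        unfolding tendsto_at_iff_sequentially g_def using X0 Xlim by (auto simp: o_def)
    qed
    fix i
    show "AE x in M. norm (g i x) \<le> a * (indicator \<Omega> x * (1 + \<bar>(2 *\<^sub>R u) x\<bar> + \<bar>((c + 1) *\<^sub>R v) x\<bar>) powr p)"
    proof (rule AE_I2)
      fix x
      show "norm (g i x) \<le> a * (indicator \<Omega> x * (1 + \<bar>(2 *\<^sub>R u) x\<bar> + \<bar>((c + 1) *\<^sub>R v) x\<bar>) powr p)"
      proof (cases "x \<in> \<Omega>")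
        case True
        define Y where "Y = 1 + \<bar>2 * u x\<bar> + \<bar>(c + 1) * v x\<bar>"
        have Xi: "X i \<noteq> 0" using X0 by auto
        have Xv: "\<bar>X i * v x\<bar> \<le> c * \<bar>v x\<bar>"
          unfolding abs_mult by (rule mult_right_mono[OF c(2)]) simp
        have "1 + \<bar>u x\<bar> + \<bar>u x + X i * v x\<bar> \<le> 1 + 2 * \<bar>u x\<bar> + (c * \<bar>v x\<bar> + \<bar>v x\<bar>)"
          using Xv by linarith
        also have "\<dots> = Y"
        proof -
          have "\<bar>(c + 1) * v x\<bar> = c * \<bar>v x\<bar> + \<bar>v x\<bar>" unfolding abs_mult using c(1) by (simp add: distrib_right)
          then show ?thesis by (simp add: Y_def abs_mult)
        qed
        finally have le: "1 + \<bar>u x\<bar> + \<bar>u x + X i * v x\<bar> \<le> Y" .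
        have vY: "\<bar>v x\<bar> \<le> Y"
          using mult_right_mono[of 1 "c + 1" "\<bar>v x\<bar>"] c(1) abs_mult[of "c + 1" "v x"]
          unfolding Y_def by linarith
        have "\<bar>F x (u x + X i * v x) - F x (u x)\<bar> \<le> \<bar>X i * v x\<bar> * (a * (1 + \<bar>u x\<bar> + \<bar>u x + X i * v x\<bar>) powr (q - 1))"
          using F_increment[OF True, of "u x + X i * v x" "u x"] by simp
        then have "norm (g i x) \<le> \<bar>v x\<bar> * (a * (1 + \<bar>u x\<bar> + \<bar>u x + X i * v x\<bar>) powr (q - 1))"
          using Xi by (simp add: g_def abs_mult divide_le_eq mult_ac)
        also have "\<dots> \<le> Y powr 1 * (a * Y powr (q - 1))"
          using le vY a q by (intro mult_mono powr_mono2) (auto simp: Y_def)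
        also have "\<dots> = a * Y powr q"
          using powr_add[of Y 1 "q - 1"] by (simp add: mult.left_commute)
        also have "\<dots> \<le> a * Y powr p" using a q by (intro mult_left_mono powr_mono) (auto simp: Y_def)
        finally show ?thesis using True by (simp add: Y_def)
      qed (simp add: g_def F_outside)
    qed
  qed measurable
  then show "((\<lambda>y. (\<Psi> (u + y *\<^sub>R v) - \<Psi> (u + 0 *\<^sub>R v)) / (y - 0)) \<circ> X) \<longlonglongrightarrow> E (A u) v"
    using A(2)[OF assms] by (simp add: o_def gi)
qed

text \<open>The superquadratic condition handles the points with \<open>\<bar>u x\<bar> > R\<close>.
  Elsewhere both \<open>F\<close> and \<open>f * u\<close> are at most
  \<open>R * (a * (1 + R) powr (q - 1))\<close> in size, which costs \<open>1 + \<theta>\<close>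
  times this constant on a set of finite measure.\<close>

lemma AR_bound:
  assumes "u \<in> V"
  shows "(\<theta> / 2 - 1) * (N u)\<^sup>2 - (1 + \<theta>) * (R * (a * (1 + R) powr (q - 1))) * measure M \<Omega>
    \<le> \<theta> * ((N u)\<^sup>2 / 2 - \<Psi> u) - (E u u - E (A u) u)"
proof -
  define c where "c = R * (a * (1 + R) powr (q - 1))"
  have le: "- ((1 + \<theta>) * c * indicator \<Omega> x) \<le> f x (u x) * u x - \<theta> * F x (u x)" for x
  proof (cases "x \<in> \<Omega>")
    case True
    show ?thesis
    proof (cases "\<bar>u x\<bar> > R")
      case True
      have "c \<ge> 0" using R a by (simp add: c_def)
      then have "0 \<le> (1 + \<theta>) * c" using \<theta> by simp
      then show ?thesis using AR[OF \<open>x \<in> \<Omega>\<close> True] \<open>x \<in> \<Omega>\<close> by (simp add: mult.commute)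
    next
      case False
      then have u: "\<bar>u x\<bar> \<le> R" by simp
      have pw: "a * (1 + \<bar>u x\<bar>) powr (q - 1) \<le> a * (1 + R) powr (q - 1)"
        using u a q by (intro mult_left_mono powr_mono2) auto
      have F: "\<bar>F x (u x)\<bar> \<le> c" unfolding c_def
        by (rule order_trans[OF F_growth[OF True]], rule mult_mono[OF u pw]) (use R a in auto)
      have "\<bar>f x (u x) * u x\<bar> = \<bar>u x\<bar> * \<bar>f x (u x)\<bar>" by (simp add: abs_mult mult.commute)
      also have "\<dots> \<le> c" unfolding c_def
        by (rule mult_mono[OF u order_trans[OF growth[OF True] pw]]) (use R in auto)
      finally have f: "\<bar>f x (u x) * u x\<bar> \<le> c" .
      have "\<theta> * F x (u x) \<le> \<theta> * c" using F \<theta> by (intro mult_left_mono) auto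
      then show ?thesis using f True by (simp add: algebra_simps)
    qed
  qed (simp add: f_outside F_outside)
  have "(\<integral>x. - ((1 + \<theta>) * c * indicator \<Omega> x) \<partial>M) \<le> (\<integral>x. f x (u x) * u x - \<theta> * F x (u x) \<partial>M)"
    using f_mult_integrable[OF assms assms] F_integrable[OF assms] le \<Omega>_finite
    by (intro integral_mono) (auto simp: less_top)
  also have "\<dots> = E (A u) u - \<theta> * \<Psi> u"
    using f_mult_integrable[OF assms assms] F_integrable[OF assms] A(2)[OF assms assms]
    by (simp add: \<Psi>_def)
  finally have "- ((1 + \<theta>) * c * measure M \<Omega>) \<le> E (A u) u - \<theta> * \<Psi> u"
    using \<Omega>_finite by simp
  then show ?thesis using N_sq[OF assms] by (simp add: c_def[symmetric] algebra_simps)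
qed

lemma F_small:
  assumes "\<epsilon> > 0"
  shows "\<exists>C\<ge>0. \<forall>x l. F x l \<le> \<epsilon> * l\<^sup>2 + C * \<bar>l\<bar> powr p"
proof -
  obtain \<delta> where \<delta>: "\<delta> > 0" "\<And>x l. x \<in> \<Omega> \<Longrightarrow> \<bar>l\<bar> < \<delta> \<Longrightarrow> \<bar>f x l\<bar> \<le> \<epsilon> * \<bar>l\<bar>"
    using at_zero[OF assms] by blast
  \<comment> \<open>For \<open>\<bar>l\<bar> \<ge> \<delta>\<close> the constant 1 is at most
    \<open>\<bar>l\<bar> / \<delta>\<close>, so \<open>1 + \<bar>l\<bar>\<close> is at most
    \<open>(1 / \<delta> + 1) * \<bar>l\<bar>\<close> and \<open>F_bound\<close> applies.\<close>
  define C where "C = a * (1 / \<delta> + 1) powr p"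
  show ?thesis
  proof (intro exI[of _ C] conjI allI)
    show "0 \<le> C" using a by (simp add: C_def)
    fix x l
    have nn: "0 \<le> C * \<bar>l\<bar> powr p" "0 \<le> \<epsilon> * l\<^sup>2" using a assms by (auto simp: C_def)
    show "F x l \<le> \<epsilon> * l\<^sup>2 + C * \<bar>l\<bar> powr p"
    proof (cases "x \<in> \<Omega>")
      case True
      show ?thesis
      proof (cases "\<bar>l\<bar> < \<delta>")
        case l: True
        have step: "\<bar>F x t - F x s\<bar> \<le> \<epsilon> * l\<^sup>2" if st: "s < t" "t - s = \<bar>l\<bar>" "\<bar>s\<bar> \<le> \<bar>l\<bar>" "\<bar>t\<bar> \<le> \<bar>l\<bar>" for s t
        proof -
          obtain z where z: "s < z" "z < t" "F x t - F x s = (t - s) * f x z"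
            using MVT2[OF st(1), where f = "F x" and f' = "f x"] F_deriv[of x] by metis
          have zl: "\<bar>z\<bar> \<le> \<bar>l\<bar>" using z st by linarith
          have "\<bar>f x z\<bar> \<le> \<epsilon> * \<bar>z\<bar>" using \<delta>(2)[OF True, of z] zl l by linarith
          also have "\<dots> \<le> \<epsilon> * \<bar>l\<bar>" using zl assms by (intro mult_left_mono) auto
          finally have "\<bar>l\<bar> * \<bar>f x z\<bar> \<le> \<bar>l\<bar> * (\<epsilon> * \<bar>l\<bar>)" by (intro mult_left_mono) auto
          also have "\<dots> = \<epsilon> * l\<^sup>2"
            by (simp add: power2_eq_square mult.left_commute)
          finally show ?thesis using z(3) st(2) by (simp add: abs_mult)
        qed
        have "\<bar>F x l\<bar> \<le> \<epsilon> * l\<^sup>2"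
        proof (cases l "0::real" rule: linorder_cases)
          case less then show ?thesis using step[of l 0] F_zero[of x] by simp
        next
          case equal then show ?thesis using F_zero[of x] by simp
        next
          case greater then show ?thesis using step[of 0 l] F_zero[of x] by simp
        qed
        then show ?thesis using nn by linarith
      next
        case False
        then have "1 \<le> \<bar>l\<bar> / \<delta>" using \<delta> by (simp add: field_simps)
        then have "1 + \<bar>l\<bar> \<le> (1 / \<delta> + 1) * \<bar>l\<bar>" by (simp add: algebra_simps)
        then have "(1 + \<bar>l\<bar>) powr p \<le> ((1 / \<delta> + 1) * \<bar>l\<bar>) powr p" using p by (intro powr_mono2) auto
        also have "\<dots> = (1 / \<delta> + 1) powr p * \<bar>l\<bar> powr p" using \<delta> by (intro powr_mult)
        finally have "a * (1 + \<bar>l\<bar>) powr p \<le> C * \<bar>l\<bar> powr p" using a by (simp add: C_def)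
        then show ?thesis using F_bound[of x l] True nn by simp
      qed
    next
      case False
      then show ?thesis using F_outside[of x l] nn by simp
    qed
  qed
qed

lemma mountain_ring:
  shows "\<exists>\<rho>>0. \<exists>\<alpha>>0. \<forall>w\<in>V. N w = \<rho> \<longrightarrow> \<alpha> \<le> (N w)\<^sup>2 / 2 - \<Psi> w"
proof -
  define C2 where "C2 = measure M \<Omega> + CS"
  have C2: "C2 > 0" using CS by (simp add: C2_def add_nonneg_pos)
  \<comment> \<open>With this \<epsilon> the quadratic part of the potential uses up only half of
    the term \<open>(N w)\<^sup>2 / 2\<close>.\<close>
  define \<epsilon> where "\<epsilon> = 1 / (4 * C2)"
  have \<epsilon>: "\<epsilon> > 0" "\<epsilon> * C2 = 1 / 4" using C2 by (auto simp: \<epsilon>_def)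
  obtain C where C: "C \<ge> 0" "\<And>x l. F x l \<le> \<epsilon> * l\<^sup>2 + C * \<bar>l\<bar> powr p" using F_small[OF \<epsilon>(1)] by blast
  have low: "(N w)\<^sup>2 / 4 - C * CS * N w powr p \<le> (N w)\<^sup>2 / 2 - \<Psi> w" if w: "w \<in> V" for w
  proof -
    have "\<Psi> w \<le> (\<integral>x. \<epsilon> * (w x)\<^sup>2 + C * \<bar>w x\<bar> powr p \<partial>M)"
      unfolding \<Psi>_def using F_integrable[OF w] square_integral_le(1)[OF w] sobolev_integrable[OF w] C(2)
      by (intro integral_mono) auto
    also have "\<dots> = \<epsilon> * (\<integral>x. (w x)\<^sup>2 \<partial>M) + C * (\<integral>x. \<bar>w x\<bar> powr p \<partial>M)"
      using square_integral_le(1)[OF w] sobolev_integrable[OF w] by simp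
    also have "\<dots> \<le> \<epsilon> * (C2 * (N w)\<^sup>2) + C * (CS * N w powr p)"
      using square_integral_le(2)[OF w] sobolev_N[OF w] \<epsilon> C by (intro add_mono mult_left_mono) (auto simp: C2_def)
    also have "\<dots> = (N w)\<^sup>2 / 4 + C * CS * N w powr p" using \<epsilon>(2) by (simp flip: mult.assoc)
    finally show ?thesis by simp
  qed
  \<comment> \<open>Since \<open>p > 2\<close>, the higher order term is relatively small on small
    spheres; this radius keeps it below half of the remaining quarter, and an eighth of the squared
    radius is left for \<alpha>.\<close>
  define \<rho> where "\<rho> = (1 / (8 * (C * CS + 1))) powr (1 / (p - 2))"
  have CC: "0 \<le> C * CS" using C CS by simp
  have \<rho>: "\<rho> > 0" using CC by (simp add: \<rho>_def)
  have "\<rho> powr (p - 2) = 1 / (8 * (C * CS + 1))" using p CC by (simp add: \<rho>_def powr_powr)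
  then have "C * CS * \<rho> powr (p - 2) = (C * CS) / (8 * (C * CS + 1))" by simp
  also have "\<dots> \<le> 1 / 8" using CC by (simp add: divide_le_eq)
  finally have "C * CS * \<rho> powr (p - 2) \<le> 1 / 8" .
  then have "C * CS * \<rho> powr (p - 2) * \<rho>\<^sup>2 \<le> 1 / 8 * \<rho>\<^sup>2" by (rule mult_right_mono) simp
  moreover have "\<rho> powr p = \<rho> powr (p - 2) * \<rho>\<^sup>2"
    using \<rho> powr_add[of \<rho> "p - 2" 2] by simp
  ultimately have "\<rho>\<^sup>2 / 8 \<le> \<rho>\<^sup>2 / 4 - C * CS * \<rho> powr p" by (simp add: mult.assoc)
  then have "\<rho>\<^sup>2 / 8 \<le> (N w)\<^sup>2 / 2 - \<Psi> w" if "w \<in> V" "N w = \<rho>" for w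
    using low[OF that(1)] that(2) by simp
  then show ?thesis using \<rho> by (intro exI[of _ \<rho>] conjI exI[of _ "\<rho>\<^sup>2 / 8"]) auto
qed

text \<open>\<open>F(x, l) l powr (-\<theta>)\<close> is nondecreasing for \<open>l > R\<close>.\<close>

lemma F_superquadratic:
  assumes x: "x \<in> \<Omega>" and l: "l \<ge> 0"
  shows "F x (R + 1) * (R + 1) powr (- \<theta>) * l powr \<theta> - 2 * ((R + 1) * (a * (1 + (R + 1)) powr (q - 1))) \<le> F x l"
proof -
  \<comment> \<open>The condition holds only strictly beyond \<open>R\<close>, so monotonicity is
    started at \<open>R + 1\<close>.\<close>
  define r B where "r = R + 1" and "B = r * (a * (1 + r) powr (q - 1))"
  have r: "r > R" "r > 0" using R by (auto simp: r_def)
  have B: "B \<ge> 0" using a r by (simp add: B_def)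
  have Fr: "\<bar>F x m\<bar> \<le> B" if "\<bar>m\<bar> \<le> r" for m
  proof -
    have "a * (1 + \<bar>m\<bar>) powr (q - 1) \<le> a * (1 + r) powr (q - 1)"
      using a q that by (intro mult_left_mono powr_mono2) auto
    then show ?thesis unfolding B_def
      using a r that by (intro order_trans[OF F_growth[OF x]] mult_mono) auto
  qed
  show ?thesis
  proof (cases "l < r")
    case True
    \<comment> \<open>Below \<open>r\<close> the leading term is at most \<open>B\<close>, so
      subtracting \<open>2 * B\<close> leaves at most \<open>- B\<close>, a lower bound for
      \<open>F x l\<close> there.\<close>
    have "l powr \<theta> \<le> r powr \<theta>" using l True \<theta> by (intro powr_mono2) auto
    then have "r powr (- \<theta>) * l powr \<theta> \<le> r powr (- \<theta>) * r powr \<theta>" by (intro mult_left_mono) auto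
    also have "\<dots> = 1" using r by (simp flip: powr_add)
    finally have "F x r * (r powr (- \<theta>) * l powr \<theta>) \<le> B * 1"
      using Fr[of r] r B by (intro mult_mono) auto
    then show ?thesis using Fr[of l] l True unfolding r_def[symmetric] B_def[symmetric] by (simp add: mult.assoc)
  next
    case False
    then have lr: "r \<le> l" by simp
    have "F x r * r powr (- \<theta>) \<le> F x l * l powr (- \<theta>)"
    proof (rule DERIV_nonneg_imp_nondecreasing[OF lr])
      fix t assume t: "r \<le> t" "t \<le> l"
      have t0: "t > 0" "\<bar>t\<bar> > R" using t r R by auto
      have d: "((\<lambda>t. F x t * t powr (- \<theta>)) has_real_derivative
          f x t * t powr (- \<theta>) + (- \<theta>) * t powr (- \<theta> - 1) * F x t) (at t)"
        by (rule DERIV_mult[OF F_deriv has_real_derivative_powr[OF t0(1)]])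
      have "t powr (- \<theta>) = t * t powr (- \<theta> - 1)" using t0 powr_mult_base[of t "- \<theta> - 1"] by simp
      then have "f x t * t powr (- \<theta>) + (- \<theta>) * t powr (- \<theta> - 1) * F x t
          = t powr (- \<theta> - 1) * (t * f x t - \<theta> * F x t)" by (simp add: algebra_simps)
      also have "\<dots> \<ge> 0" using AR[OF x t0(2)] by simp
      finally show "\<exists>y. ((\<lambda>t. F x t * t powr (- \<theta>)) has_real_derivative y) (at t) \<and> 0 \<le> y" using d by blast
    qed
    then have "F x r * r powr (- \<theta>) * l powr \<theta> \<le> F x l * l powr (- \<theta>) * l powr \<theta>" by (rule mult_right_mono) simp
    also have "\<dots> = F x l" using lr r by (simp add: mult.assoc flip: powr_add)
    finally show ?thesis using B unfolding r_def[symmetric] B_def[symmetric] by simp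
  qed
qed

text \<open>On the ray through \<phi> the potential is at least \<open>T powr \<theta> * I\<close>
  minus a constant, with \<open>I > 0\<close> because \<phi> does not vanish almost everywhere. As
  \<open>\<theta> > 2\<close>, this beats the quadratic term.\<close>

lemma far_low_point:
  shows "\<exists>e\<in>V. N e > \<rho> \<and> (N e)\<^sup>2 / 2 - \<Psi> e \<le> 0"
proof -
  note [measurable] = V_measurable[OF \<phi>(1)]
  define k where "k x = F x (R + 1) * (R + 1) powr (- \<theta>)" for x
  define B where "B = 2 * ((R + 1) * (a * (1 + (R + 1)) powr (q - 1)))"
  have [measurable]: "k \<in> borel_measurable M" unfolding k_def by measurable
  have k_pos: "k x > 0" if "x \<in> \<Omega>" for x
    using AR[OF that, of "R + 1"] R \<theta> by (simp add: k_def zero_less_mult_iff)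
  have k_out: "k x = 0" if "x \<notin> \<Omega>" for x using that by (simp add: k_def F_outside)
  have b: "b \<ge> 0" using \<phi>(2,3) order_trans by blast
  define J where "J x = k x * \<phi> x powr \<theta>" for x
  define Kb where "Kb = (a * (1 + (R + 1)) powr p) * (R + 1) powr (- \<theta>)"
  have kb: "k x \<le> Kb" if "x \<in> \<Omega>" for x
    using F_bound[of x "R + 1"] R that by (simp add: k_def Kb_def mult_right_mono)
  have J_nn: "J x \<ge> 0" for x using k_pos[of x] k_out[of x] by (cases "x \<in> \<Omega>") (auto simp: J_def less_imp_le)
  have indi: "integrable M (indicat_real \<Omega>)" using \<Omega>_finite by (simp add: less_top)
  have J_int: "integrable M J"
  proof (rule Bochner_Integration.integrable_bound)
    show "integrable M (\<lambda>x. Kb * b powr \<theta> * indicat_real \<Omega> x)" using indi by simp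
    show "J \<in> borel_measurable M" unfolding J_def by measurable
    show "AE x in M. norm (J x) \<le> norm (Kb * b powr \<theta> * indicat_real \<Omega> x)"
    proof (rule AE_I2)
      fix x
      show "norm (J x) \<le> norm (Kb * b powr \<theta> * indicat_real \<Omega> x)"
      proof (cases "x \<in> \<Omega>")
        case True
        have "J x \<le> Kb * b powr \<theta>" unfolding J_def
          using kb[OF True] k_pos[OF True] \<phi> \<theta> by (intro mult_mono powr_mono2) auto
        then show ?thesis using J_nn[of x] True by simp
      qed (simp add: J_def k_out)
    qed
  qed
  define I where "I = integral\<^sup>L M J"
  have "I \<noteq> 0"
  proof
    assume "I = 0"
    then have "AE x in M. J x = 0"
      using integral_nonneg_eq_0_iff_AE[OF J_int] J_nn by (simp add: I_def)
    moreover have "AE x in M. x \<notin> \<Omega> \<longrightarrow> \<phi> x = 0" using \<phi>(1) by (simp add: V_iff)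
    ultimately have "AE x in M. \<phi> x = 0"
    proof eventually_elim
      case (elim x)
      then show ?case using k_pos[of x] by (cases "x \<in> \<Omega>") (auto simp: J_def)
    qed
    then show False using \<phi>(4) by simp
  qed
  moreover have "I \<ge> 0" unfolding I_def using J_nn by (rule Bochner_Integration.integral_nonneg)
  ultimately have I: "I > 0" by simp
  have low: "T powr \<theta> * I - B * measure M \<Omega> \<le> \<Psi> (T *\<^sub>R \<phi>)" if T: "T > 0" for T
  proof -
    have "T powr \<theta> * I - B * measure M \<Omega> = (\<integral>x. T powr \<theta> * J x - B * indicator \<Omega> x \<partial>M)"
      using J_int indi \<Omega>_finite by (simp add: I_def)
    also have "\<dots> \<le> \<Psi> (T *\<^sub>R \<phi>)" unfolding \<Psi>_def
    proof (rule integral_mono)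
      show "integrable M (\<lambda>x. T powr \<theta> * J x - B * indicat_real \<Omega> x)" using J_int indi by simp
      show "integrable M (\<lambda>x. F x ((T *\<^sub>R \<phi>) x))" using \<phi>(1) by (intro F_integrable) blast
      fix x
      show "T powr \<theta> * J x - B * indicat_real \<Omega> x \<le> F x ((T *\<^sub>R \<phi>) x)"
      proof (cases "x \<in> \<Omega>")
        case True
        have "k x * (T * \<phi> x) powr \<theta> - B \<le> F x (T * \<phi> x)"
          using F_superquadratic[OF True, of "T * \<phi> x"] \<phi>(2)[of x] T by (simp add: k_def B_def)
        then show ?thesis using True T \<phi>(2)[of x] by (simp add: J_def powr_mult mult.left_commute)
      qed (simp add: J_def k_out F_outside)
    qed
    finally show ?thesis .
  qed
  have N\<phi>: "N \<phi> > 0"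
    using AE_zero_of_N_zero[OF \<phi>(1)] \<phi>(4) N_nonneg[OF \<phi>(1)] by linarith
  have B0: "B * measure M \<Omega> \<ge> 0" using a R by (simp add: B_def)
  \<comment> \<open>\<open>T powr (\<theta> - 2) \<ge> X\<close> is what makes the energy
    nonpositive once the constant has been absorbed using \<open>T \<ge> 1\<close>; the other
    entries of the maximum in \<open>T\<close> secure that inequality and a norm beyond
    \<rho>.\<close>
  define X where "X = ((N \<phi>)\<^sup>2 / 2 + B * measure M \<Omega>) / I"
  have X0: "X \<ge> 0" using B0 I by (simp add: X_def)
  define T where "T = max (max 1 ((\<bar>\<rho>\<bar> + 1) / N \<phi>)) (X powr (1 / (\<theta> - 2)))"
  have T: "T \<ge> 1" "T \<ge> (\<bar>\<rho>\<bar> + 1) / N \<phi>" by (auto simp: T_def)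
  have "X = (X powr (1 / (\<theta> - 2))) powr (\<theta> - 2)" using X0 \<theta> by (simp add: powr_powr)
  also have "\<dots> \<le> T powr (\<theta> - 2)" using \<theta> by (intro powr_mono2) (auto simp: T_def)
  finally have TX: "X \<le> T powr (\<theta> - 2)" .
  have "\<bar>\<rho>\<bar> + 1 \<le> T * N \<phi>" using T(2) N\<phi> by (simp add: divide_le_eq)
  then have far: "N (T *\<^sub>R \<phi>) > \<rho>" using T \<phi>(1) by (simp add: N_scale)
  have "(N (T *\<^sub>R \<phi>))\<^sup>2 / 2 - \<Psi> (T *\<^sub>R \<phi>) \<le> T\<^sup>2 * ((N \<phi>)\<^sup>2 / 2) - (T powr \<theta> * I - B * measure M \<Omega>)"
    using low[of T] T \<phi>(1) by (simp add: N_scale power_mult_distrib)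
  also have "\<dots> \<le> T\<^sup>2 * ((N \<phi>)\<^sup>2 / 2 + B * measure M \<Omega>) - T powr \<theta> * I"
    using mult_right_mono[of 1 "T\<^sup>2" "B * measure M \<Omega>"] T B0 by (simp add: algebra_simps)
  also have "\<dots> \<le> T\<^sup>2 * (T powr (\<theta> - 2) * I) - T powr \<theta> * I"
    using TX I by (intro diff_right_mono mult_left_mono) (auto simp: X_def field_simps)
  also have "\<dots> = 0"
    using T powr_add[of T 2 "\<theta> - 2"] by (simp flip: mult.assoc)
  finally show ?thesis using far \<phi>(1) by blast
qed

text \<open>The positive lower bound \<alpha> for the energy of \<open>u\<close> is kept in the
  conclusion because it excludes the zero solution.\<close>

theorem mountain_pass_solution:
  "\<exists>u\<in>V. \<exists>e\<in>V. \<exists>\<rho>>0. \<exists>\<alpha>>0. N e > \<rho> \<and> (N e)\<^sup>2 / 2 - \<Psi> e \<le> 0 \<and>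
    (\<forall>w\<in>V. N w = \<rho> \<longrightarrow> \<alpha> \<le> (N w)\<^sup>2 / 2 - \<Psi> w) \<and>
    (\<forall>v\<in>V. E u v = (\<integral>x. f x (u x) * v x \<partial>M)) \<and> \<alpha> \<le> (N u)\<^sup>2 / 2 - \<Psi> u \<and>
    ereal ((N u)\<^sup>2 / 2 - \<Psi> u) =
      (INF \<gamma>\<in>{\<gamma>. cpath \<gamma> \<and> N (\<gamma> 0) = 0 \<and> N (\<gamma> 1 - e) = 0}. SUP \<tau>\<in>{0..1}. ereal ((N (\<gamma> \<tau>))\<^sup>2 / 2 - \<Psi> (\<gamma> \<tau>)))"
proof -
  obtain \<rho> \<alpha> where \<rho>: "\<rho> > 0" "\<alpha> > 0" "\<And>w. w \<in> V \<Longrightarrow> N w = \<rho> \<Longrightarrow> \<alpha> \<le> (N w)\<^sup>2 / 2 - \<Psi> w"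
    using mountain_ring by blast
  obtain e where e: "e \<in> V" "N e > \<rho>" "(N e)\<^sup>2 / 2 - \<Psi> e \<le> 0"
    using far_low_point by blast
  interpret mp: mountain_pass V E A \<Psi> \<rho> \<alpha> \<theta> "(1 + \<theta>) * (R * (a * (1 + R) powr (q - 1))) * measure M \<Omega>" e
  proof
    show "\<Psi> 0 = 0" by (simp add: \<Psi>_def F_zero)
  next
    fix x :: "nat \<Rightarrow> 'a \<Rightarrow> real" and c
    assume "\<And>n. x n \<in> V" "\<And>n. N (x n) \<le> c"
    then show "\<exists>r::nat \<Rightarrow> nat. strict_mono r \<and>
        (\<forall>\<epsilon>>0. \<exists>n0. \<forall>m\<ge>n0. \<forall>n\<ge>n0. N (A (x (r m)) - A (x (r n))) < \<epsilon>)"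
      by (rule A_compact)
  next
    fix \<epsilon> c :: real assume "\<epsilon> > 0"
    then show "\<exists>\<delta>>0. \<forall>u\<in>V. \<forall>v\<in>V. N u \<le> c \<longrightarrow> N v \<le> c \<longrightarrow> N (u - v) < \<delta> \<longrightarrow> N (A u - A v) < \<epsilon>"
      by (rule A_uniform)
  qed (fact A(1) deriv_\<Psi> \<theta> AR_bound \<rho> e)+
  obtain u where u: "u \<in> V" "N (u - A u) = 0" "ereal (mp.H u) = mp.level"
    using mp.critical_point_at_level by (auto simp: mp.G_def)
  have "E u v = (\<integral>x. f x (u x) * v x \<partial>M)" if "v \<in> V" for v
    using B_null[of "u - A u" v] u A[OF u(1)] that by (simp add: B_diff_left)
  moreover have "\<alpha> \<le> mp.H u" using mp.level_ge u(3) by (metis ereal_less_eq(3))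
  ultimately show ?thesis
    using u e \<rho> unfolding mp.level_def mp.paths_def mp.H_def
    by (intro bexI[of _ u] bexI[of _ e] exI[of _ \<rho>] exI[of _ \<alpha>] conjI) auto
qed

end

section \<open>Haar measure on the Heisenberg group\<close>

lemma heis_mult_eq:
  "\<xi> \<cdot>\<^sub>H \<eta> = (fst \<xi> + fst \<eta>, fst (snd \<xi>) + fst (snd \<eta>), snd (snd \<xi>) + snd (snd \<eta>) +
     2 * (fst \<eta> \<bullet> fst (snd \<xi>) - fst \<xi> \<bullet> fst (snd \<eta>)))"
  by (cases \<xi>; cases \<eta>) auto

lemma heis_inv_eq: "heis_inv \<xi> = - \<xi>"
  by (cases \<xi>) auto

lemma heis_norm_eq: "heis_norm \<xi> = root 4 ((snd (snd \<xi>))\<^sup>2 + ((norm (fst \<xi>))\<^sup>2 + (norm (fst (snd \<xi>)))\<^sup>2)\<^sup>2)"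
  by (cases \<xi>) auto

lemma heis_mult_assoc: "(\<xi> \<cdot>\<^sub>H \<eta>) \<cdot>\<^sub>H \<zeta> = \<xi> \<cdot>\<^sub>H (\<eta> \<cdot>\<^sub>H \<zeta>)"
  by (simp add: heis_mult_eq algebra_simps inner_add_left inner_add_right)

lemma heis_mult_zero [simp]: "0 \<cdot>\<^sub>H \<xi> = \<xi>" "\<xi> \<cdot>\<^sub>H 0 = \<xi>"
  by (cases \<xi>; simp add: zero_prod_def)+

lemma heis_inv_inv [simp]: "heis_inv (heis_inv \<xi>) = \<xi>"
  by (cases \<xi>) auto

lemma heis_inv_mult: "heis_inv (\<xi> \<cdot>\<^sub>H \<eta>) = heis_inv \<eta> \<cdot>\<^sub>H heis_inv \<xi>"
  by (cases \<xi>; cases \<eta>) (auto simp: algebra_simps inner_commute)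

lemma heis_cancel_left [simp]: "heis_inv \<xi> \<cdot>\<^sub>H (\<xi> \<cdot>\<^sub>H \<eta>) = \<eta>" "\<xi> \<cdot>\<^sub>H (heis_inv \<xi> \<cdot>\<^sub>H \<eta>) = \<eta>"
  by (simp_all add: heis_mult_assoc[symmetric] heis_inv_left heis_inv_right)

lemma heis_diff_eq_zero_iff: "heis_inv \<eta> \<cdot>\<^sub>H \<xi> = 0 \<longleftrightarrow> \<xi> = \<eta>"
  by (metis heis_cancel_left(2) heis_inv_left heis_mult_zero(2))

lemma heis_diff_commute: "heis_inv (heis_inv \<eta> \<cdot>\<^sub>H \<xi>) = heis_inv \<xi> \<cdot>\<^sub>H \<eta>"
  by (simp add: heis_inv_mult)

lemma heis_norm_inv [simp]: "heis_norm (heis_inv \<xi>) = heis_norm \<xi>"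
  by (cases \<xi>) auto

lemma heis_norm_diff_commute: "heis_norm (heis_inv \<eta> \<cdot>\<^sub>H \<xi>) = heis_norm (heis_inv \<xi> \<cdot>\<^sub>H \<eta>)"
  by (metis heis_diff_commute heis_norm_inv)

lemma heis_norm_nonneg [simp]: "0 \<le> heis_norm \<xi>"
  by (simp add: heis_norm_eq)

lemma heis_norm_power4: "heis_norm \<xi> ^ 4 = (snd (snd \<xi>))\<^sup>2 + ((norm (fst \<xi>))\<^sup>2 + (norm (fst (snd \<xi>)))\<^sup>2)\<^sup>2"
  unfolding heis_norm_eq by (rule real_root_pow_pos2) auto

lemma heis_norm_eq_zero_iff [simp]: "heis_norm \<xi> = 0 \<longleftrightarrow> \<xi> = 0"
proof
  assume "heis_norm \<xi> = 0"
  then have "(snd (snd \<xi>))\<^sup>2 + ((norm (fst \<xi>))\<^sup>2 + (norm (fst (snd \<xi>)))\<^sup>2)\<^sup>2 = 0"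
    using heis_norm_power4[of \<xi>] by simp
  then have "snd (snd \<xi>) = 0" "(norm (fst \<xi>))\<^sup>2 + (norm (fst (snd \<xi>)))\<^sup>2 = 0"
    by (simp_all add: add_nonneg_eq_0_iff)
  then show "\<xi> = 0" by (cases \<xi>) (auto simp: add_nonneg_eq_0_iff zero_prod_def)
qed (simp add: heis_norm_eq)

lemma heis_norm_pos_iff: "0 < heis_norm \<xi> \<longleftrightarrow> \<xi> \<noteq> 0"
  using heis_norm_nonneg[of \<xi>] heis_norm_eq_zero_iff[of \<xi>] by linarith

lemma continuous_heis_norm [continuous_intros]:
  "continuous_on S g \<Longrightarrow> continuous_on S (\<lambda>x. heis_norm (g x))"
  unfolding heis_norm_eq by (intro continuous_intros)

lemma continuous_heis_mult [continuous_intros]: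
  "continuous_on S g \<Longrightarrow> continuous_on S h \<Longrightarrow> continuous_on S (\<lambda>x. g x \<cdot>\<^sub>H h x)"
  unfolding heis_mult_eq by (intro continuous_intros)

lemma continuous_heis_inv [continuous_intros]:
  "continuous_on S g \<Longrightarrow> continuous_on S (\<lambda>x. heis_inv (g x))"
  unfolding heis_inv_eq by (intro continuous_intros)

lemma heis_norm_measurable [measurable]: "heis_norm \<in> borel_measurable borel"
  by (intro borel_measurable_continuous_onI continuous_intros)

lemma heis_mult_measurable [measurable]:
  assumes [measurable]: "g \<in> borel_measurable M" "h \<in> borel_measurable M"
  shows "(\<lambda>x. g x \<cdot>\<^sub>H h x) \<in> borel_measurable M"
proof -
  have "(\<lambda>p. fst p \<cdot>\<^sub>H snd p) \<in> borel_measurable borel"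
    by (intro borel_measurable_continuous_onI continuous_intros)
  then have "(\<lambda>p. fst p \<cdot>\<^sub>H snd p) \<in> borel_measurable (borel \<Otimes>\<^sub>M borel)"
    by (simp add: borel_prod)
  from measurable_compose[OF measurable_Pair[OF assms] this] show ?thesis by simp
qed

lemma heis_inv_measurable [measurable]:
  assumes [measurable]: "g \<in> borel_measurable M"
  shows "(\<lambda>x. heis_inv (g x)) \<in> borel_measurable M"
proof -
  have "heis_inv \<in> borel_measurable borel"
    by (intro borel_measurable_continuous_onI continuous_intros)
  from measurable_compose[OF assms this] show ?thesis .
qed

section \<open>Left invariance and the volume of balls\<close>

lemma nn_integral_lborel_translate:
  fixes c :: "'a::euclidean_space"
  assumes [measurable]: "g \<in> borel_measurable borel"
  shows "(\<integral>\<^sup>+t. g (c + t) \<partial>lborel) = (\<integral>\<^sup>+t. g t \<partial>lborel)"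
proof -
  have "(\<integral>\<^sup>+t. g t \<partial>lborel) = (\<integral>\<^sup>+t. g t \<partial>distr lborel borel ((+) c))"
    by (simp only: lborel_distr_plus)
  also have "\<dots> = (\<integral>\<^sup>+t. g (c + t) \<partial>lborel)" by (rule nn_integral_distr) measurable
  finally show ?thesis by simp
qed

lemma nn_integral_lborel_fst:
  fixes h :: "'a::euclidean_space \<times> 'b::euclidean_space \<Rightarrow> ennreal"
  assumes "h \<in> borel_measurable borel"
  shows "(\<integral>\<^sup>+z. h z \<partial>lborel) = (\<integral>\<^sup>+x. \<integral>\<^sup>+y. h (x, y) \<partial>lborel \<partial>lborel)"
proof -
  have "h \<in> borel_measurable (lborel \<Otimes>\<^sub>M lborel)" using assms by (simp add: lborel_prod)
  from lborel.nn_integral_fst[OF this] show ?thesis by (simp add: lborel_prod)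
qed

lemma nn_integral_lborel_snd:
  fixes h :: "'a::euclidean_space \<times> 'b::euclidean_space \<Rightarrow> ennreal"
  assumes "h \<in> borel_measurable borel"
  shows "(\<integral>\<^sup>+z. h z \<partial>lborel) = (\<integral>\<^sup>+y. \<integral>\<^sup>+x. h (x, y) \<partial>lborel \<partial>lborel)"
proof -
  have "(\<lambda>(x, y). h (x, y)) \<in> borel_measurable (lborel \<Otimes>\<^sub>M lborel)" using assms by (simp add: lborel_prod)
  from lborel_pair.nn_integral_snd[OF this] show ?thesis by (simp add: lborel_prod)
qed

lemma borel_measurable_parameter_nn_integral:
  fixes h :: "'a::euclidean_space \<times> 'b::euclidean_space \<Rightarrow> ennreal"
  assumes "h \<in> borel_measurable borel"
  shows "(\<lambda>x. \<integral>\<^sup>+y. h (x, y) \<partial>lborel) \<in> borel_measurable borel"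
proof -
  have "sets (borel \<Otimes>\<^sub>M lborel) = sets (borel :: ('a \<times> 'b) measure)"
    unfolding borel_prod[symmetric] by (rule sets_pair_measure_cong) auto
  then have "borel_measurable (borel \<Otimes>\<^sub>M lborel) = (borel_measurable borel :: ('a \<times> 'b \<Rightarrow> ennreal) set)"
    by (rule measurable_cong_sets) simp
  then have "(\<lambda>(x, y). h (x, y)) \<in> borel_measurable (borel \<Otimes>\<^sub>M lborel)"
    using assms by simp
  from lborel.borel_measurable_nn_integral[OF this] show ?thesis by simp
qed

text \<open>Left translation shifts the last coordinate by an amount depending only on the first
  two, and shifts these by constants. Integrating over the last coordinate first removes the
  twist.\<close>

lemma nn_integral_heis_left:
  fixes \<xi> :: "'n::finite heis"
  assumes h [measurable]: "h \<in> borel_measurable borel"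
  shows "(\<integral>\<^sup>+\<eta>. h (\<xi> \<cdot>\<^sub>H \<eta>) \<partial>lborel) = (\<integral>\<^sup>+\<eta>. h \<eta> \<partial>lborel)"
proof -
  obtain x0 y0 t0 where \<xi>: "\<xi> = (x0, y0, t0)" by (cases \<xi>)
  have m: "(\<lambda>t. h (x, y, t)) \<in> borel_measurable borel" for x y
    by (rule measurable_compose[OF _ h]) (intro borel_measurable_continuous_onI continuous_intros)
  have m2: "(\<lambda>z. h (x, z)) \<in> borel_measurable borel" for x
    by (rule measurable_compose[OF _ h]) (intro borel_measurable_continuous_onI continuous_intros)
  have [measurable]: "(\<lambda>\<eta>. h (\<xi> \<cdot>\<^sub>H \<eta>)) \<in> borel_measurable borel"
    by (rule measurable_compose[OF _ h]) measurable
  have m3: "(\<lambda>z. h (\<xi> \<cdot>\<^sub>H (x, z))) \<in> borel_measurable borel" for x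
    by (rule measurable_compose[OF _ h]) (intro borel_measurable_continuous_onI continuous_intros)
  have mt: "(\<lambda>y. \<integral>\<^sup>+t. h (x, y, t) \<partial>lborel) \<in> borel_measurable borel" for x
    using borel_measurable_parameter_nn_integral[OF m2[of x]] by simp
  have mz: "(\<lambda>x. \<integral>\<^sup>+z. h (x, z) \<partial>lborel) \<in> borel_measurable borel"
    by (rule borel_measurable_parameter_nn_integral[OF h])
  have "(\<integral>\<^sup>+\<eta>. h (\<xi> \<cdot>\<^sub>H \<eta>) \<partial>lborel) = (\<integral>\<^sup>+x. \<integral>\<^sup>+z. h (\<xi> \<cdot>\<^sub>H (x, z)) \<partial>lborel \<partial>lborel)"
    by (rule nn_integral_lborel_fst) measurable
  also have "\<dots> = (\<integral>\<^sup>+x. \<integral>\<^sup>+y. \<integral>\<^sup>+t. h (\<xi> \<cdot>\<^sub>H (x, y, t)) \<partial>lborel \<partial>lborel \<partial>lborel)"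
    by (rule nn_integral_cong) (rule nn_integral_lborel_fst[OF m3])
  also have "\<dots> = (\<integral>\<^sup>+x. \<integral>\<^sup>+y. \<integral>\<^sup>+t. h (x0 + x, y0 + y, (t0 + 2 * (x \<bullet> y0 - x0 \<bullet> y)) + t) \<partial>lborel \<partial>lborel \<partial>lborel)"
    by (simp add: \<xi> algebra_simps)
  also have "\<dots> = (\<integral>\<^sup>+x. \<integral>\<^sup>+y. \<integral>\<^sup>+t. h (x0 + x, y0 + y, t) \<partial>lborel \<partial>lborel \<partial>lborel)"
    by (intro nn_integral_cong nn_integral_lborel_translate m)
  also have "\<dots> = (\<integral>\<^sup>+x. \<integral>\<^sup>+y. \<integral>\<^sup>+t. h (x0 + x, y, t) \<partial>lborel \<partial>lborel \<partial>lborel)"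
    by (intro nn_integral_cong nn_integral_lborel_translate mt)
  also have "\<dots> = (\<integral>\<^sup>+x. \<integral>\<^sup>+z. h (x0 + x, z) \<partial>lborel \<partial>lborel)"
    by (intro nn_integral_cong nn_integral_lborel_fst[symmetric] m2)
  also have "\<dots> = (\<integral>\<^sup>+x. \<integral>\<^sup>+z. h (x, z) \<partial>lborel \<partial>lborel)"
    by (intro nn_integral_lborel_translate mz)
  also have "\<dots> = (\<integral>\<^sup>+\<eta>. h \<eta> \<partial>lborel)" by (rule nn_integral_lborel_fst[symmetric, OF h])
  finally show ?thesis .
qed

lemma emeasure_lborel_Times:
  fixes A :: "'a::euclidean_space set" and B :: "'b::euclidean_space set"
  assumes "A \<in> sets borel" "B \<in> sets borel"
  shows "emeasure lborel (A \<times> B) = emeasure lborel A * emeasure lborel B"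
  unfolding lborel_prod[symmetric] using assms by (intro lborel.emeasure_pair_measure_Times) auto

text \<open>A ball around 0 contains a box whose last side scales quadratically, so its volume is a
  constant times \<open>r\<close> to the power \<open>2 * N + 2\<close>; left invariance moves the
  centre.\<close>

lemma heis_ball_measure:
  "\<exists>\<omega>>0. \<forall>(\<xi>::'n::finite heis) r. r > 0 \<longrightarrow>
     ennreal (\<omega> * r powr hom_dim TYPE('n)) \<le> emeasure lborel {\<eta>. heis_norm (heis_inv \<xi> \<cdot>\<^sub>H \<eta>) < r}"
proof -
  define v where "v = unit_ball_vol (real CARD('n))"
  define \<omega> where "\<omega> = (v * (1/2) ^ CARD('n))\<^sup>2"
  have v: "v > 0" unfolding v_def by (rule unit_ball_vol_pos) simp
  then have \<omega>: "\<omega> > 0" by (simp add: \<omega>_def)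
  show ?thesis
  proof (intro exI[of _ \<omega>] conjI allI impI)
    fix \<xi> :: "'n heis" and r :: real assume r: "r > 0"
    \<comment> \<open>For these sizes each of the two summands of the fourth power of the norm is at
      most a quarter of \<open>r ^ 4\<close>, which keeps the box inside the ball.\<close>
    let ?B = "ball (0::real^'n) (r/2)" and ?I = "{- (r\<^sup>2/2) <..< r\<^sup>2/2}"
    have sub: "?B \<times> ?B \<times> ?I \<subseteq> {\<zeta>. heis_norm \<zeta> < r}"
    proof clarify
      fix x y :: "real^'n" and t :: real
      assume "x \<in> ?B" "y \<in> ?B" "t \<in> ?I"
      then have x: "norm x < r/2" and y: "norm y < r/2" and t: "\<bar>t\<bar> < r\<^sup>2/2" by auto
      have "(norm x)\<^sup>2 \<le> (r/2)\<^sup>2" "(norm y)\<^sup>2 \<le> (r/2)\<^sup>2" using x y by (auto intro!: power_mono)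
      then have "(norm x)\<^sup>2 + (norm y)\<^sup>2 \<le> r\<^sup>2/2" by (simp add: power_divide)
      then have "((norm x)\<^sup>2 + (norm y)\<^sup>2)\<^sup>2 \<le> (r\<^sup>2/2)\<^sup>2" by (intro power_mono) auto
      moreover have "\<bar>t\<bar>\<^sup>2 \<le> (r\<^sup>2/2)\<^sup>2" using t by (intro power_mono) auto
      ultimately have "heis_norm (x, y, t) ^ 4 \<le> 2 * (r\<^sup>2/2)\<^sup>2"
        unfolding heis_norm_power4 fst_conv snd_conv power2_abs by linarith
      also have "\<dots> = r ^ 4 / 2" by (simp add: power_divide flip: power_mult)
      also have "\<dots> < r ^ 4" using r by simp
      finally have "heis_norm (x, y, t) ^ 4 < r ^ 4" .
      then show "heis_norm (x, y, t) < r" using power_less_imp_less_base[OF _ less_imp_le[OF r]] by blast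
    qed
    have vB: "emeasure lborel ?B = ennreal (v * (r/2) ^ CARD('n))"
      using r by (simp add: emeasure_ball v_def)
    have "emeasure lborel (?B \<times> ?B \<times> ?I) = emeasure lborel ?B * (emeasure lborel ?B * emeasure lborel ?I)"
    proof -
      have "?B \<times> ?I \<in> sets borel" by (intro borel_open open_Times) auto
      then have "emeasure lborel (?B \<times> (?B \<times> ?I)) = emeasure lborel ?B * emeasure lborel (?B \<times> ?I)"
        by (intro emeasure_lborel_Times) auto
      also have "emeasure lborel (?B \<times> ?I) = emeasure lborel ?B * emeasure lborel ?I"
        by (intro emeasure_lborel_Times) auto
      finally show ?thesis .
    qed
    also have "\<dots> = ennreal (v * (r/2) ^ CARD('n)) * (ennreal (v * (r/2) ^ CARD('n)) * ennreal (r\<^sup>2))"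
      using r by (simp add: vB)
    also have "\<dots> = ennreal (\<omega> * r powr hom_dim TYPE('n))"
    proof -
      have "r powr hom_dim TYPE('n) = (r ^ CARD('n))\<^sup>2 * r\<^sup>2"
      proof -
        have "r powr hom_dim TYPE('n) = r powr real (CARD('n) * 2 + 2)" by (simp add: hom_dim_def algebra_simps)
        also have "\<dots> = r ^ (CARD('n) * 2 + 2)" by (rule powr_realpow[OF r])
        finally show ?thesis by (simp only: power_add power_mult)
      qed
      then have "\<omega> * r powr hom_dim TYPE('n) = (v * (r/2) ^ CARD('n)) * ((v * (r/2) ^ CARD('n)) * r\<^sup>2)"
        by (simp add: \<omega>_def power_divide power2_eq_square)
      moreover have "v * (r/2) ^ CARD('n) \<ge> 0" using r v by simp
      ultimately show ?thesis by (simp add: ennreal_mult)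
    qed
    finally have "ennreal (\<omega> * r powr hom_dim TYPE('n)) \<le> emeasure lborel {\<zeta>::'n heis. heis_norm \<zeta> < r}"
      using emeasure_mono[OF sub, of lborel] by simp
    also have "\<dots> = (\<integral>\<^sup>+\<eta>. indicator {\<zeta>::'n heis. heis_norm \<zeta> < r} \<eta> \<partial>lborel)" by simp
    also have "\<dots> = (\<integral>\<^sup>+\<eta>. indicator {\<zeta>::'n heis. heis_norm \<zeta> < r} (heis_inv \<xi> \<cdot>\<^sub>H \<eta>) \<partial>lborel)"
      by (rule nn_integral_heis_left[symmetric]) measurable
    also have "\<dots> = (\<integral>\<^sup>+\<eta>. indicator {\<eta>. heis_norm (heis_inv \<xi> \<cdot>\<^sub>H \<eta>) < r} \<eta> \<partial>lborel)"
      by (intro nn_integral_cong) (auto simp: indicator_def)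
    also have "\<dots> = emeasure lborel {\<eta>. heis_norm (heis_inv \<xi> \<cdot>\<^sub>H \<eta>) < r}"
      by (rule nn_integral_indicator) measurable
    finally show "ennreal (\<omega> * r powr hom_dim TYPE('n)) \<le> emeasure lborel {\<eta>. heis_norm (heis_inv \<xi> \<cdot>\<^sub>H \<eta>) < r}" .
  qed (rule \<omega>)
qed

lemma AE_lborel_fst:
  assumes "AE x in lborel. P x"
  shows "AE z in (lborel :: ('a::euclidean_space \<times> 'b::euclidean_space) measure). P (fst z)"
proof -
  obtain N where N: "N \<in> null_sets lborel" "{x. \<not> P x} \<subseteq> N"
    using assms by (auto simp: eventually_ae_filter)
  have "emeasure lborel (N \<times> (UNIV :: 'b set)) = 0"
    using null_setsD1[OF N(1)] null_setsD2[OF N(1)] by (subst emeasure_lborel_Times) auto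
  moreover have "N \<times> (UNIV :: 'b set) \<in> sets lborel"
    using N(1) unfolding lborel_prod[symmetric] by (intro pair_measureI) auto
  ultimately show ?thesis using N(2) by (intro AE_I[of _ _ "N \<times> UNIV"]) auto
qed

lemma AE_lborel_snd:
  assumes "AE x in lborel. P x"
  shows "AE z in (lborel :: ('a::euclidean_space \<times> 'b::euclidean_space) measure). P (snd z)"
proof -
  obtain N where N: "N \<in> null_sets lborel" "{x. \<not> P x} \<subseteq> N"
    using assms by (auto simp: eventually_ae_filter)
  have "emeasure lborel ((UNIV :: 'a set) \<times> N) = 0"
    using null_setsD1[OF N(1)] null_setsD2[OF N(1)] by (subst emeasure_lborel_Times) auto
  moreover have "(UNIV :: 'a set) \<times> N \<in> sets lborel"
    using N(1) unfolding lborel_prod[symmetric] by (intro pair_measureI) auto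
  ultimately show ?thesis using N(2) by (intro AE_I[of _ _ "UNIV \<times> N"]) auto
qed

text \<open>For fixed second coordinate the section of the preimage is a left translate of the null
  set, so Tonelli's theorem and invariance give measure 0.\<close>

lemma AE_heis_diff:
  fixes P :: "'n::finite heis \<Rightarrow> bool"
  assumes "AE \<zeta> in lborel. P \<zeta>"
  shows "AE z in lborel. P (heis_inv (snd z) \<cdot>\<^sub>H fst z)"
proof -
  obtain N where N: "N \<in> null_sets lborel" "{x. \<not> P x} \<subseteq> N"
    using assms by (auto simp: eventually_ae_filter)
  have Nm [measurable]: "N \<in> sets borel" using N(1) by auto
  have [measurable]: "(\<lambda>z::'n heis \<times> 'n heis. heis_inv (snd z) \<cdot>\<^sub>H fst z) \<in> borel_measurable borel"
    by (intro borel_measurable_continuous_onI continuous_intros)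
  let ?D = "{z. heis_inv (snd z) \<cdot>\<^sub>H fst z \<in> N}"
  have [measurable]: "?D \<in> sets borel" by measurable
  have "emeasure lborel ?D = (\<integral>\<^sup>+z. indicator ?D z \<partial>lborel)" by simp
  also have "\<dots> = (\<integral>\<^sup>+\<eta>. \<integral>\<^sup>+\<xi>. indicator ?D (\<xi>, \<eta>) \<partial>lborel \<partial>lborel)"
    by (rule nn_integral_lborel_snd) measurable
  also have "\<dots> = (\<integral>\<^sup>+\<eta>. \<integral>\<^sup>+\<xi>. indicator N (heis_inv \<eta> \<cdot>\<^sub>H \<xi>) \<partial>(lborel :: 'n heis measure) \<partial>(lborel :: 'n heis measure))"
    by (intro nn_integral_cong) (auto simp: indicator_def)
  also have "\<dots> = (\<integral>\<^sup>+\<eta>. \<integral>\<^sup>+\<xi>. indicator N \<xi> \<partial>(lborel :: 'n heis measure) \<partial>(lborel :: 'n heis measure))"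
    by (intro nn_integral_cong nn_integral_heis_left) measurable
  also have "\<dots> = 0" using null_setsD1[OF N(1)] by simp
  finally show ?thesis using N(2) by (intro AE_I[of _ _ ?D]) auto
qed

section \<open>Lebesgue measurable functions and Borel representatives\<close>

lemma lebesgue_AE_iff: "(AE x in lebesgue. P x) \<longleftrightarrow> (AE x in lborel. P x)"
  by (rule AE_completion_iff)

text \<open>Tonelli's theorem is applied on \<open>lborel\<close>, whose products are again
  \<open>lborel\<close>; Lebesgue measurable functions enter through a Borel function equal to them
  almost everywhere.\<close>

lemma lebesgue_measurable_obtain_borel:
  fixes u :: "'a::euclidean_space \<Rightarrow> real"
  assumes "u \<in> borel_measurable lebesgue"
  obtains u' where "u' \<in> borel_measurable borel" "AE x in lborel. u x = u' x"
  using completion_ex_borel_measurable_real[OF assms] by auto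

lemma lebesgue_measurable_AE_eq:
  fixes u :: "'a::euclidean_space \<Rightarrow> real"
  assumes "u' \<in> borel_measurable borel" "AE x in lborel. u x = u' x"
  shows "u \<in> borel_measurable lebesgue"
proof -
  have 1: "u' \<in> borel_measurable lebesgue" using assms(1) by (simp add: measurable_completion)
  have "AE x in lebesgue. u' x = u x" using assms(2) by (auto simp: lebesgue_AE_iff)
  then show ?thesis by (rule borel_measurable_AE[OF 1])
qed

section \<open>The fractional Sobolev inequality\<close>

text \<open>The model kernel in the lower bound for \<open>K\<close>. As
  \<open>0 powr x = 0\<close>, the weight is 0 at the identity, so lower bounds for it are stated
  off the identity.\<close>

definition heis_weight :: "real \<Rightarrow> 'n::finite heis \<Rightarrow> real" where
  "heis_weight s \<zeta> = heis_norm \<zeta> powr (- (hom_dim TYPE('n) + 2 * s))"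

definition local_energy :: "real \<Rightarrow> ('n::finite heis \<Rightarrow> real) \<Rightarrow> 'n heis \<Rightarrow> ennreal" where
  "local_energy s u \<xi> = (\<integral>\<^sup>+\<eta>. ennreal ((u \<xi> - u \<eta>)\<^sup>2 * heis_weight s (heis_inv \<eta> \<cdot>\<^sub>H \<xi>)) \<partial>lborel)"

lemma heis_weight_nonneg [simp]: "0 \<le> heis_weight s \<zeta>"
  by (simp add: heis_weight_def)

lemma heis_weight_measurable [measurable]:
  assumes [measurable]: "g \<in> borel_measurable M"
  shows "(\<lambda>x. heis_weight s (g x :: 'n::finite heis)) \<in> borel_measurable M"
proof -
  have [measurable]: "(\<lambda>x. heis_norm (g x)) \<in> borel_measurable M"
    by (rule measurable_compose[OF assms heis_norm_measurable])
  show ?thesis unfolding heis_weight_def by measurable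
qed

lemma hom_dim_pos: "hom_dim TYPE('n::finite) > 2"
  by (simp add: hom_dim_def)

lemma heis_weight_ge:
  fixes \<zeta> :: "'n::finite heis"
  assumes "0 < s" "\<zeta> \<noteq> 0" "heis_norm \<zeta> \<le> r"
  shows "r powr (- (hom_dim TYPE('n) + 2 * s)) \<le> heis_weight s \<zeta>"
  unfolding heis_weight_def using assms hom_dim_pos[where 'n='n]
  by (intro powr_mono2') (auto simp: heis_norm_pos_iff)

lemma borel_measurable_heis_pair:
  fixes g :: "'n::finite heis \<times> 'n heis \<Rightarrow> 'b::topological_space"
  assumes "g \<in> borel_measurable (borel \<Otimes>\<^sub>M borel)"
  shows "g \<in> borel_measurable borel"
  using assms by (simp add: borel_prod)

lemma energy_integrand_measurable:
  fixes u :: "'n::finite heis \<Rightarrow> real"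
  assumes [measurable]: "u \<in> borel_measurable borel"
  shows "(\<lambda>z. ennreal ((u (fst z) - u (snd z))\<^sup>2 * heis_weight s (heis_inv (snd z) \<cdot>\<^sub>H fst z)))
    \<in> borel_measurable borel"
  by (rule borel_measurable_heis_pair) measurable

lemma local_energy_measurable [measurable]:
  fixes u :: "'n::finite heis \<Rightarrow> real"
  assumes [measurable]: "u \<in> borel_measurable borel"
  shows "local_energy s u \<in> borel_measurable borel"
  using borel_measurable_parameter_nn_integral[OF energy_integrand_measurable[OF assms, of s]]
  by (simp add: local_energy_def[abs_def])

context
  fixes s p Q :: real
  assumes s: "0 < s" "s < 1" and Q_def: "Q = hom_dim TYPE('n::finite)" and p: "p = 2 * Q / (Q - 2 * s)"
begin

text \<open>The fourth identity completes \<open>a\<^sup>2\<close> to \<open>a powr p\<close> in the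
  pointwise estimate; the third gives the power of \<open>X\<close> that is left when
  \<open>X powr (2 * s / Q)\<close> is divided out.\<close>

lemma sobolev_exponent: "p > 2" "2 * s / Q < 1" "1 - 2 * s / Q = 2 / p" "p = 2 + 2 * s * p / Q"
proof -
  have Q: "Q > 2" unfolding Q_def by (rule hom_dim_pos)
  show "p > 2" using p s Q by (simp add: less_divide_eq)
  show "2 * s / Q < 1" using s Q by simp
  show "1 - 2 * s / Q = 2 / p" unfolding p using s Q by (simp add: diff_divide_distrib)
  show "p = 2 + 2 * s * p / Q" using p s Q by (simp add: field_simps)
qed

text \<open>The radius \<open>r\<close> is chosen so large that \<open>|u| < |u \<xi>| / 2\<close> on at least half of the ball of
  radius \<open>r\<close> around \<open>\<xi>\<close>, by Chebyshev's inequality.\<close>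

lemma sobolev_pointwise:
  "\<exists>C>0. \<forall>(u :: 'n heis \<Rightarrow> real) X \<xi>. u \<in> borel_measurable borel \<longrightarrow> X > 0 \<longrightarrow>
     (\<integral>\<^sup>+\<eta>. ennreal (\<bar>u \<eta>\<bar> powr p) \<partial>lborel) \<le> ennreal X \<longrightarrow>
     ennreal (\<bar>u \<xi>\<bar> powr p) \<le> ennreal (C * X powr (2 * s / Q)) * local_energy s u \<xi>"
proof -
  obtain \<omega> where \<omega>: "\<omega> > 0" "\<And>(\<xi>::'n heis) r. r > 0 \<Longrightarrow>
     ennreal (\<omega> * r powr Q) \<le> emeasure lborel {\<eta>. heis_norm (heis_inv \<xi> \<cdot>\<^sub>H \<eta>) < r}"
    using heis_ball_measure unfolding Q_def by blast
  have Q: "Q > 2" unfolding Q_def by (rule hom_dim_pos)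
  note p2 = sobolev_exponent
  \<comment> \<open>\<open>8 / \<omega>\<close> inverts the coefficient in the lower bound
    \<open>e2\<close> for the local energy, and the second factor is the coefficient in
    \<open>r2s\<close>, where \<open>r\<close> is expressed by \<open>X\<close> and
    \<open>a\<close>.\<close>
  define C where "C = (8 / \<omega>) * (2 * 2 powr p / \<omega>) powr (2 * s / Q)"
  have C: "C > 0" using \<omega> by (simp add: C_def)
  show ?thesis
  proof (intro exI[of _ C] conjI allI impI)
    fix u :: "'n heis \<Rightarrow> real" and X :: real and \<xi>
    assume um [measurable]: "u \<in> borel_measurable borel" and X: "X > 0"
      and le: "(\<integral>\<^sup>+\<eta>. ennreal (\<bar>u \<eta>\<bar> powr p) \<partial>lborel) \<le> ennreal X"
    show "ennreal (\<bar>u \<xi>\<bar> powr p) \<le> ennreal (C * X powr (2 * s / Q)) * local_energy s u \<xi>"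
    proof (cases "u \<xi> = 0")
      case True
      then show ?thesis by simp
    next
      case False
      define a where "a = \<bar>u \<xi>\<bar>"
      have a: "a > 0" using False by (simp add: a_def)
      define m where "m = X * (2 / a) powr p"
      have m: "m > 0" using X a by (simp add: m_def)
      \<comment> \<open>By Chebyshev's inequality \<open>m\<close> bounds the measure of the set
        \<open>S\<close> where \<open>\<bar>u\<bar>\<close> is large; this \<open>r\<close> gives
        the ball at least twice that measure.\<close>
      define r where "r = (2 * m / \<omega>) powr (1 / Q)"
      have r: "r > 0" using m \<omega> by (simp add: r_def)
      have rQ: "\<omega> * r powr Q = 2 * m" using m \<omega> Q by (simp add: r_def powr_powr)
      define S where "S = {\<eta>. a / 2 \<le> \<bar>u \<eta>\<bar>}"
      define D where "D = {\<eta>. heis_norm (heis_inv \<xi> \<cdot>\<^sub>H \<eta>) < r}"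
      have [measurable]: "S \<in> sets borel" "D \<in> sets borel"
      proof -
        show "S \<in> sets borel" unfolding S_def by measurable
        have "(\<lambda>\<eta>. heis_norm (heis_inv \<xi> \<cdot>\<^sub>H \<eta>)) \<in> borel_measurable borel"
          by (intro borel_measurable_continuous_onI continuous_intros)
        then show "D \<in> sets borel" unfolding D_def by measurable
      qed
      have "S \<subseteq> {\<eta>\<in>UNIV. 1 \<le> ennreal ((2 / a) powr p) * ennreal (\<bar>u \<eta>\<bar> powr p)}"
      proof
        fix \<eta> assume "\<eta> \<in> S"
        then have "1 \<le> (2 / a) * \<bar>u \<eta>\<bar>" using a by (simp add: S_def field_simps)
        then have "1 powr p \<le> ((2 / a) * \<bar>u \<eta>\<bar>) powr p" using p2(1) by (intro powr_mono2) auto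
        also have "\<dots> = (2 / a) powr p * \<bar>u \<eta>\<bar> powr p" using a by (intro powr_mult)
        finally have "1 \<le> ennreal ((2 / a) powr p * \<bar>u \<eta>\<bar> powr p)"
          by (subst ennreal_1[symmetric]) (rule ennreal_leI, simp)
        then show "\<eta> \<in> {\<eta>\<in>UNIV. 1 \<le> ennreal ((2 / a) powr p) * ennreal (\<bar>u \<eta>\<bar> powr p)}"
          by (simp add: ennreal_mult)
      qed
      then have "emeasure lborel S \<le> emeasure lborel {\<eta>\<in>UNIV. 1 \<le> ennreal ((2 / a) powr p) * ennreal (\<bar>u \<eta>\<bar> powr p)}"
        by (rule emeasure_mono) measurable
      also have "\<dots> \<le> ennreal ((2 / a) powr p) * (\<integral>\<^sup>+\<eta>. ennreal (\<bar>u \<eta>\<bar> powr p) * indicator UNIV \<eta> \<partial>lborel)"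
        by (rule nn_integral_Markov_inequality) auto
      also have "\<dots> \<le> ennreal ((2 / a) powr p) * ennreal X"
        using le by (intro mult_left_mono) auto
      also have "\<dots> = ennreal m" using X by (simp add: m_def ennreal_mult[symmetric] mult.commute)
      finally have Sm: "emeasure lborel S \<le> ennreal m" .
      have Sfin: "emeasure lborel S \<noteq> \<infinity>" using Sm by (auto simp: top_unique)
      have "ennreal m + ennreal m \<le> emeasure lborel D"
        using \<omega>(2)[OF r, of \<xi>] m by (simp add: rQ D_def ennreal_plus[symmetric] del: ennreal_plus)
      also have "\<dots> \<le> emeasure lborel (D - S) + emeasure lborel S"
        using emeasure_mono[of D "(D - S) \<union> S" lborel] emeasure_subadditive[of "D - S" lborel S] by force
      also have "\<dots> \<le> emeasure lborel (D - S) + ennreal m" by (intro add_left_mono Sm)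
      finally have DS: "ennreal m \<le> emeasure lborel (D - S)"
        by (simp add: ennreal_add_left_cancel_le add.commute)
      have "ennreal (a\<^sup>2 / 4 * r powr (- (Q + 2 * s)) * m) \<le> ennreal (a\<^sup>2 / 4 * r powr (- (Q + 2 * s))) * emeasure lborel (D - S)"
        using DS m by (subst ennreal_mult) (auto intro: mult_left_mono)
      also have "\<dots> = (\<integral>\<^sup>+\<eta>. ennreal (a\<^sup>2 / 4 * r powr (- (Q + 2 * s))) * indicator (D - S) \<eta> \<partial>lborel)"
        by (rule nn_integral_cmult_indicator[symmetric]) measurable
      also have "\<dots> \<le> local_energy s u \<xi>"
        unfolding local_energy_def
      proof (rule nn_integral_mono)
        fix \<eta>
        show "ennreal (a\<^sup>2 / 4 * r powr (- (Q + 2 * s))) * indicator (D - S) \<eta>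
          \<le> ennreal ((u \<xi> - u \<eta>)\<^sup>2 * heis_weight s (heis_inv \<eta> \<cdot>\<^sub>H \<xi>))"
        proof (cases "\<eta> \<in> D - S")
          case True
          then have \<eta>: "heis_norm (heis_inv \<eta> \<cdot>\<^sub>H \<xi>) < r" "\<bar>u \<eta>\<bar> < a / 2"
            by (auto simp: D_def S_def heis_norm_diff_commute[of \<eta> \<xi>])
          have "\<eta> \<noteq> \<xi>" using \<eta>(2) a by (auto simp: a_def)
          then have "heis_inv \<eta> \<cdot>\<^sub>H \<xi> \<noteq> 0" by (auto simp: heis_diff_eq_zero_iff)
          then have w: "r powr (- (Q + 2 * s)) \<le> heis_weight s (heis_inv \<eta> \<cdot>\<^sub>H \<xi>)"
            using s \<eta>(1) unfolding Q_def by (intro heis_weight_ge) auto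
          have "a / 2 \<le> \<bar>u \<xi> - u \<eta>\<bar>" using \<eta>(2) unfolding a_def by linarith
          then have "(a / 2)\<^sup>2 \<le> \<bar>u \<xi> - u \<eta>\<bar>\<^sup>2" using a by (intro power_mono) auto
          then have "a\<^sup>2 / 4 \<le> (u \<xi> - u \<eta>)\<^sup>2" by (simp add: power_divide)
          then have "a\<^sup>2 / 4 * r powr (- (Q + 2 * s)) \<le> (u \<xi> - u \<eta>)\<^sup>2 * heis_weight s (heis_inv \<eta> \<cdot>\<^sub>H \<xi>)"
            by (rule mult_mono[OF _ w]) auto
          then show ?thesis using True by (auto intro: ennreal_leI)
        qed auto
      qed
      finally have en: "ennreal (a\<^sup>2 / 4 * r powr (- (Q + 2 * s)) * m) \<le> local_energy s u \<xi>" .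
      have "m = \<omega> * r powr Q / 2" using rQ by simp
      then have e1: "a\<^sup>2 / 4 * r powr (- (Q + 2 * s)) * m = a\<^sup>2 * \<omega> / 8 * (r powr (- (Q + 2 * s)) * r powr Q)"
        by simp
      also have "r powr (- (Q + 2 * s)) * r powr Q = r powr (- (2 * s))"
        unfolding powr_add[symmetric] by simp
      finally have e2: "a\<^sup>2 / 4 * r powr (- (Q + 2 * s)) * m = a\<^sup>2 * \<omega> / 8 * r powr (- (2 * s))" .
      have r2s: "r powr (2 * s) = (2 * 2 powr p / \<omega>) powr (2 * s / Q) * X powr (2 * s / Q) * a powr (- (2 * s * p / Q))"
      proof -
        have m_eq: "2 * m / \<omega> = (2 * 2 powr p / \<omega>) * X * a powr (- p)"
          using a by (simp add: m_def powr_divide powr_minus_divide mult_ac)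
        have "r powr (2 * s) = (2 * m / \<omega>) powr (2 * s / Q)"
          by (simp add: r_def powr_powr)
        also have "\<dots> = ((2 * 2 powr p / \<omega>) * X * a powr (- p)) powr (2 * s / Q)"
          by (simp only: m_eq)
        also have "\<dots> = (2 * 2 powr p / \<omega>) powr (2 * s / Q) * X powr (2 * s / Q) * (a powr (- p)) powr (2 * s / Q)"
          by (simp only: powr_mult)
        finally show ?thesis by (simp add: powr_powr mult.commute)
      qed
      have "a powr p = a powr 2 * a powr (2 * s * p / Q)"
        unfolding powr_add[symmetric] using p2(4) by simp
      then have ap: "a powr p = a\<^sup>2 * a powr (2 * s * p / Q)" using a by simp
      have "C * X powr (2 * s / Q) * (a\<^sup>2 * \<omega> / 8 * r powr (- (2 * s)))
          = a\<^sup>2 * ((2 * 2 powr p / \<omega>) powr (2 * s / Q) * X powr (2 * s / Q)) * r powr (- (2 * s))"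
        using \<omega> by (simp add: C_def)
      also have "(2 * 2 powr p / \<omega>) powr (2 * s / Q) * X powr (2 * s / Q) = r powr (2 * s) * a powr (2 * s * p / Q)"
        unfolding r2s using a by (simp add: powr_minus_divide)
      also have "a\<^sup>2 * (r powr (2 * s) * a powr (2 * s * p / Q)) * r powr (- (2 * s)) = a powr p"
        using r by (simp add: ap powr_minus_divide)
      finally have "a powr p = (C * X powr (2 * s / Q)) * (a\<^sup>2 / 4 * r powr (- (Q + 2 * s)) * m)"
        unfolding e2 by simp
      moreover have "0 \<le> C * X powr (2 * s / Q)" "0 \<le> a\<^sup>2 / 4 * r powr (- (Q + 2 * s)) * m" using C m by auto
      ultimately have "ennreal (a powr p) = ennreal (C * X powr (2 * s / Q)) * ennreal (a\<^sup>2 / 4 * r powr (- (Q + 2 * s)) * m)"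
        by (simp only: ennreal_mult)
      also have "\<dots> \<le> ennreal (C * X powr (2 * s / Q)) * local_energy s u \<xi>"
        by (intro mult_left_mono en) simp
      finally show ?thesis by (simp add: a_def)
    qed
  qed (rule C)
qed

text \<open>Integrating the pointwise estimate bounds \<open>X\<close> by
  \<open>C * X powr (2 * s / Q) * e\<close>, which gives information only for finite
  \<open>X\<close>. Bounded functions vanishing off \<Omega> have finite \<open>X\<close>;
  truncation and Fatou's lemma give the rest.\<close>

lemma sobolev_borel:
  "\<exists>C>0. \<forall>(u :: 'n heis \<Rightarrow> real) \<Omega> e. u \<in> borel_measurable borel \<longrightarrow> \<Omega> \<in> sets borel \<longrightarrow>
     emeasure lborel \<Omega> < \<infinity> \<longrightarrow> (\<forall>\<xi>. \<xi> \<notin> \<Omega> \<longrightarrow> u \<xi> = 0) \<longrightarrow> 0 \<le> e \<longrightarrow>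
     (\<integral>\<^sup>+\<xi>. local_energy s u \<xi> * indicator \<Omega> \<xi> \<partial>lborel) \<le> ennreal e \<longrightarrow>
     (\<integral>\<^sup>+\<xi>. ennreal (\<bar>u \<xi>\<bar> powr p) \<partial>lborel) \<le> ennreal (C * e powr (p / 2))"
proof -
  obtain C where C: "C > 0" "\<And>(u :: 'n heis \<Rightarrow> real) X \<xi>. u \<in> borel_measurable borel \<Longrightarrow> X > 0 \<Longrightarrow>
     (\<integral>\<^sup>+\<eta>. ennreal (\<bar>u \<eta>\<bar> powr p) \<partial>lborel) \<le> ennreal X \<Longrightarrow>
     ennreal (\<bar>u \<xi>\<bar> powr p) \<le> ennreal (C * X powr (2 * s / Q)) * local_energy s u \<xi>"
    using sobolev_pointwise by blast
  note p2 = sobolev_exponent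
  have bounded_case: "(\<integral>\<^sup>+\<xi>. ennreal (\<bar>u \<xi>\<bar> powr p) \<partial>lborel) \<le> ennreal (C powr (p / 2) * e powr (p / 2))"
    if [measurable]: "u \<in> borel_measurable borel" "\<Omega> \<in> sets borel" and fin: "emeasure lborel \<Omega> < \<infinity>"
      and out: "\<And>\<xi>. \<xi> \<notin> \<Omega> \<Longrightarrow> u \<xi> = 0" and e: "0 \<le> e" and T: "\<And>\<xi>. \<bar>u \<xi>\<bar> \<le> T"
      and en: "(\<integral>\<^sup>+\<xi>. local_energy s u \<xi> * indicator \<Omega> \<xi> \<partial>lborel) \<le> ennreal e"
    for u :: "'n heis \<Rightarrow> real" and \<Omega> e T
  proof -
    let ?I = "\<integral>\<^sup>+\<xi>. ennreal (\<bar>u \<xi>\<bar> powr p) \<partial>lborel"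
    have "?I \<le> (\<integral>\<^sup>+\<xi>. ennreal (T powr p) * indicator \<Omega> \<xi> \<partial>lborel)"
    proof (rule nn_integral_mono)
      fix \<xi> show "ennreal (\<bar>u \<xi>\<bar> powr p) \<le> ennreal (T powr p) * indicator \<Omega> \<xi>"
        using T[of \<xi>] out[of \<xi>] p2(1) by (cases "\<xi> \<in> \<Omega>") (auto intro!: ennreal_leI powr_mono2)
    qed
    also have "\<dots> = ennreal (T powr p) * emeasure lborel \<Omega>"
      by (rule nn_integral_cmult_indicator) measurable
    also have "\<dots> < \<infinity>" using fin by (simp add: ennreal_mult_less_top)
    finally have "?I < top" by simp
    then obtain X where X: "X \<ge> 0" "?I = ennreal X" by (cases ?I) auto
    show ?thesis
    proof (cases "X = 0")
      case True
      then show ?thesis using X by simp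
    next
      case False
      then have X0: "X > 0" using X by simp
      have "ennreal X = (\<integral>\<^sup>+\<xi>. ennreal (\<bar>u \<xi>\<bar> powr p) * indicator \<Omega> \<xi> \<partial>lborel)"
        unfolding X(2)[symmetric] using out p2(1) by (intro nn_integral_cong) (auto simp: indicator_def)
      also have "\<dots> \<le> (\<integral>\<^sup>+\<xi>. ennreal (C * X powr (2 * s / Q)) * (local_energy s u \<xi> * indicator \<Omega> \<xi>) \<partial>lborel)"
        using C(2)[of u X] X0 X(2) by (intro nn_integral_mono) (auto simp: indicator_def)
      also have "\<dots> = ennreal (C * X powr (2 * s / Q)) * (\<integral>\<^sup>+\<xi>. local_energy s u \<xi> * indicator \<Omega> \<xi> \<partial>lborel)"
        by (rule nn_integral_cmult) measurable
      also have "\<dots> \<le> ennreal (C * X powr (2 * s / Q)) * ennreal e" by (intro mult_left_mono en) simp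
      also have "\<dots> = ennreal (C * X powr (2 * s / Q) * e)" using C e by (simp add: ennreal_mult)
      finally have "X \<le> C * X powr (2 * s / Q) * e" using C e by (subst (asm) ennreal_le_iff) auto
      \<comment> \<open>Division by a power of \<open>X\<close> is where \<open>0 < X\<close> and
        finiteness are used; the exponent left over is \<open>2 / p\<close>.\<close>
      then have "X powr 1 * X powr (- (2 * s / Q)) \<le> C * X powr (2 * s / Q) * e * X powr (- (2 * s / Q))"
        using X0 by (intro mult_right_mono) auto
      also have "\<dots> = C * e" using X0 by (simp add: powr_minus_divide)
      finally have "X powr (2 / p) \<le> C * e"
        unfolding powr_add[symmetric] using p2(3) by simp
      then have "(X powr (2 / p)) powr (p / 2) \<le> (C * e) powr (p / 2)"
        using p2(1) by (intro powr_mono2) auto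
      then have "X \<le> C powr (p / 2) * e powr (p / 2)"
        using X0 p2(1) C e by (simp add: powr_powr powr_mult)
      then show ?thesis unfolding X(2) by (rule ennreal_leI)
    qed
  qed
  show ?thesis
  proof (intro exI[of _ "C powr (p / 2)"] conjI allI impI)
    show "0 < C powr (p / 2)" using C by simp
    fix u :: "'n heis \<Rightarrow> real" and \<Omega> :: "'n heis set" and e :: real
    assume [measurable]: "u \<in> borel_measurable borel" "\<Omega> \<in> sets borel"
      and fin: "emeasure lborel \<Omega> < \<infinity>" and out: "\<forall>\<xi>. \<xi> \<notin> \<Omega> \<longrightarrow> u \<xi> = 0" and e: "0 \<le> e"
      and en: "(\<integral>\<^sup>+\<xi>. local_energy s u \<xi> * indicator \<Omega> \<xi> \<partial>lborel) \<le> ennreal e"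
    \<comment> \<open>Truncation is 1-Lipschitz, so it does not increase the local energy.\<close>
    define w where "w n \<xi> = max (- real n) (min (real n) (u \<xi>))" for n \<xi>
    have [measurable]: "w n \<in> borel_measurable borel" for n unfolding w_def by measurable
    have lip: "(w n \<xi> - w n \<eta>)\<^sup>2 \<le> (u \<xi> - u \<eta>)\<^sup>2" for n \<xi> \<eta>
    proof -
      have "\<bar>w n \<xi> - w n \<eta>\<bar> \<le> \<bar>u \<xi> - u \<eta>\<bar>" unfolding w_def by linarith
      then show ?thesis by (simp add: abs_le_square_iff)
    qed
    have wle: "(\<integral>\<^sup>+\<xi>. local_energy s (w n) \<xi> * indicator \<Omega> \<xi> \<partial>lborel) \<le> (\<integral>\<^sup>+\<xi>. local_energy s u \<xi> * indicator \<Omega> \<xi> \<partial>lborel)" for n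
      unfolding local_energy_def
      by (intro nn_integral_mono mult_right_mono ennreal_leI lip) auto
    have wn: "(\<integral>\<^sup>+\<xi>. ennreal (\<bar>w n \<xi>\<bar> powr p) \<partial>lborel) \<le> ennreal (C powr (p / 2) * e powr (p / 2))" for n
    proof (rule bounded_case[of _ \<Omega> e "real n"])
      show "(\<integral>\<^sup>+\<xi>. local_energy s (w n) \<xi> * indicator \<Omega> \<xi> \<partial>lborel) \<le> ennreal e"
        using wle en by (rule order_trans)
    qed (use out e fin in \<open>auto simp: w_def\<close>)
    have "(\<lambda>n. ennreal (\<bar>w n \<xi>\<bar> powr p)) \<longlonglongrightarrow> ennreal (\<bar>u \<xi>\<bar> powr p)" for \<xi>
    proof -
      obtain n0 where n0: "\<bar>u \<xi>\<bar> < real n0" using reals_Archimedean2 by blast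
      have "\<forall>\<^sub>F n in sequentially. ennreal (\<bar>w n \<xi>\<bar> powr p) = ennreal (\<bar>u \<xi>\<bar> powr p)"
        using eventually_ge_at_top[of n0]
      proof eventually_elim
        case (elim n)
        then have "\<bar>u \<xi>\<bar> < real n" using n0 by linarith
        then have "w n \<xi> = u \<xi>" unfolding w_def by linarith
        then show ?case by simp
      qed
      then show ?thesis by (rule tendsto_eventually)
    qed
    then have "(\<integral>\<^sup>+\<xi>. ennreal (\<bar>u \<xi>\<bar> powr p) \<partial>lborel) = (\<integral>\<^sup>+\<xi>. liminf (\<lambda>n. ennreal (\<bar>w n \<xi>\<bar> powr p)) \<partial>lborel)"
      by (intro nn_integral_cong) (auto intro!: lim_imp_Liminf[symmetric])
    also have "\<dots> \<le> liminf (\<lambda>n. \<integral>\<^sup>+\<xi>. ennreal (\<bar>w n \<xi>\<bar> powr p) \<partial>lborel)"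
      by (rule nn_integral_liminf) measurable
    also have "\<dots> \<le> liminf (\<lambda>n. ennreal (C powr (p / 2) * e powr (p / 2)))"
      by (rule Liminf_mono) (simp add: wn)
    finally show "(\<integral>\<^sup>+\<xi>. ennreal (\<bar>u \<xi>\<bar> powr p) \<partial>lborel) \<le> ennreal (C powr (p / 2) * e powr (p / 2))"
      by (simp add: Liminf_const)
  qed
qed

end

section \<open>Compactness\<close>

definition heis_cutoff :: "real \<Rightarrow> 'n::finite heis \<Rightarrow> real" where
  "heis_cutoff r \<zeta> = max 0 (1 - heis_norm \<zeta> ^ 4 / r ^ 4)"

definition heis_cutoff_mass :: "'n::finite itself \<Rightarrow> real \<Rightarrow> real" where
  "heis_cutoff_mass _ r = (\<integral>\<zeta>. heis_cutoff r (\<zeta> :: 'n heis) \<partial>lborel)"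

text \<open>The average over the left translate of a ball, so that its distance to \<open>u\<close>
  is governed by the left invariant energy. A continuous weight in place of an indicator makes the
  averages equicontinuous.\<close>

definition heis_average :: "real \<Rightarrow> ('n::finite heis \<Rightarrow> real) \<Rightarrow> 'n heis \<Rightarrow> real" where
  "heis_average r u \<xi> = (\<integral>\<eta>. u \<eta> * heis_cutoff r (heis_inv \<xi> \<cdot>\<^sub>H \<eta>) \<partial>lborel) / heis_cutoff_mass TYPE('n) r"

lemma heis_cutoff_bounds: "0 \<le> heis_cutoff r \<zeta>" "heis_cutoff r \<zeta> \<le> 1"
  by (auto simp: heis_cutoff_def)

lemma heis_cutoff_eq_zero:
  assumes "r > 0" "r \<le> heis_norm \<zeta>" shows "heis_cutoff r \<zeta> = 0"
proof -
  have "r ^ 4 \<le> heis_norm \<zeta> ^ 4" using assms by (intro power_mono) auto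
  then show ?thesis using assms by (simp add: heis_cutoff_def)
qed

lemma continuous_heis_cutoff [continuous_intros]:
  assumes "continuous_on S g" shows "continuous_on S (\<lambda>x. heis_cutoff r (g x))"
proof (cases "r = 0")
  case True
  then show ?thesis by (simp add: heis_cutoff_def)
next
  case False
  then show ?thesis unfolding heis_cutoff_def by (intro continuous_intros assms) auto
qed

lemma heis_cutoff_diff_measurable [measurable]:
  "(\<lambda>\<eta>. heis_cutoff r (heis_inv \<xi> \<cdot>\<^sub>H \<eta>)) \<in> borel_measurable borel" "heis_cutoff r \<in> borel_measurable borel"
  by (intro borel_measurable_continuous_onI continuous_intros)+

lemma heis_norm_components:
  fixes x y :: "real^'n::finite"
  assumes "heis_norm (x, y, t) \<le> r"
  shows "norm x \<le> r" "norm y \<le> r" "\<bar>t\<bar> \<le> r\<^sup>2"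
proof -
  define A where "A = (norm x)\<^sup>2 + (norm y)\<^sup>2"
  have r: "0 \<le> r" using heis_norm_nonneg assms by (rule order_trans)
  have "heis_norm (x, y, t) ^ 4 \<le> r ^ 4" by (intro power_mono assms heis_norm_nonneg)
  then have le4: "t\<^sup>2 + A\<^sup>2 \<le> (r\<^sup>2)\<^sup>2" unfolding heis_norm_power4 by (simp add: A_def flip: power_mult)
  have "t\<^sup>2 \<le> (r\<^sup>2)\<^sup>2" "A\<^sup>2 \<le> (r\<^sup>2)\<^sup>2" using le4 zero_le_power2[of A] zero_le_power2[of t] by linarith+
  then have "\<bar>t\<bar> \<le> r\<^sup>2" "A \<le> r\<^sup>2"
    using power2_le_imp_le[of "\<bar>t\<bar>" "r\<^sup>2"] power2_le_imp_le[of A "r\<^sup>2"] by auto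
  moreover have "(norm x)\<^sup>2 \<le> A" "(norm y)\<^sup>2 \<le> A" by (auto simp: A_def)
  ultimately show "norm x \<le> r" "norm y \<le> r" "\<bar>t\<bar> \<le> r\<^sup>2"
    using r by (meson order_trans power2_le_imp_le)+
qed

lemma bounded_heis_ball: "bounded {\<zeta> :: 'n::finite heis. heis_norm \<zeta> \<le> r}"
proof (rule bounded_subset)
  show "bounded (cball (0::real^'n) r \<times> cball (0::real^'n) r \<times> cball (0::real) (r\<^sup>2))"
    by (intro bounded_Times bounded_cball)
  show "{\<zeta> :: 'n heis. heis_norm \<zeta> \<le> r} \<subseteq> cball (0::real^'n) r \<times> cball (0::real^'n) r \<times> cball (0::real) (r\<^sup>2)"
    by (auto dest: heis_norm_components simp del: heis_norm.simps)
qed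

lemma heis_cutoff_integrable:
  assumes r: "r > 0"
  shows "integrable lborel (heis_cutoff r :: 'n::finite heis \<Rightarrow> real)"
proof (rule Bochner_Integration.integrable_bound)
  have [measurable]: "{\<zeta> :: 'n heis. heis_norm \<zeta> \<le> r} \<in> sets borel"
    by (intro borel_closed closed_Collect_le continuous_intros)
  have "emeasure lborel {\<zeta> :: 'n heis. heis_norm \<zeta> \<le> r} < \<infinity>"
    by (rule emeasure_bounded_finite[OF bounded_heis_ball])
  then show "integrable lborel (indicat_real {\<zeta> :: 'n heis. heis_norm \<zeta> \<le> r})" by simp
  show "AE \<zeta> in lborel. norm (heis_cutoff r \<zeta>) \<le> norm (indicat_real {\<zeta> :: 'n heis. heis_norm \<zeta> \<le> r} \<zeta>)"
  proof (rule AE_I2)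
    fix \<zeta> :: "'n heis"
    show "norm (heis_cutoff r \<zeta>) \<le> norm (indicat_real {\<zeta> :: 'n heis. heis_norm \<zeta> \<le> r} \<zeta>)"
      using heis_cutoff_bounds[of r \<zeta>] heis_cutoff_eq_zero[OF r, of \<zeta>]
      by (cases "heis_norm \<zeta> \<le> r") simp_all
  qed
qed measurable

lemma heis_cutoff_mass_nonneg: "0 \<le> heis_cutoff_mass TYPE('n::finite) r"
  unfolding heis_cutoff_mass_def by (intro Bochner_Integration.integral_nonneg heis_cutoff_bounds)

lemma heis_cutoff_translate:
  fixes \<xi> :: "'n::finite heis"
  assumes r: "r > 0"
  shows "integrable lborel (\<lambda>\<eta>. heis_cutoff r (heis_inv \<xi> \<cdot>\<^sub>H \<eta>))"
    and "(\<integral>\<eta>. heis_cutoff r (heis_inv \<xi> \<cdot>\<^sub>H \<eta>) \<partial>lborel) = heis_cutoff_mass TYPE('n) r"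
    and "(\<integral>\<^sup>+\<eta>. ennreal (heis_cutoff r (heis_inv \<xi> \<cdot>\<^sub>H \<eta>)) \<partial>lborel) = ennreal (heis_cutoff_mass TYPE('n) r)"
proof -
  have eq: "(\<integral>\<^sup>+\<eta>. ennreal (heis_cutoff r (heis_inv \<xi> \<cdot>\<^sub>H \<eta>)) \<partial>lborel) = (\<integral>\<^sup>+\<eta>. ennreal (heis_cutoff r (\<eta> :: 'n heis)) \<partial>lborel)"
    by (rule nn_integral_heis_left) measurable
  also have "\<dots> = ennreal (heis_cutoff_mass TYPE('n) r)"
    unfolding heis_cutoff_mass_def
    by (intro nn_integral_eq_integral heis_cutoff_integrable[OF r] AE_I2 heis_cutoff_bounds)
  finally show 1: "(\<integral>\<^sup>+\<eta>. ennreal (heis_cutoff r (heis_inv \<xi> \<cdot>\<^sub>H \<eta>)) \<partial>lborel) = ennreal (heis_cutoff_mass TYPE('n) r)" .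
  show 2: "integrable lborel (\<lambda>\<eta>. heis_cutoff r (heis_inv \<xi> \<cdot>\<^sub>H \<eta>))"
    by (rule integrableI_nonneg) (simp_all add: 1 heis_cutoff_bounds)
  show "(\<integral>\<eta>. heis_cutoff r (heis_inv \<xi> \<cdot>\<^sub>H \<eta>) \<partial>lborel) = heis_cutoff_mass TYPE('n) r"
    by (subst integral_eq_nn_integral) (simp_all add: 1 heis_cutoff_bounds heis_cutoff_mass_nonneg)
qed

text \<open>On the ball of half the radius the cut-off is at least 1/2, so its mass inherits the
  volume growth of balls.\<close>

lemma heis_cutoff_mass_ge:
  "\<exists>\<omega>>0. \<forall>r>0. \<omega> * r powr hom_dim TYPE('n::finite) \<le> heis_cutoff_mass TYPE('n) r"
proof -
  obtain \<omega> where \<omega>: "\<omega> > 0" "\<And>(\<xi>::'n heis) r. r > 0 \<Longrightarrow>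
     ennreal (\<omega> * r powr hom_dim TYPE('n)) \<le> emeasure lborel {\<eta>. heis_norm (heis_inv \<xi> \<cdot>\<^sub>H \<eta>) < r}"
    using heis_ball_measure by blast
  define \<omega>' where "\<omega>' = \<omega> * (1/2) powr hom_dim TYPE('n) / 2"
  have \<omega>': "\<omega>' > 0" using \<omega> by (simp add: \<omega>'_def)
  show ?thesis
  proof (intro exI[of _ \<omega>'] conjI allI impI)
    fix r :: real assume r: "r > 0"
    let ?B = "{\<eta> :: 'n heis. heis_norm (heis_inv 0 \<cdot>\<^sub>H \<eta>) < r / 2}"
    have [measurable]: "?B \<in> sets borel"
      by (intro borel_open open_Collect_less continuous_intros)
    have "ennreal (\<omega>' * r powr hom_dim TYPE('n)) = ennreal (1/2) * ennreal (\<omega> * (r / 2) powr hom_dim TYPE('n))"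
    proof -
      have "\<omega>' * r powr hom_dim TYPE('n) = (1/2) * (\<omega> * (r / 2) powr hom_dim TYPE('n))"
        using r by (simp add: \<omega>'_def powr_divide)
      moreover have "0 \<le> \<omega> * (r / 2) powr hom_dim TYPE('n)" using \<omega>(1) by simp
      ultimately show ?thesis by (simp only: ennreal_mult zero_le_divide_1_iff zero_le_numeral)
    qed
    also have "\<dots> \<le> ennreal (1/2) * emeasure lborel ?B"
      using \<omega>(2)[of "r/2" 0] r by (intro mult_left_mono) auto
    also have "\<dots> = (\<integral>\<^sup>+\<eta>. ennreal (1/2) * indicator ?B \<eta> \<partial>lborel)"
      by (rule nn_integral_cmult_indicator[symmetric]) measurable
    also have "\<dots> \<le> (\<integral>\<^sup>+\<eta>. ennreal (heis_cutoff r (heis_inv 0 \<cdot>\<^sub>H \<eta> :: 'n heis)) \<partial>lborel)"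
    proof (rule nn_integral_mono)
      fix \<eta> :: "'n heis"
      show "ennreal (1/2) * indicator ?B \<eta> \<le> ennreal (heis_cutoff r (heis_inv 0 \<cdot>\<^sub>H \<eta>))"
      proof (cases "\<eta> \<in> ?B")
        case True
        define h where "h = heis_norm (heis_inv 0 \<cdot>\<^sub>H \<eta>)"
        have "h ^ 4 \<le> (r / 2) ^ 4" using True by (intro power_mono) (auto simp: h_def)
        moreover have "(r / 2) ^ 4 = r ^ 4 / 16" by (simp add: power_divide)
        moreover have "0 \<le> h ^ 4" by simp
        ultimately have "h ^ 4 \<le> r ^ 4 / 2" by linarith
        then have "h ^ 4 / r ^ 4 \<le> 1 / 2" using r by (simp add: divide_le_eq)
        then have "1 / 2 \<le> heis_cutoff r (heis_inv 0 \<cdot>\<^sub>H \<eta>)"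
          unfolding heis_cutoff_def h_def[symmetric] by linarith
        then have "ennreal (1/2) \<le> ennreal (heis_cutoff r (heis_inv 0 \<cdot>\<^sub>H \<eta>))" by (rule ennreal_leI)
        with True show ?thesis by simp
      qed simp
    qed
    also have "\<dots> = ennreal (heis_cutoff_mass TYPE('n) r)" by (rule heis_cutoff_translate(3)[OF r])
    finally show "\<omega>' * r powr hom_dim TYPE('n) \<le> heis_cutoff_mass TYPE('n) r"
      using heis_cutoff_mass_nonneg by (subst (asm) ennreal_le_iff)
  qed (rule \<omega>')
qed

lemma heis_average_integrable:
  fixes u :: "'n::finite heis \<Rightarrow> real"
  assumes u: "integrable lborel u"
  shows "integrable lborel (\<lambda>\<eta>. u \<eta> * heis_cutoff r (heis_inv \<xi> \<cdot>\<^sub>H \<eta>))"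
proof (rule Bochner_Integration.integrable_bound[OF u])
  have [measurable]: "u \<in> borel_measurable borel" using borel_measurable_integrable[OF u] by simp
  show "(\<lambda>\<eta>. u \<eta> * heis_cutoff r (heis_inv \<xi> \<cdot>\<^sub>H \<eta>)) \<in> borel_measurable lborel" by measurable
  show "AE \<eta> in lborel. norm (u \<eta> * heis_cutoff r (heis_inv \<xi> \<cdot>\<^sub>H \<eta>)) \<le> norm (u \<eta>)"
    by (intro AE_I2) (simp add: abs_mult mult_left_le heis_cutoff_bounds)
qed

text \<open>On the support of the cut-off the weight is at least
  \<open>r powr (- (Q + 2 * s))\<close>, so squared differences are controlled by the local energy.
  Splitting each difference into a squared and a constant part leaves two errors that both carry the
  factor \<open>r powr s\<close>.\<close>

lemma heis_average_close:
  fixes u :: "'n::finite heis \<Rightarrow> real"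
  assumes s: "0 < s" and r: "r > 0" and u: "integrable lborel u"
    and \<omega>: "\<omega> > 0" "\<omega> * r powr hom_dim TYPE('n) \<le> heis_cutoff_mass TYPE('n) r"
  shows "ennreal \<bar>u \<xi> - heis_average r u \<xi>\<bar> \<le> ennreal (r powr s / \<omega>) * local_energy s u \<xi> + ennreal (r powr s)"
proof -
  define Q where "Q = hom_dim TYPE('n)"
  define c where "c = heis_cutoff_mass TYPE('n) r"
  define k where "k \<eta> = heis_cutoff r (heis_inv \<xi> \<cdot>\<^sub>H \<eta>)" for \<eta>
  have um [measurable]: "u \<in> borel_measurable borel" using borel_measurable_integrable[OF u] by simp
  have km [measurable]: "k \<in> borel_measurable borel" unfolding k_def by measurable
  have "\<omega> * r powr Q > 0" using \<omega> r by simp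
  then have c: "c > 0" "\<omega> * r powr Q \<le> c" using \<omega> by (auto simp: c_def Q_def)
  have k: "0 \<le> k \<eta>" "k \<eta> \<le> 1" for \<eta> unfolding k_def by (rule heis_cutoff_bounds)+
  have ki: "integrable lborel k" "(\<integral>\<eta>. k \<eta> \<partial>lborel) = c" "(\<integral>\<^sup>+\<eta>. ennreal (k \<eta>) \<partial>lborel) = ennreal c"
    using heis_cutoff_translate[OF r, of \<xi>] by (auto simp: k_def[abs_def] c_def)
  have uki: "integrable lborel (\<lambda>\<eta>. u \<eta> * k \<eta>)"
    unfolding k_def by (rule heis_average_integrable[OF u])
  have di: "integrable lborel (\<lambda>\<eta>. (u \<xi> - u \<eta>) * k \<eta>)"
    unfolding left_diff_distrib using ki(1) uki by auto
  have "u \<xi> - heis_average r u \<xi> = (\<integral>\<eta>. (u \<xi> - u \<eta>) * k \<eta> \<partial>lborel) / c"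
    unfolding left_diff_distrib using ki uki c(1)
    by (simp add: heis_average_def c_def[symmetric] k_def[symmetric] diff_divide_distrib)
  then have "\<bar>u \<xi> - heis_average r u \<xi>\<bar> = \<bar>\<integral>\<eta>. (u \<xi> - u \<eta>) * k \<eta> \<partial>lborel\<bar> / c" using c by simp
  also have "\<dots> \<le> (\<integral>\<eta>. \<bar>(u \<xi> - u \<eta>) * k \<eta>\<bar> \<partial>lborel) / c"
    using c by (intro divide_right_mono integral_abs_bound) auto
  finally have "ennreal \<bar>u \<xi> - heis_average r u \<xi>\<bar> \<le> ennreal ((1 / c) * (\<integral>\<eta>. \<bar>(u \<xi> - u \<eta>) * k \<eta>\<bar> \<partial>lborel))"
    by (intro ennreal_leI) simp
  also have "\<dots> = ennreal (1 / c) * (\<integral>\<^sup>+\<eta>. ennreal \<bar>(u \<xi> - u \<eta>) * k \<eta>\<bar> \<partial>lborel)"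
    using di c by (subst nn_integral_eq_integral) (auto simp: ennreal_mult[symmetric])
  also have "(\<integral>\<^sup>+\<eta>. ennreal \<bar>(u \<xi> - u \<eta>) * k \<eta>\<bar> \<partial>lborel) \<le>
      (\<integral>\<^sup>+\<eta>. ennreal (r powr (Q + s)) * ennreal ((u \<xi> - u \<eta>)\<^sup>2 * heis_weight s (heis_inv \<eta> \<cdot>\<^sub>H \<xi>)) + ennreal (r powr s) * ennreal (k \<eta>) \<partial>lborel)"
  proof (rule nn_integral_mono)
    fix \<eta>
    let ?w = "heis_weight s (heis_inv \<eta> \<cdot>\<^sub>H \<xi>)" and ?x = "\<bar>u \<xi> - u \<eta>\<bar>"
    have "?x * k \<eta> \<le> r powr (Q + s) * ((u \<xi> - u \<eta>)\<^sup>2 * ?w) + r powr s * k \<eta>"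
    proof (cases "\<eta> = \<xi> \<or> k \<eta> = 0")
      case True
      then show ?thesis using k[of \<eta>] by auto
    next
      case False
      then have "heis_norm (heis_inv \<xi> \<cdot>\<^sub>H \<eta>) < r"
        using heis_cutoff_eq_zero[OF r, of "heis_inv \<xi> \<cdot>\<^sub>H \<eta>"] unfolding k_def by linarith
      then have "heis_norm (heis_inv \<eta> \<cdot>\<^sub>H \<xi>) \<le> r" by (simp add: heis_norm_diff_commute[of \<eta> \<xi>])
      then have w: "r powr (- (Q + 2 * s)) \<le> ?w"
        unfolding Q_def using False by (intro heis_weight_ge[OF s]) (auto simp: heis_diff_eq_zero_iff)
      have "k \<eta> \<le> r powr (Q + 2 * s) * r powr (- (Q + 2 * s))" using k r by (simp flip: powr_add)
      also have "\<dots> \<le> r powr (Q + 2 * s) * ?w" by (rule mult_left_mono[OF w]) simp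
      finally have kw: "k \<eta> \<le> r powr (Q + 2 * s) * ?w" .
      \<comment> \<open>The threshold in \<open>x \<le> x\<^sup>2 / t + t\<close> is chosen so that
        both parts have the same power of \<open>r\<close> after division by the mass.\<close>
      define t where "t = r powr s"
      have t: "t > 0" using r by (simp add: t_def)
      have "?x \<le> ?x\<^sup>2 / t + t"
      proof (cases "?x \<le> t")
        case True
        then show ?thesis using t by (simp add: add_increasing)
      next
        case False
        then have "?x * t \<le> ?x * ?x" using t by (intro mult_left_mono) auto
        then have "?x \<le> ?x\<^sup>2 / t" using t by (simp add: le_divide_eq power2_eq_square)
        then show ?thesis using t by simp
      qed
      then have "?x * k \<eta> \<le> (?x\<^sup>2 / t + t) * k \<eta>" using k(1) by (rule mult_right_mono)
      also have "\<dots> = (u \<xi> - u \<eta>)\<^sup>2 / t * k \<eta> + t * k \<eta>" by (simp add: distrib_right)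
      also have "(u \<xi> - u \<eta>)\<^sup>2 / t * k \<eta> \<le> (u \<xi> - u \<eta>)\<^sup>2 / t * (r powr (Q + 2 * s) * ?w)"
        using t by (intro mult_left_mono kw) auto
      also have "\<dots> = r powr (Q + s) * ((u \<xi> - u \<eta>)\<^sup>2 * ?w)"
      proof -
        have "r powr (Q + 2 * s) = t * r powr (Q + s)" by (simp add: t_def algebra_simps flip: powr_add)
        then show ?thesis using t by simp
      qed
      finally show ?thesis by (simp add: t_def)
    qed
    then show "ennreal \<bar>(u \<xi> - u \<eta>) * k \<eta>\<bar> \<le>
        ennreal (r powr (Q + s)) * ennreal ((u \<xi> - u \<eta>)\<^sup>2 * ?w) + ennreal (r powr s) * ennreal (k \<eta>)"
      using k by (simp add: abs_mult ennreal_mult[symmetric] ennreal_plus[symmetric] del: ennreal_plus)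
  qed
  also have "\<dots> = ennreal (r powr (Q + s)) * local_energy s u \<xi> + ennreal (r powr s) * ennreal c"
  proof -
    have [measurable]: "(\<lambda>\<eta>. heis_weight s (heis_inv \<eta> \<cdot>\<^sub>H \<xi>)) \<in> borel_measurable borel" by measurable
    show ?thesis unfolding local_energy_def
      by (subst nn_integral_add) (auto simp: nn_integral_cmult ki(3))
  qed
  finally have "ennreal \<bar>u \<xi> - heis_average r u \<xi>\<bar> \<le>
      ennreal (1 / c) * (ennreal (r powr (Q + s)) * local_energy s u \<xi> + ennreal (r powr s) * ennreal c)"
    by (simp add: mult_left_mono)
  also have "\<dots> = ennreal (1 / c * r powr (Q + s)) * local_energy s u \<xi> + ennreal (r powr s)"
    using c by (simp add: distrib_left ennreal_mult[symmetric] mult.assoc[symmetric])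
  also have "\<dots> \<le> ennreal (r powr s / \<omega>) * local_energy s u \<xi> + ennreal (r powr s)"
  proof (intro add_right_mono mult_right_mono ennreal_leI)
    have "1 / c * r powr (Q + s) \<le> 1 / (\<omega> * r powr Q) * r powr (Q + s)"
      using c \<open>\<omega> * r powr Q > 0\<close> by (intro mult_right_mono divide_left_mono) auto
    also have "\<dots> = r powr s / \<omega>" using r \<omega> by (simp add: powr_add)
    finally show "1 / c * r powr (Q + s) \<le> r powr s / \<omega>" .
  qed simp
  finally show ?thesis .
qed

text \<open>The cut-off of the group difference is uniformly continuous on the compact square of the
  closure of \<Omega>, so the modulus depends on \<open>u\<close> only through its support and the
  bound \<open>L\<close> on its integral.\<close>

lemma heis_average_equicontinuous:
  fixes \<Omega> :: "'n::finite heis set"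
  assumes r: "r > 0" and c: "heis_cutoff_mass TYPE('n) r > 0" and \<Omega>: "bounded \<Omega>" and e: "e > 0"
  shows "\<exists>d>0. \<forall>u \<xi> \<xi>'. integrable lborel u \<longrightarrow> (\<forall>\<eta>. \<eta> \<notin> \<Omega> \<longrightarrow> u \<eta> = 0) \<longrightarrow> (\<integral>\<eta>. \<bar>u \<eta>\<bar> \<partial>lborel) \<le> L \<longrightarrow>
    \<xi> \<in> closure \<Omega> \<longrightarrow> \<xi>' \<in> closure \<Omega> \<longrightarrow> dist \<xi> \<xi>' < d \<longrightarrow> \<bar>heis_average r u \<xi> - heis_average r u \<xi>'\<bar> < e"
proof -
  define c where "c = heis_cutoff_mass TYPE('n) r"
  have c0: "c > 0" using c by (simp add: c_def)
  \<comment> \<open>The added 1 avoids division by 0 and makes the final inequality strict.\<close>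
  define e' where "e' = e * c / (\<bar>L\<bar> + 1)"
  have e': "e' > 0" using e c0 by (simp add: e'_def)
  have "compact (closure \<Omega> \<times> closure \<Omega>)" using \<Omega> by (intro compact_Times) auto
  then have "uniformly_continuous_on (closure \<Omega> \<times> closure \<Omega>) (\<lambda>z. heis_cutoff r (heis_inv (fst z) \<cdot>\<^sub>H snd z))"
    by (intro compact_uniformly_continuous continuous_intros)
  then obtain d where d: "d > 0" "\<And>z z'. z \<in> closure \<Omega> \<times> closure \<Omega> \<Longrightarrow> z' \<in> closure \<Omega> \<times> closure \<Omega> \<Longrightarrow> dist z' z < d \<Longrightarrow>
      dist (heis_cutoff r (heis_inv (fst z') \<cdot>\<^sub>H snd z')) (heis_cutoff r (heis_inv (fst z) \<cdot>\<^sub>H snd z)) < e'"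
    using e' unfolding uniformly_continuous_on_def by metis
  show ?thesis
  proof (intro exI[of _ d] conjI allI impI)
    fix u and \<xi> \<xi>' :: "'n heis"
    assume u: "integrable lborel u" and out: "\<forall>\<eta>. \<eta> \<notin> \<Omega> \<longrightarrow> u \<eta> = 0" and L: "(\<integral>\<eta>. \<bar>u \<eta>\<bar> \<partial>lborel) \<le> L"
      and \<xi>: "\<xi> \<in> closure \<Omega>" "\<xi>' \<in> closure \<Omega>" "dist \<xi> \<xi>' < d"
    let ?k = "\<lambda>\<xi> \<eta>. heis_cutoff r (heis_inv \<xi> \<cdot>\<^sub>H \<eta>)"
    have L0: "0 \<le> L" using L by (rule order_trans[rotated]) simp
    have int: "integrable lborel (\<lambda>\<eta>. u \<eta> * ?k \<xi> \<eta>)" for \<xi> by (rule heis_average_integrable[OF u])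
    have "heis_average r u \<xi> - heis_average r u \<xi>' = (\<integral>\<eta>. u \<eta> * ?k \<xi> \<eta> - u \<eta> * ?k \<xi>' \<eta> \<partial>lborel) / c"
      using int by (simp add: heis_average_def c_def diff_divide_distrib)
    then have "\<bar>heis_average r u \<xi> - heis_average r u \<xi>'\<bar> = \<bar>\<integral>\<eta>. u \<eta> * ?k \<xi> \<eta> - u \<eta> * ?k \<xi>' \<eta> \<partial>lborel\<bar> / c"
      using c0 by simp
    also have "\<dots> \<le> (\<integral>\<eta>. \<bar>u \<eta> * ?k \<xi> \<eta> - u \<eta> * ?k \<xi>' \<eta>\<bar> \<partial>lborel) / c"
      using c0 by (intro divide_right_mono integral_abs_bound) auto
    also have "\<dots> \<le> (\<integral>\<eta>. e' * \<bar>u \<eta>\<bar> \<partial>lborel) / c"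
    proof (intro divide_right_mono integral_mono)
      fix \<eta>
      show "\<bar>u \<eta> * ?k \<xi> \<eta> - u \<eta> * ?k \<xi>' \<eta>\<bar> \<le> e' * \<bar>u \<eta>\<bar>"
      proof (cases "\<eta> \<in> \<Omega>")
        case True
        then have "\<eta> \<in> closure \<Omega>" using closure_subset by blast
        then have "dist (?k \<xi> \<eta>) (?k \<xi>' \<eta>) < e'"
          using d(2)[of "(\<xi>', \<eta>)" "(\<xi>, \<eta>)"] \<xi> by (simp add: dist_Pair_Pair)
        then have "\<bar>u \<eta>\<bar> * \<bar>?k \<xi> \<eta> - ?k \<xi>' \<eta>\<bar> \<le> \<bar>u \<eta>\<bar> * e'"
          by (intro mult_left_mono) (auto simp: dist_real_def)
        then show ?thesis by (simp add: abs_mult[symmetric] right_diff_distrib mult.commute)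
      next
        case False
        then have "u \<eta> = 0" using out by blast
        then show ?thesis by simp
      qed
    qed (use int u c0 in auto)
    also have "\<dots> = e' * (\<integral>\<eta>. \<bar>u \<eta>\<bar> \<partial>lborel) / c" by simp
    also have "\<dots> \<le> e' * L / c" using L e' c0 by (intro divide_right_mono mult_left_mono) auto
    also have "\<dots> = e * (L / (L + 1))" using c0 L0 by (simp add: e'_def)
    also have "\<dots> < e * 1" using e L0 by (intro mult_strict_left_mono) auto
    finally show "\<bar>heis_average r u \<xi> - heis_average r u \<xi>'\<bar> < e" by simp
  qed (rule d(1))
qed

text \<open>For a fixed radius the averages are bounded and equicontinuous on a compact set. The
  conclusion is a Cauchy condition rather than a limit, so that it survives the passage to a
  diagonal subsequence.\<close>

lemma heis_average_precompact:
  fixes \<Omega> :: "'n::finite heis set" and x :: "nat \<Rightarrow> 'n heis \<Rightarrow> real"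
  assumes r: "r > 0" and c: "heis_cutoff_mass TYPE('n) r > 0" and \<Omega>: "bounded \<Omega>"
    and x: "\<And>n. integrable lborel (x n)" "\<And>n \<eta>. \<eta> \<notin> \<Omega> \<Longrightarrow> x n \<eta> = 0" "\<And>n. (\<integral>\<eta>. \<bar>x n \<eta>\<bar> \<partial>lborel) \<le> L"
  shows "\<exists>k::nat \<Rightarrow> nat. strict_mono k \<and>
    (\<forall>e>0. \<exists>n0. \<forall>m\<ge>n0. \<forall>n\<ge>n0. \<forall>\<xi>\<in>\<Omega>. \<bar>heis_average r (x (k m)) \<xi> - heis_average r (x (k n)) \<xi>\<bar> < e)"
proof -
  have S: "compact (closure \<Omega>)" using \<Omega> by simp
  have bd: "norm (heis_average r (x n) \<xi>) \<le> L / heis_cutoff_mass TYPE('n) r" for n \<xi>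
  proof -
    have "\<bar>\<integral>\<eta>. x n \<eta> * heis_cutoff r (heis_inv \<xi> \<cdot>\<^sub>H \<eta>) \<partial>lborel\<bar> \<le> (\<integral>\<eta>. \<bar>x n \<eta> * heis_cutoff r (heis_inv \<xi> \<cdot>\<^sub>H \<eta>)\<bar> \<partial>lborel)"
      by (rule integral_abs_bound)
    also have "\<dots> \<le> (\<integral>\<eta>. \<bar>x n \<eta>\<bar> \<partial>lborel)"
    proof (rule integral_mono)
      show "integrable lborel (\<lambda>\<eta>. \<bar>x n \<eta> * heis_cutoff r (heis_inv \<xi> \<cdot>\<^sub>H \<eta>)\<bar>)"
        by (intro integrable_abs heis_average_integrable x)
    qed (use x(1) in \<open>simp_all add: abs_mult mult_left_le heis_cutoff_bounds\<close>)
    also have "\<dots> \<le> L" by (rule x(3))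
    finally show ?thesis using c by (simp add: heis_average_def divide_right_mono)
  qed
  obtain g k where k: "strict_mono (k :: nat \<Rightarrow> nat)"
    "\<And>e. 0 < e \<Longrightarrow> \<exists>N. \<forall>n \<xi>. n \<ge> N \<and> \<xi> \<in> closure \<Omega> \<longrightarrow> norm (heis_average r (x (k n)) \<xi> - g \<xi>) < e"
  proof (rule Arzela_Ascoli[OF S, of "\<lambda>n. heis_average r (x n)"])
    show "norm (heis_average r (x n) \<xi>) \<le> L / heis_cutoff_mass TYPE('n) r" for n \<xi> by (rule bd)
    show "\<exists>d. 0 < d \<and> (\<forall>n y. y \<in> closure \<Omega> \<and> norm (\<xi> - y) < d \<longrightarrow>
        norm (heis_average r (x n) \<xi> - heis_average r (x n) y) < e)" if \<xi>: "\<xi> \<in> closure \<Omega>" and e: "0 < e" for \<xi> e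
    proof -
      obtain d where "d > 0" "\<And>u \<xi> \<xi>'. integrable lborel u \<Longrightarrow> (\<forall>\<eta>. \<eta> \<notin> \<Omega> \<longrightarrow> u \<eta> = 0) \<Longrightarrow> (\<integral>\<eta>. \<bar>u \<eta>\<bar> \<partial>lborel) \<le> L \<Longrightarrow>
         \<xi> \<in> closure \<Omega> \<Longrightarrow> \<xi>' \<in> closure \<Omega> \<Longrightarrow> dist \<xi> \<xi>' < d \<Longrightarrow> \<bar>heis_average r u \<xi> - heis_average r u \<xi>'\<bar> < e"
        using heis_average_equicontinuous[OF r c \<Omega> e, of L] by blast
      then show ?thesis using x \<xi> by (intro exI[of _ d]) (auto simp: dist_norm)
    qed
  qed blast
  have "\<exists>n0. \<forall>m\<ge>n0. \<forall>n\<ge>n0. \<forall>\<xi>\<in>\<Omega>. \<bar>heis_average r (x (k m)) \<xi> - heis_average r (x (k n)) \<xi>\<bar> < e" if e: "e > 0" for e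
  proof -
    obtain N where N: "\<And>n \<xi>. n \<ge> N \<Longrightarrow> \<xi> \<in> closure \<Omega> \<Longrightarrow> norm (heis_average r (x (k n)) \<xi> - g \<xi>) < e / 2"
      using k(2)[OF half_gt_zero[OF e]] by blast
    show ?thesis
    proof (intro exI[of _ N] allI impI ballI)
      fix m n \<xi> assume "N \<le> m" "N \<le> n" "\<xi> \<in> \<Omega>"
      then have "\<xi> \<in> closure \<Omega>" using closure_subset by blast
      from N[OF \<open>N \<le> m\<close> this] N[OF \<open>N \<le> n\<close> this]
      show "\<bar>heis_average r (x (k m)) \<xi> - heis_average r (x (k n)) \<xi>\<bar> < e"
        unfolding real_norm_def by linarith
    qed
  qed
  then show ?thesis using k(1) by blast
qed

context
  fixes s p Q :: real
  assumes s: "0 < s" "s < 1" and Q_def: "Q = hom_dim TYPE('n::finite)" and p: "p = 2 * Q / (Q - 2 * s)"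
begin

text \<open>Functions are close to their averages in the integral norm, uniformly along the
  sequence, and for each radius the averages have a uniformly Cauchy subsequence. A diagonal
  subsequence over all radii is therefore Cauchy in the integral norm and has an almost everywhere
  convergent subsequence.\<close>

lemma heis_compact_borel:
  fixes \<Omega> :: "'n heis set" and x :: "nat \<Rightarrow> 'n heis \<Rightarrow> real"
  assumes \<Omega>: "open \<Omega>" "bounded \<Omega>"
    and xm: "\<And>n. x n \<in> borel_measurable borel" and out: "\<And>n \<eta>. \<eta> \<notin> \<Omega> \<Longrightarrow> x n \<eta> = 0"
    and e: "0 \<le> e" "\<And>n. (\<integral>\<^sup>+\<xi>. local_energy s (x n) \<xi> * indicator \<Omega> \<xi> \<partial>lborel) \<le> ennreal e"
  shows "\<exists>(r::nat \<Rightarrow> nat) l. strict_mono r \<and> l \<in> borel_measurable borel \<and>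
    (AE y in lborel. (\<lambda>n. x (r n) y) \<longlonglongrightarrow> l y)"
proof -
  note [measurable] = xm
  have \<Omega>m [measurable]: "\<Omega> \<in> sets borel" using \<Omega> by auto
  have \<Omega>fin: "emeasure lborel \<Omega> < \<infinity>" by (rule emeasure_bounded_finite[OF \<Omega>(2)])
  have p2: "p > 2" using sobolev_exponent(1)[OF s Q_def p] .
  define W where "W = measure lborel \<Omega>"
  have W: "emeasure lborel \<Omega> = ennreal W" "W \<ge> 0"
    using \<Omega>fin by (auto simp: W_def emeasure_eq_ennreal_measure)
  obtain C where C: "C > 0" "\<And>(u :: 'n heis \<Rightarrow> real) \<Omega> e. u \<in> borel_measurable borel \<Longrightarrow> \<Omega> \<in> sets borel \<Longrightarrow>
     emeasure lborel \<Omega> < \<infinity> \<Longrightarrow> (\<forall>\<xi>. \<xi> \<notin> \<Omega> \<longrightarrow> u \<xi> = 0) \<Longrightarrow> 0 \<le> e \<Longrightarrow>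
     (\<integral>\<^sup>+\<xi>. local_energy s u \<xi> * indicator \<Omega> \<xi> \<partial>lborel) \<le> ennreal e \<Longrightarrow>
     (\<integral>\<^sup>+\<xi>. ennreal (\<bar>u \<xi>\<bar> powr p) \<partial>lborel) \<le> ennreal (C * e powr (p / 2))"
    using sobolev_borel[OF s Q_def p] by blast
  \<comment> \<open>On \<Omega>, \<open>t \<le> 1 + t powr p\<close> turns the Sobolev bound into a
    bound of the integrals of \<open>\<bar>x n\<bar>\<close>.\<close>
  define L where "L = W + C * e powr (p / 2)"
  have L0: "L \<ge> 0" using W C by (simp add: L_def)
  have nnL: "(\<integral>\<^sup>+\<eta>. ennreal \<bar>x n \<eta>\<bar> \<partial>lborel) \<le> ennreal L" for n
  proof -
    have "(\<integral>\<^sup>+\<eta>. ennreal \<bar>x n \<eta>\<bar> \<partial>lborel) \<le> (\<integral>\<^sup>+\<eta>. indicator \<Omega> \<eta> + ennreal (\<bar>x n \<eta>\<bar> powr p) \<partial>lborel)"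
    proof (rule nn_integral_mono)
      fix \<eta>
      show "ennreal \<bar>x n \<eta>\<bar> \<le> indicator \<Omega> \<eta> + ennreal (\<bar>x n \<eta>\<bar> powr p)"
      proof (cases "\<eta> \<in> \<Omega>")
        case True
        have "\<bar>x n \<eta>\<bar> \<le> 1 + \<bar>x n \<eta>\<bar> powr p"
        proof (cases "\<bar>x n \<eta>\<bar> \<le> 1")
          case False
          then have "\<bar>x n \<eta>\<bar> powr 1 \<le> \<bar>x n \<eta>\<bar> powr p" using p2 by (intro powr_mono) auto
          then show ?thesis using False by simp
        qed (simp add: add_increasing2)
        then have "ennreal \<bar>x n \<eta>\<bar> \<le> ennreal (1 + \<bar>x n \<eta>\<bar> powr p)" by (rule ennreal_leI)
        then show ?thesis using True by simp
      qed (simp add: out)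
    qed
    also have "\<dots> = emeasure lborel \<Omega> + (\<integral>\<^sup>+\<eta>. ennreal (\<bar>x n \<eta>\<bar> powr p) \<partial>lborel)"
      by (subst nn_integral_add) auto
    also have "\<dots> \<le> ennreal W + ennreal (C * e powr (p / 2))"
      unfolding W(1) using out \<Omega>fin e by (intro add_left_mono C(2)[of "x n" \<Omega>]) auto
    finally show ?thesis using W C by (simp add: L_def)
  qed
  have xi: "integrable lborel (x n)" for n
  proof (rule integrableI_bounded)
    show "(\<integral>\<^sup>+\<eta>. ennreal (norm (x n \<eta>)) \<partial>lborel) < \<infinity>"
      using nnL[of n] by (simp add: le_less_trans[OF _ ennreal_less_top])
  qed simp
  have xL: "(\<integral>\<eta>. \<bar>x n \<eta>\<bar> \<partial>lborel) \<le> L" for n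
    using nnL[of n] L0 by (subst integral_eq_nn_integral) (auto intro: enn2real_leI)
  obtain \<omega> where \<omega>: "\<omega> > 0" "\<And>r. r > 0 \<Longrightarrow> \<omega> * r powr hom_dim TYPE('n) \<le> heis_cutoff_mass TYPE('n) r"
    using heis_cutoff_mass_ge[where 'n='n] by blast
  have mass: "heis_cutoff_mass TYPE('n) r > 0" if "r > 0" for r
  proof -
    have "0 < \<omega> * r powr hom_dim TYPE('n)" using \<omega>(1) that by simp
    also have "\<dots> \<le> heis_cutoff_mass TYPE('n) r" by (rule \<omega>(2)[OF that])
    finally show ?thesis .
  qed
  \<comment> \<open>\<open>K\<close> collects the two error terms of
    \<open>heis_average_close\<close> after integration over \<Omega>.\<close>
  define K where "K = e / \<omega> + W"
  have K0: "K \<ge> 0" using e \<omega> W by (simp add: K_def)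
  have av_meas: "heis_average r u \<in> borel_measurable borel" if "u \<in> borel_measurable borel" for r and u :: "'n heis \<Rightarrow> real"
  proof -
    note [measurable] = that
    have 1: "(\<lambda>z :: 'n heis \<times> 'n heis. heis_cutoff r (heis_inv (fst z) \<cdot>\<^sub>H snd z)) \<in> borel_measurable borel"
      by (intro borel_measurable_continuous_onI continuous_intros)
    have "(\<lambda>z :: 'n heis \<times> 'n heis. u (snd z) * heis_cutoff r (heis_inv (fst z) \<cdot>\<^sub>H snd z)) \<in> borel_measurable (borel \<Otimes>\<^sub>M borel)"
      unfolding borel_prod
      by (intro borel_measurable_times 1 measurable_compose[OF _ that] borel_measurable_continuous_onI continuous_intros)
    moreover have "sets (borel \<Otimes>\<^sub>M lborel) = sets (borel \<Otimes>\<^sub>M borel :: ('n heis \<times> 'n heis) measure)"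
      by (rule sets_pair_measure_cong) auto
    ultimately have "(\<lambda>(\<xi>, \<eta>). u \<eta> * heis_cutoff r (heis_inv \<xi> \<cdot>\<^sub>H \<eta>)) \<in> borel_measurable (borel \<Otimes>\<^sub>M lborel)"
      by (simp add: split_beta' cong: measurable_cong_sets)
    from lborel.borel_measurable_lebesgue_integral[OF this]
    show ?thesis unfolding heis_average_def by (intro borel_measurable_divide) auto
  qed
  have close: "(\<integral>\<^sup>+\<xi>. ennreal \<bar>x n \<xi> - heis_average r (x n) \<xi>\<bar> * indicator \<Omega> \<xi> \<partial>lborel) \<le> ennreal (r powr s * K)"
    if r: "r > 0" for r n
  proof -
    have "(\<integral>\<^sup>+\<xi>. ennreal \<bar>x n \<xi> - heis_average r (x n) \<xi>\<bar> * indicator \<Omega> \<xi> \<partial>lborel)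
      \<le> (\<integral>\<^sup>+\<xi>. ennreal (r powr s / \<omega>) * (local_energy s (x n) \<xi> * indicator \<Omega> \<xi>) + ennreal (r powr s) * indicator \<Omega> \<xi> \<partial>lborel)"
    proof (rule nn_integral_mono)
      fix \<xi>
      show "ennreal \<bar>x n \<xi> - heis_average r (x n) \<xi>\<bar> * indicator \<Omega> \<xi>
        \<le> ennreal (r powr s / \<omega>) * (local_energy s (x n) \<xi> * indicator \<Omega> \<xi>) + ennreal (r powr s) * indicator \<Omega> \<xi>"
        using heis_average_close[OF s(1) r xi \<omega>(1) \<omega>(2)[OF r], of n \<xi>] by (cases "\<xi> \<in> \<Omega>") simp_all
    qed
    also have "\<dots> = ennreal (r powr s / \<omega>) * (\<integral>\<^sup>+\<xi>. local_energy s (x n) \<xi> * indicator \<Omega> \<xi> \<partial>lborel) + ennreal (r powr s) * ennreal W"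
      by (subst nn_integral_add) (auto simp: nn_integral_cmult W(1))
    also have "\<dots> \<le> ennreal (r powr s / \<omega>) * ennreal e + ennreal (r powr s) * ennreal W"
      by (intro add_right_mono mult_left_mono e(2)) simp
    also have "\<dots> = ennreal (r powr s / \<omega> * e + r powr s * W)"
      using e(1) \<omega>(1) W(2) by (simp add: ennreal_mult[symmetric])
    also have "r powr s / \<omega> * e + r powr s * W = r powr s * K" by (simp add: K_def algebra_simps)
    finally show ?thesis .
  qed
  define rad where "rad j = 1 / real (Suc j)" for j
  have rad: "rad j > 0" for j by (simp add: rad_def)
  define P where "P j k \<longleftrightarrow> (\<forall>e>0. \<exists>n0. \<forall>m\<ge>n0. \<forall>n\<ge>n0. \<forall>\<xi>\<in>\<Omega>.
     \<bar>heis_average (rad j) (x (k m)) \<xi> - heis_average (rad j) (x (k n)) \<xi>\<bar> < e)" for j and k :: "nat \<Rightarrow> nat"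
  \<comment> \<open>One property per radius \<open>rad j\<close>, so that the diagonal sequence
    serves all radii at once.\<close>
  interpret subseqs P
  proof
    fix j and k :: "nat \<Rightarrow> nat"
    show "\<exists>r'. strict_mono r' \<and> P j (k \<circ> r')"
      unfolding P_def o_def
      by (rule heis_average_precompact[OF rad mass[OF rad] \<Omega>(2), of "\<lambda>n. x (k n)" L])
        (simp_all add: xi out xL)
  qed
  have stable: "P j (k \<circ> r')" if r': "strict_mono r'" and Pk: "P j k" for r' k j
    unfolding P_def
  proof (intro allI impI)
    fix e :: real assume "e > 0"
    then obtain n0 where n0: "\<And>m n \<xi>. m \<ge> n0 \<Longrightarrow> n \<ge> n0 \<Longrightarrow> \<xi> \<in> \<Omega> \<Longrightarrow>
       \<bar>heis_average (rad j) (x (k m)) \<xi> - heis_average (rad j) (x (k n)) \<xi>\<bar> < e"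
      using Pk unfolding P_def by blast
    show "\<exists>n0. \<forall>m\<ge>n0. \<forall>n\<ge>n0. \<forall>\<xi>\<in>\<Omega>. \<bar>heis_average (rad j) (x ((k \<circ> r') m)) \<xi> - heis_average (rad j) (x ((k \<circ> r') n)) \<xi>\<bar> < e"
    proof (intro exI allI impI ballI)
      fix m n \<xi> assume "n0 \<le> m" "n0 \<le> n" "\<xi> \<in> \<Omega>"
      then show "\<bar>heis_average (rad j) (x ((k \<circ> r') m)) \<xi> - heis_average (rad j) (x ((k \<circ> r') n)) \<xi>\<bar> < e"
        using n0[of "r' m" "r' n" \<xi>] seq_suble[OF r', of m] seq_suble[OF r', of n] by simp
    qed
  qed
  define d where "d = diagseq"
  have d: "strict_mono d" unfolding d_def by (rule subseq_diagseq)
  \<comment> \<open>Only from index \<open>Suc j\<close> on is the diagonal sequence a subsequence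
    of the one chosen for \<open>j\<close>; since a Cauchy condition ignores initial terms, the
    shift disappears in \<open>unif\<close>.\<close>
  have Pd: "P j (d \<circ> (+) (Suc j))" for j
    unfolding d_def by (rule diagseq_holds) (rule stable)
  have unif: "\<exists>n0. \<forall>m\<ge>n0. \<forall>n\<ge>n0. \<forall>\<xi>\<in>\<Omega>. \<bar>heis_average (rad j) (x (d m)) \<xi> - heis_average (rad j) (x (d n)) \<xi>\<bar> < e'"
    if e': "e' > 0" for j e'
  proof -
    obtain n0 where n0: "\<And>m n \<xi>. m \<ge> n0 \<Longrightarrow> n \<ge> n0 \<Longrightarrow> \<xi> \<in> \<Omega> \<Longrightarrow>
       \<bar>heis_average (rad j) (x (d (Suc j + m))) \<xi> - heis_average (rad j) (x (d (Suc j + n))) \<xi>\<bar> < e'"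
      using Pd[of j] e' unfolding P_def o_def by blast
    show ?thesis
    proof (intro exI allI impI ballI)
      fix m n \<xi> assume "n0 + Suc j \<le> m" "n0 + Suc j \<le> n" "\<xi> \<in> \<Omega>"
      then show "\<bar>heis_average (rad j) (x (d m)) \<xi> - heis_average (rad j) (x (d n)) \<xi>\<bar> < e'"
        using n0[of "m - Suc j" "n - Suc j" \<xi>] by simp
    qed
  qed
  have Cauchy: "\<exists>n0. \<forall>i\<ge>n0. \<forall>j\<ge>n0. (LINT \<xi>|lborel. norm (x (d i) \<xi> - x (d j) \<xi>)) < e'" if e': "e' > 0" for e'
  proof -
    \<comment> \<open>The radius is fixed first, making the two averaging errors less than
      \<open>e' / 4\<close> each; for this radius the averages are then made uniformly close, which
      contributes at most another \<open>e' / 4\<close>.\<close>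
    have "(\<lambda>j. rad j powr s * K) \<longlonglongrightarrow> 0 powr s * K"
      unfolding rad_def using s
      by (intro tendsto_mult tendsto_const tendsto_powr' LIMSEQ_Suc[OF lim_1_over_n]) auto
    then have "\<forall>\<^sub>F j in sequentially. rad j powr s * K < e' / 4"
      using e' s by (intro order_tendstoD) auto
    then obtain j where j: "rad j powr s * K < e' / 4" by (auto simp: eventually_sequentially)
    define \<epsilon> where "\<epsilon> = e' / (4 * (W + 1))"
    have \<epsilon>: "\<epsilon> > 0" using e' W by (simp add: \<epsilon>_def)
    obtain n0 where n0: "\<And>m n \<xi>. m \<ge> n0 \<Longrightarrow> n \<ge> n0 \<Longrightarrow> \<xi> \<in> \<Omega> \<Longrightarrow>
       \<bar>heis_average (rad j) (x (d m)) \<xi> - heis_average (rad j) (x (d n)) \<xi>\<bar> < \<epsilon>"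
      using unif[OF \<epsilon>, of j] by blast
    show ?thesis
    proof (intro exI allI impI)
      fix m n assume mn: "n0 \<le> m" "n0 \<le> n"
      let ?a = "heis_average (rad j)"
      note [measurable] = av_meas[OF xm, of "rad j"]
      have "(\<integral>\<^sup>+\<xi>. ennreal (norm (x (d m) \<xi> - x (d n) \<xi>)) \<partial>lborel) \<le>
        (\<integral>\<^sup>+\<xi>. (ennreal \<bar>x (d m) \<xi> - ?a (x (d m)) \<xi>\<bar> * indicator \<Omega> \<xi> + ennreal \<bar>x (d n) \<xi> - ?a (x (d n)) \<xi>\<bar> * indicator \<Omega> \<xi>)
          + ennreal \<epsilon> * indicator \<Omega> \<xi> \<partial>lborel)"
      proof (rule nn_integral_mono)
        fix \<xi>
        show "ennreal (norm (x (d m) \<xi> - x (d n) \<xi>)) \<le>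
          (ennreal \<bar>x (d m) \<xi> - ?a (x (d m)) \<xi>\<bar> * indicator \<Omega> \<xi> + ennreal \<bar>x (d n) \<xi> - ?a (x (d n)) \<xi>\<bar> * indicator \<Omega> \<xi>)
          + ennreal \<epsilon> * indicator \<Omega> \<xi>"
        proof (cases "\<xi> \<in> \<Omega>")
          case True
          have "norm (x (d m) \<xi> - x (d n) \<xi>) \<le> (\<bar>x (d m) \<xi> - ?a (x (d m)) \<xi>\<bar> + \<bar>x (d n) \<xi> - ?a (x (d n)) \<xi>\<bar>) + \<epsilon>"
            using n0[OF mn True] unfolding real_norm_def by linarith
          then have "ennreal (norm (x (d m) \<xi> - x (d n) \<xi>)) \<le> ennreal ((\<bar>x (d m) \<xi> - ?a (x (d m)) \<xi>\<bar> + \<bar>x (d n) \<xi> - ?a (x (d n)) \<xi>\<bar>) + \<epsilon>)"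
            by (rule ennreal_leI)
          then show ?thesis using True \<epsilon> by simp
        qed (simp add: out)
      qed
      also have "\<dots> = (\<integral>\<^sup>+\<xi>. ennreal \<bar>x (d m) \<xi> - ?a (x (d m)) \<xi>\<bar> * indicator \<Omega> \<xi> \<partial>lborel)
         + (\<integral>\<^sup>+\<xi>. ennreal \<bar>x (d n) \<xi> - ?a (x (d n)) \<xi>\<bar> * indicator \<Omega> \<xi> \<partial>lborel) + ennreal \<epsilon> * ennreal W"
        by (simp add: nn_integral_add nn_integral_cmult W(1))
      also have "\<dots> \<le> ennreal (rad j powr s * K) + ennreal (rad j powr s * K) + ennreal \<epsilon> * ennreal W"
        by (intro add_mono close[OF rad] order_refl)
      also have "\<dots> = ennreal (rad j powr s * K + rad j powr s * K + \<epsilon> * W)"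
        using K0 \<epsilon> W(2) by (simp add: ennreal_mult[symmetric] ennreal_plus[symmetric] del: ennreal_plus)
      finally have le: "(\<integral>\<^sup>+\<xi>. ennreal (norm (x (d m) \<xi> - x (d n) \<xi>)) \<partial>lborel) \<le> ennreal (rad j powr s * K + rad j powr s * K + \<epsilon> * W)" .
      have nn: "0 \<le> rad j powr s * K + rad j powr s * K + \<epsilon> * W" using K0 \<epsilon> W by simp
      have "(LINT \<xi>|lborel. norm (x (d m) \<xi> - x (d n) \<xi>)) \<le> rad j powr s * K + rad j powr s * K + \<epsilon> * W"
        using enn2real_leI[OF nn le] by (subst integral_eq_nn_integral) auto
      also have "\<epsilon> * W \<le> e' / 4"
      proof -
        have "\<epsilon> * W \<le> \<epsilon> * (W + 1)" using \<epsilon> by (intro mult_left_mono) auto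
        also have "\<dots> = e' / 4"
        proof -
          have "W + 1 \<noteq> 0" using W by linarith
          then show ?thesis unfolding \<epsilon>_def by (simp only: times_divide_eq_left) (simp add: field_simps)
        qed
        finally show ?thesis .
      qed
      finally show "(LINT \<xi>|lborel. norm (x (d m) \<xi> - x (d n) \<xi>)) < e'" using j e' by linarith
    qed
  qed
  obtain r where r: "strict_mono r" "AE \<xi> in lborel. Cauchy (\<lambda>i. x (d (r i)) \<xi>)"
    using cauchy_L1_AE_cauchy_subseq[of lborel "\<lambda>n. x (d n)", OF xi Cauchy] by blast
  define l where "l \<xi> = lim (\<lambda>i. x (d (r i)) \<xi>)" for \<xi>
  have "l \<in> borel_measurable borel"
    unfolding l_def using borel_measurable_lim_metric[of "\<lambda>i. x (d (r i))" borel] by simp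
  moreover have "AE \<xi> in lborel. (\<lambda>i. x (d (r i)) \<xi>) \<longlonglongrightarrow> l \<xi>"
    using r(2) by eventually_elim (metis l_def real_Cauchy_convergent convergent_LIMSEQ_iff)
  moreover have "strict_mono (\<lambda>i. d (r i))" using strict_mono_o[OF d r(1)] by (simp add: o_def)
  ultimately show ?thesis by (intro exI[of _ "\<lambda>i. d (r i)"] exI[of _ l]) auto
qed

end

section \<open>The space of the kernel\<close>

text \<open>Pairs with only the first point in \<Omega> are integrated over the second point first,
  which leads to this order of the difference.\<close>

lemma AE_heis_diff_swap:
  fixes P :: "'n::finite heis \<Rightarrow> bool"
  assumes "AE \<zeta> in lborel. P \<zeta>"
  shows "AE z in lborel. P (heis_inv (fst z) \<cdot>\<^sub>H snd z)"
proof -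
  obtain N where N: "N \<in> null_sets lborel" "{x. \<not> P x} \<subseteq> N"
    using assms by (auto simp: eventually_ae_filter)
  have Nm [measurable]: "N \<in> sets borel" using N(1) by auto
  have [measurable]: "(\<lambda>z::'n heis \<times> 'n heis. heis_inv (fst z) \<cdot>\<^sub>H snd z) \<in> borel_measurable borel"
    by (intro borel_measurable_continuous_onI continuous_intros)
  let ?D = "{z. heis_inv (fst z) \<cdot>\<^sub>H snd z \<in> N}"
  have [measurable]: "?D \<in> sets borel" by measurable
  have "emeasure lborel ?D = (\<integral>\<^sup>+z. indicator ?D z \<partial>lborel)" by simp
  also have "\<dots> = (\<integral>\<^sup>+\<xi>. \<integral>\<^sup>+\<eta>. indicator ?D (\<xi>, \<eta>) \<partial>lborel \<partial>lborel)"
    by (rule nn_integral_lborel_fst) measurable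
  also have "\<dots> = (\<integral>\<^sup>+\<xi>. \<integral>\<^sup>+\<eta>. indicator N (heis_inv \<xi> \<cdot>\<^sub>H \<eta>) \<partial>(lborel :: 'n heis measure) \<partial>(lborel :: 'n heis measure))"
    by (intro nn_integral_cong) (auto simp: indicator_def)
  also have "\<dots> = (\<integral>\<^sup>+\<xi>. \<integral>\<^sup>+\<eta>. indicator N \<eta> \<partial>(lborel :: 'n heis measure) \<partial>(lborel :: 'n heis measure))"
    by (intro nn_integral_cong nn_integral_heis_left) measurable
  also have "\<dots> = 0" using null_setsD1[OF N(1)] by simp
  finally show ?thesis using N(2) by (intro AE_I[of _ _ ?D]) auto
qed

text \<open>The three coordinates contribute 3, and the twist of the group law, with base point in a
  bounded set, contributes \<open>4 * R\<close>. Through this bound Euclidean Lipschitz functions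
  have differences controlled by the homogeneous norm of the group difference.\<close>

lemma heis_dist_mult_le:
  fixes \<eta> \<zeta> :: "'n::finite heis"
  assumes "norm \<eta> \<le> R" "heis_norm \<zeta> \<le> 1"
  shows "dist (\<eta> \<cdot>\<^sub>H \<zeta>) \<eta> \<le> (3 + 4 * R) * heis_norm \<zeta>"
proof -
  obtain x y t where \<zeta>: "\<zeta> = (x, y, t)" by (cases \<zeta>)
  obtain x0 y0 t0 where \<eta>: "\<eta> = (x0, y0, t0)" by (cases \<eta>)
  define h where "h = heis_norm \<zeta>"
  have h: "0 \<le> h" "h \<le> 1" using assms by (auto simp: h_def)
  have c: "norm x \<le> h" "norm y \<le> h" "\<bar>t\<bar> \<le> h\<^sup>2" using heis_norm_components[of x y t h] by (auto simp: h_def \<zeta>)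
  have "h\<^sup>2 \<le> h" using h by (simp add: power2_eq_square mult_left_le)
  then have t: "\<bar>t\<bar> \<le> h" using c by linarith
  have 0: "norm x0 \<le> R" "norm y0 \<le> R"
    using assms(1) norm_fst_le[of x0 "(y0, t0)"] norm_snd_le[of "(y0, t0)" x0] norm_fst_le[of y0 t0] by (auto simp: \<eta>)
  have "\<bar>x \<bullet> y0\<bar> \<le> norm x * norm y0" by (rule Cauchy_Schwarz_ineq2)
  also have "\<dots> \<le> h * R" using c 0 h by (intro mult_mono) auto
  finally have 1: "\<bar>x \<bullet> y0\<bar> \<le> h * R" .
  have "\<bar>x0 \<bullet> y\<bar> \<le> norm x0 * norm y" by (rule Cauchy_Schwarz_ineq2)
  also have "\<dots> \<le> R * h" using c 0 h by (intro mult_mono) (auto intro: order_trans[OF norm_ge_zero])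
  finally have 2: "\<bar>x0 \<bullet> y\<bar> \<le> h * R" by (simp add: mult.commute)
  have "dist (\<eta> \<cdot>\<^sub>H \<zeta>) \<eta> = norm (x, y, t + 2 * (x \<bullet> y0 - x0 \<bullet> y))"
    by (simp add: dist_norm \<zeta> \<eta> algebra_simps)
  also have "\<dots> \<le> norm x + (norm y + \<bar>t + 2 * (x \<bullet> y0 - x0 \<bullet> y)\<bar>)"
    using norm_Pair_le[of x "(y, t + 2 * (x \<bullet> y0 - x0 \<bullet> y))"] norm_Pair_le[of y "t + 2 * (x \<bullet> y0 - x0 \<bullet> y)"] by simp
  also have "\<dots> \<le> h + (h + (h + 2 * (h * R + h * R)))"
  proof -
    have "\<bar>t + 2 * (x \<bullet> y0 - x0 \<bullet> y)\<bar> \<le> h + 2 * (h * R + h * R)"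
      using t 1 2 unfolding abs_le_iff by (simp add: algebra_simps)
    then show ?thesis by (intro add_mono c)
  qed
  also have "\<dots> = (3 + 4 * R) * h" by (simp add: algebra_simps)
  finally show ?thesis by (simp add: h_def)
qed

locale heis_kernel =
  fixes s :: real and K :: "'n::finite heis \<Rightarrow> real" and \<Omega> :: "'n heis set"
  assumes s: "0 < s" "s < 1" and K: "admissible_kernel s K"
    and \<Omega>: "open \<Omega>" "bounded \<Omega>" "\<Omega> \<noteq> {}"
begin

definition Q where "Q = hom_dim TYPE('n)"
definition p where "p = 2 * Q / (Q - 2 * s)"
text \<open>The value of \<open>K\<close> at the identity is arbitrary and may be negative;
  replacing it by 0 gives a kernel that is nonnegative everywhere and can serve as a
  density.\<close>

definition k0 where "k0 \<zeta> = (if \<zeta> = 0 then 0 else K \<zeta>)"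
definition kk where "kk z = k0 (heis_inv (snd z) \<cdot>\<^sub>H fst z)"

text \<open>The measure for which the squared norm of \<open>Z\<^sub>0\<close> is the integral of the squared differences.\<close>

definition \<nu> :: "('n heis \<times> 'n heis) measure" where
  "\<nu> = density lebesgue (\<lambda>z. ennreal (indicator (S_set \<Omega>) z * kk z))"

lemma \<Omega>_borel [measurable]: "\<Omega> \<in> sets borel"
  using \<Omega> by auto

lemma \<Omega>_finite: "emeasure lborel \<Omega> < \<infinity>"
  by (rule emeasure_bounded_finite[OF \<Omega>(2)])

lemma S_set_eq: "S_set \<Omega> = {z. fst z \<in> \<Omega> \<or> snd z \<in> \<Omega>}"
  by (auto simp: S_set_def)

lemma S_set_open: "open (S_set \<Omega>)"
proof -
  have "S_set \<Omega> = \<Omega> \<times> UNIV \<union> UNIV \<times> \<Omega>" by (auto simp: S_set_def)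
  then show ?thesis using \<Omega>(1) by (simp add: open_Times open_Un)
qed

lemma S_set_borel [measurable]: "S_set \<Omega> \<in> sets borel"
  using S_set_open by auto

lemma k0_nonneg: "0 \<le> k0 \<zeta>"
proof (cases "\<zeta> = 0")
  case False
  then have "0 < K \<zeta>" using K unfolding admissible_kernel_def by blast
  then show ?thesis using False by (simp add: k0_def)
qed (simp add: k0_def)

lemma k0_inv: "k0 (heis_inv \<zeta>) = k0 \<zeta>"
proof (cases "\<zeta> = 0")
  case True
  then show ?thesis by (simp add: k0_def heis_inv_eq)
next
  case False
  then have "K \<zeta> = K (heis_inv \<zeta>)" using K unfolding admissible_kernel_def by blast
  then show ?thesis using False by (simp add: k0_def heis_inv_eq)
qed

lemma kk_nonneg: "0 \<le> kk z"
  by (simp add: kk_def k0_nonneg)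

lemma k0_measurable: "k0 \<in> borel_measurable lebesgue"
proof -
  have "K \<in> borel_measurable (lebesgue_on (- {0}))" using K by (simp add: admissible_kernel_def)
  then have "(\<lambda>x. if x \<in> - {0} then K x else 0) \<in> borel_measurable lebesgue"
    by (rule borel_measurable_if_I) auto
  moreover have "(\<lambda>x. if x \<in> - {0} then K x else 0) = k0" by (auto simp: k0_def fun_eq_iff)
  ultimately show ?thesis by simp
qed

text \<open>A Lebesgue measurable function composed with a continuous map need not be measurable.
  Here a Borel representative works, because null sets pull back to null sets under the group
  difference.\<close>

lemma kk_measurable [measurable]: "kk \<in> borel_measurable lebesgue"
proof -
  obtain k' where k': "k' \<in> borel_measurable borel" "AE \<zeta> in lborel. k0 \<zeta> = k' \<zeta>"
    using k0_measurable by (rule lebesgue_measurable_obtain_borel)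
  have "(\<lambda>z. k' (heis_inv (snd z) \<cdot>\<^sub>H fst z)) \<in> borel_measurable borel"
    by (rule measurable_compose[OF _ k'(1)]) (intro borel_measurable_continuous_onI continuous_intros)
  moreover have "AE z in lborel. kk z = k' (heis_inv (snd z) \<cdot>\<^sub>H fst z)"
    unfolding kk_def by (rule AE_heis_diff[OF k'(2)])
  ultimately show ?thesis by (rule lebesgue_measurable_AE_eq)
qed

lemma S_set_lebesgue [measurable]: "S_set \<Omega> \<in> sets lebesgue"
  using S_set_borel by simp

lemma coordinate_measurable:
  fixes u :: "'n heis \<Rightarrow> real"
  assumes "u \<in> borel_measurable lebesgue"
  shows "(\<lambda>z. u (fst z)) \<in> borel_measurable (lebesgue :: ('n heis \<times> 'n heis) measure)"
    and "(\<lambda>z. u (snd z)) \<in> borel_measurable (lebesgue :: ('n heis \<times> 'n heis) measure)"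
proof -
  obtain u' where u': "u' \<in> borel_measurable borel" "AE x in lborel. u x = u' x"
    using assms by (rule lebesgue_measurable_obtain_borel)
  have 1: "(\<lambda>z. u' (fst z)) \<in> borel_measurable (borel :: ('n heis \<times> 'n heis) measure)"
    by (rule measurable_compose[OF _ u'(1)]) (intro borel_measurable_continuous_onI continuous_intros)
  have 2: "(\<lambda>z. u' (snd z)) \<in> borel_measurable (borel :: ('n heis \<times> 'n heis) measure)"
    by (rule measurable_compose[OF _ u'(1)]) (intro borel_measurable_continuous_onI continuous_intros)
  show "(\<lambda>z. u (fst z)) \<in> borel_measurable (lebesgue :: ('n heis \<times> 'n heis) measure)"
    by (rule lebesgue_measurable_AE_eq[OF 1 AE_lborel_fst[OF u'(2)]])
  show "(\<lambda>z. u (snd z)) \<in> borel_measurable (lebesgue :: ('n heis \<times> 'n heis) measure)"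
    by (rule lebesgue_measurable_AE_eq[OF 2 AE_lborel_snd[OF u'(2)]])
qed

lemma measurable_\<nu>: "borel_measurable \<nu> = (borel_measurable lebesgue :: ('n heis \<times> 'n heis \<Rightarrow> 'b::topological_space) set)"
  by (rule measurable_cong_sets) (simp_all add: \<nu>_def)

lemma AE_\<nu>: "AE z in lborel. P z \<Longrightarrow> AE z in \<nu>. P z"
proof -
  assume "AE z in lborel. P z"
  then have "AE z in lebesgue. P z" by (simp add: lebesgue_AE_iff)
  then have "AE z in lebesgue. 0 < ennreal (indicator (S_set \<Omega>) z * kk z) \<longrightarrow> P z" by eventually_elim simp
  then show ?thesis unfolding \<nu>_def by (subst AE_density) auto
qed

lemma integrable_\<nu>:
  fixes g :: "'n heis \<times> 'n heis \<Rightarrow> real"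
  assumes "g \<in> borel_measurable lebesgue"
  shows "integrable \<nu> g \<longleftrightarrow> integrable lebesgue (\<lambda>z. indicator (S_set \<Omega>) z * kk z * g z)"
  unfolding \<nu>_def using assms by (subst integrable_density) (auto simp: kk_nonneg)

lemma integral_\<nu>:
  fixes g :: "'n heis \<times> 'n heis \<Rightarrow> real"
  assumes "g \<in> borel_measurable lebesgue"
  shows "integral\<^sup>L \<nu> g = (\<integral>z. indicator (S_set \<Omega>) z * kk z * g z \<partial>lebesgue)"
  unfolding \<nu>_def using assms by (subst integral_density) (auto simp: kk_nonneg)

text \<open>Off the diagonal \<open>kk\<close> is the kernel; on it the difference factor vanishes, whatever \<open>K 0\<close> is.\<close>

lemma kk_diff: "kk (\<xi>, \<eta>) * (u \<xi> - u \<eta>) = K (heis_inv \<eta> \<cdot>\<^sub>H \<xi>) * (u \<xi> - (u \<eta> :: real))"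
proof (cases "\<xi> = \<eta>")
  case False
  then have "heis_inv \<eta> \<cdot>\<^sub>H \<xi> \<noteq> 0" by (simp add: heis_diff_eq_zero_iff)
  then show ?thesis by (simp add: kk_def k0_def)
qed simp

lemma kernel_lower_bound: "\<exists>\<mu>>0. \<forall>\<zeta>. \<mu> * heis_weight s \<zeta> \<le> k0 \<zeta>"
proof -
  obtain \<mu> where \<mu>: "\<mu> > 0" "\<And>\<zeta>. \<zeta> \<noteq> 0 \<Longrightarrow> \<mu> * heis_weight s \<zeta> \<le> K \<zeta>"
    using K unfolding admissible_kernel_def heis_weight_def by blast
  have "\<mu> * heis_weight s \<zeta> \<le> k0 \<zeta>" for \<zeta>
  proof (cases "\<zeta> = 0")
    case True
    then have "heis_weight s \<zeta> = 0" unfolding heis_weight_def powr_eq_0_iff heis_norm_eq_zero_iff .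
    then show ?thesis using True by (simp add: k0_def)
  next
    case False
    then show ?thesis using \<mu>(2) by (simp add: k0_def)
  qed
  then show ?thesis using \<mu>(1) by blast
qed

lemma form_nonneg: "0 \<le> form \<nu> u u"
  unfolding form_def by (intro Bochner_Integration.integral_nonneg) simp

text \<open>A null set modification makes \<open>u\<close> Borel and zero at every point off
  \<Omega>. The energy is integrated only over first points in \<Omega>; such pairs lie in
  \<open>S_set \<Omega>\<close>, where the kernel bound compares the weight with
  \<open>kk\<close>.\<close>

lemma borel_representative:
  assumes u: "u \<in> form_space lebesgue \<Omega> \<nu>"
    and \<mu>: "\<mu> > 0" "\<And>\<zeta>. \<mu> * heis_weight s \<zeta> \<le> k0 \<zeta>"
  shows "\<exists>u'. u' \<in> borel_measurable borel \<and> (\<forall>\<xi>. \<xi> \<notin> \<Omega> \<longrightarrow> u' \<xi> = 0) \<and> (AE x in lborel. u x = u' x) \<and>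
    (\<integral>\<^sup>+\<xi>. local_energy s u' \<xi> * indicator \<Omega> \<xi> \<partial>lborel) \<le> ennreal (form \<nu> u u / \<mu>)"
proof -
  have um: "u \<in> borel_measurable lebesgue" and uout: "AE x in lborel. x \<notin> \<Omega> \<longrightarrow> u x = 0"
    and ui: "integrable \<nu> (\<lambda>z. (u (fst z) - u (snd z))\<^sup>2)"
    using u by (auto simp: form_space_def lebesgue_AE_iff)
  obtain v where v: "v \<in> borel_measurable borel" "AE x in lborel. u x = v x"
    using um by (rule lebesgue_measurable_obtain_borel)
  define u' where "u' x = indicator \<Omega> x * v x" for x
  have u'm [measurable]: "u' \<in> borel_measurable borel" unfolding u'_def using v(1) by measurable
  have u'out: "u' \<xi> = 0" if "\<xi> \<notin> \<Omega>" for \<xi> using that by (simp add: u'_def)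
  have ae: "AE x in lborel. u x = u' x" using v(2) uout
  proof eventually_elim
    case (elim x)
    then show ?case by (cases "x \<in> \<Omega>") (simp_all add: u'_def)
  qed
  let ?g = "\<lambda>z. ennreal ((u' (fst z) - u' (snd z))\<^sup>2 * heis_weight s (heis_inv (snd z) \<cdot>\<^sub>H fst z))"
  have gm: "?g \<in> borel_measurable borel" by (rule energy_integrand_measurable[OF u'm])
  have fm: "(\<lambda>z. indicator \<Omega> (fst z) :: ennreal) \<in> borel_measurable (borel :: ('n heis \<times> 'n heis) measure)"
    by (rule measurable_compose[of fst _ borel]) (auto intro!: borel_measurable_continuous_onI continuous_intros)
  have "(\<integral>\<^sup>+\<xi>. local_energy s u' \<xi> * indicator \<Omega> \<xi> \<partial>lborel) = (\<integral>\<^sup>+\<xi>. \<integral>\<^sup>+\<eta>. ?g (\<xi>, \<eta>) * indicator \<Omega> \<xi> \<partial>lborel \<partial>lborel)"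
  proof (rule nn_integral_cong)
    fix \<xi>
    show "local_energy s u' \<xi> * indicator \<Omega> \<xi> = (\<integral>\<^sup>+\<eta>. ?g (\<xi>, \<eta>) * indicator \<Omega> \<xi> \<partial>lborel)"
      by (cases "\<xi> \<in> \<Omega>") (simp_all add: local_energy_def)
  qed
  also have "\<dots> = (\<integral>\<^sup>+z. ?g z * indicator \<Omega> (fst z) \<partial>lborel)"
    using nn_integral_lborel_fst[of "\<lambda>z. ?g z * indicator \<Omega> (fst z)"] borel_measurable_times_ennreal[OF gm fm] by simp
  also have "\<dots> = (\<integral>\<^sup>+z. ?g z * indicator \<Omega> (fst z) \<partial>lebesgue)" by (simp add: nn_integral_completion)
  also have "\<dots> \<le> (\<integral>\<^sup>+z. ennreal (1 / \<mu>) * ennreal (indicator (S_set \<Omega>) z * kk z * (u (fst z) - u (snd z))\<^sup>2) \<partial>lebesgue)"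
  proof (rule nn_integral_mono_AE)
    show "AE z in lebesgue. ?g z * indicator \<Omega> (fst z) \<le> ennreal (1 / \<mu>) * ennreal (indicator (S_set \<Omega>) z * kk z * (u (fst z) - u (snd z))\<^sup>2)"
      unfolding lebesgue_AE_iff using AE_lborel_fst[OF ae] AE_lborel_snd[OF ae]
    proof eventually_elim
      case (elim z)
      show ?case
      proof (cases "fst z \<in> \<Omega>")
        case True
        then have S: "z \<in> S_set \<Omega>" by (simp add: S_set_eq)
        have "heis_weight s (heis_inv (snd z) \<cdot>\<^sub>H fst z) \<le> 1 / \<mu> * kk z"
          using \<mu>(2)[of "heis_inv (snd z) \<cdot>\<^sub>H fst z"] \<mu>(1) by (simp add: kk_def field_simps)
        then have "(u (fst z) - u (snd z))\<^sup>2 * heis_weight s (heis_inv (snd z) \<cdot>\<^sub>H fst z) \<le> (u (fst z) - u (snd z))\<^sup>2 * (1 / \<mu> * kk z)"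
          by (rule mult_left_mono) simp
        then show ?thesis using elim True S \<mu>(1) kk_nonneg[of z]
          by (simp add: ennreal_mult[symmetric] ennreal_leI mult_ac)
      qed simp
    qed
  qed
  also have "\<dots> = ennreal (1 / \<mu>) * (\<integral>\<^sup>+z. ennreal (indicator (S_set \<Omega>) z * kk z * (u (fst z) - u (snd z))\<^sup>2) \<partial>lebesgue)"
    using coordinate_measurable[OF um] by (intro nn_integral_cmult) measurable
  also have "(\<integral>\<^sup>+z. ennreal (indicator (S_set \<Omega>) z * kk z * (u (fst z) - u (snd z))\<^sup>2) \<partial>lebesgue) = ennreal (form \<nu> u u)"
  proof -
    have m: "(\<lambda>z. (u (fst z) - u (snd z))\<^sup>2) \<in> borel_measurable lebesgue"
      using coordinate_measurable[OF um] by measurable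
    show ?thesis unfolding form_def power2_eq_square[symmetric] integral_\<nu>[OF m]
      using ui unfolding integrable_\<nu>[OF m] by (intro nn_integral_eq_integral) (simp_all add: kk_nonneg)
  qed
  also have "ennreal (1 / \<mu>) * ennreal (form \<nu> u u) = ennreal (form \<nu> u u / \<mu>)"
    using \<mu>(1) form_nonneg[of u] by (simp add: ennreal_mult[symmetric])
  finally show ?thesis using u'm u'out ae by blast
qed

lemma p_eq: "p = 2 * Q / (Q - 2 * s)" and Q_eq: "Q = hom_dim TYPE('n)"
  by (simp_all add: p_def Q_def)

lemma form_space_cong:
  assumes "G \<subseteq> \<Omega>" "AE x in lebesgue. x \<in> \<Omega> \<longrightarrow> x \<in> G"
  shows "form_space lebesgue G \<nu> = form_space lebesgue \<Omega> \<nu>"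
proof -
  have "(AE x in lebesgue. x \<notin> G \<longrightarrow> u x = 0) \<longleftrightarrow> (AE x in lebesgue. x \<notin> \<Omega> \<longrightarrow> u x = 0)" for u :: "'n heis \<Rightarrow> real"
  proof
    assume "AE x in lebesgue. x \<notin> G \<longrightarrow> u x = 0"
    then show "AE x in lebesgue. x \<notin> \<Omega> \<longrightarrow> u x = 0" by eventually_elim (use assms(1) in blast)
  next
    assume "AE x in lebesgue. x \<notin> \<Omega> \<longrightarrow> u x = 0"
    then show "AE x in lebesgue. x \<notin> G \<longrightarrow> u x = 0" using assms(2) by eventually_elim blast
  qed
  then show ?thesis by (simp add: form_space_def)
qed

text \<open>Subsets \<open>G\<close> of full measure are allowed because the conditions on the
  nonlinearity can be made to hold pointwise only there; the constant is chosen before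
  \<open>G\<close>.\<close>

lemma dirichlet_form_kernel:
  "\<exists>CS. \<forall>G. G \<in> sets lebesgue \<longrightarrow> G \<subseteq> \<Omega> \<longrightarrow> (AE x in lebesgue. x \<in> \<Omega> \<longrightarrow> x \<in> G) \<longrightarrow>
    dirichlet_form lebesgue G \<nu> p CS"
proof -
  obtain \<mu> where \<mu>: "\<mu> > 0" "\<And>\<zeta>. \<mu> * heis_weight s \<zeta> \<le> k0 \<zeta>" using kernel_lower_bound by blast
  have p2: "p > 2" by (rule sobolev_exponent(1)[OF s Q_eq p_eq])
  obtain C where C: "C > 0" "\<And>(u :: 'n heis \<Rightarrow> real) \<Omega> e. u \<in> borel_measurable borel \<Longrightarrow> \<Omega> \<in> sets borel \<Longrightarrow>
     emeasure lborel \<Omega> < \<infinity> \<Longrightarrow> (\<forall>\<xi>. \<xi> \<notin> \<Omega> \<longrightarrow> u \<xi> = 0) \<Longrightarrow> 0 \<le> e \<Longrightarrow>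
     (\<integral>\<^sup>+\<xi>. local_energy s u \<xi> * indicator \<Omega> \<xi> \<partial>lborel) \<le> ennreal e \<Longrightarrow>
     (\<integral>\<^sup>+\<xi>. ennreal (\<bar>u \<xi>\<bar> powr p) \<partial>lborel) \<le> ennreal (C * e powr (p / 2))"
    using sobolev_borel[OF s Q_eq p_eq] by blast
  define CS where "CS = C * (1 / \<mu>) powr (p / 2)"
  have CS: "CS > 0" using C \<mu> by (simp add: CS_def)
  have sob: "(\<integral>\<^sup>+x. ennreal (\<bar>u x\<bar> powr p) \<partial>lebesgue) \<le> ennreal (CS * sqrt (form \<nu> u u) powr p)"
    if u: "u \<in> form_space lebesgue \<Omega> \<nu>" for u
  proof -
    obtain u' where u': "u' \<in> borel_measurable borel" "\<forall>\<xi>. \<xi> \<notin> \<Omega> \<longrightarrow> u' \<xi> = 0" "AE x in lborel. u x = u' x"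
      "(\<integral>\<^sup>+\<xi>. local_energy s u' \<xi> * indicator \<Omega> \<xi> \<partial>lborel) \<le> ennreal (form \<nu> u u / \<mu>)"
      using borel_representative[OF u \<mu>] by blast
    have "(\<integral>\<^sup>+x. ennreal (\<bar>u x\<bar> powr p) \<partial>lebesgue) = (\<integral>\<^sup>+x. ennreal (\<bar>u' x\<bar> powr p) \<partial>lborel)"
      unfolding nn_integral_completion
    proof (rule nn_integral_cong_AE)
      show "AE x in lborel. ennreal (\<bar>u x\<bar> powr p) = ennreal (\<bar>u' x\<bar> powr p)"
        using u'(3) by eventually_elim simp
    qed
    also have "\<dots> \<le> ennreal (C * (form \<nu> u u / \<mu>) powr (p / 2))"
      using u' \<Omega>_finite form_nonneg[of u] \<mu>(1) by (intro C(2)[of u' \<Omega>]) auto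
    also have "(form \<nu> u u / \<mu>) powr (p / 2) = (1 / \<mu>) powr (p / 2) * sqrt (form \<nu> u u) powr p"
    proof -
      have "(form \<nu> u u / \<mu>) powr (p / 2) = (1 / \<mu> * form \<nu> u u) powr (p / 2)" by simp
      also have "\<dots> = (1 / \<mu>) powr (p / 2) * form \<nu> u u powr (p / 2)" by (rule powr_mult)
      also have "form \<nu> u u powr (p / 2) = sqrt (form \<nu> u u) powr p"
        using form_nonneg[of u] by (simp add: powr_half_sqrt[symmetric] powr_powr)
      finally show ?thesis .
    qed
    finally show ?thesis by (simp add: CS_def mult.assoc)
  qed
  have main: "dirichlet_form lebesgue G \<nu> p CS"
    if G: "G \<in> sets lebesgue" "G \<subseteq> \<Omega>" "AE x in lebesgue. x \<in> \<Omega> \<longrightarrow> x \<in> G" for G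
  proof
    note V_eq = form_space_cong[OF G(2,3)]
    show "G \<in> sets lebesgue" by (rule G)
    have "emeasure lebesgue G \<le> emeasure lebesgue \<Omega>" using G by (intro emeasure_mono) auto
    also have "\<dots> < \<infinity>" using \<Omega>_finite by (simp add: emeasure_completion)
    finally show "emeasure lebesgue G < \<infinity>" .
    show "p > 2" by (rule p2)
    show "CS > 0" by (rule CS)
    fix u :: "'n heis \<Rightarrow> real"
    {
      assume um: "u \<in> borel_measurable lebesgue"
      show "(\<lambda>z. u (fst z)) \<in> borel_measurable \<nu>" "(\<lambda>z. u (snd z)) \<in> borel_measurable \<nu>"
        unfolding measurable_\<nu> by (rule coordinate_measurable[OF um])+
    }
    {
      fix P :: "'n heis \<Rightarrow> bool"
      assume "AE x in lebesgue. P x"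
      then have "AE x in lborel. P x" by (simp add: lebesgue_AE_iff)
      then show "AE z in \<nu>. P (fst z)" "AE z in \<nu>. P (snd z)"
        by (rule AE_\<nu>[OF AE_lborel_fst[of P]], rule AE_\<nu>[OF AE_lborel_snd[of P]])
    }
    {
      assume "u \<in> form_space lebesgue G \<nu>"
      then have u: "u \<in> form_space lebesgue \<Omega> \<nu>" by (simp add: V_eq)
      then have [measurable]: "u \<in> borel_measurable lebesgue" by (simp add: form_space_def)
      show "integrable lebesgue (\<lambda>x. \<bar>u x\<bar> powr p)"
      proof (rule integrableI_nonneg)
        show "(\<integral>\<^sup>+x. ennreal (\<bar>u x\<bar> powr p) \<partial>lebesgue) < \<infinity>"
          using le_less_trans[OF sob[OF u] ennreal_less_top] by simp
      qed auto
      show "(\<integral>x. \<bar>u x\<bar> powr p \<partial>lebesgue) \<le> CS * sqrt (form \<nu> u u) powr p"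
        using enn2real_leI[OF _ sob[OF u]] CS by (subst integral_eq_nn_integral) auto
    }
    {
      fix x :: "nat \<Rightarrow> 'n heis \<Rightarrow> real" and b
      assume x: "\<And>n. x n \<in> form_space lebesgue G \<nu>" and b: "\<And>n. sqrt (form \<nu> (x n) (x n)) \<le> b"
      have "\<forall>n. \<exists>u'. u' \<in> borel_measurable borel \<and> (\<forall>\<xi>. \<xi> \<notin> \<Omega> \<longrightarrow> u' \<xi> = 0) \<and> (AE y in lborel. x n y = u' y) \<and>
        (\<integral>\<^sup>+\<xi>. local_energy s u' \<xi> * indicator \<Omega> \<xi> \<partial>lborel) \<le> ennreal (form \<nu> (x n) (x n) / \<mu>)"
        using x unfolding V_eq by (intro allI borel_representative[OF _ \<mu>])
      from choice[OF this] obtain x' where x': "\<And>n. x' n \<in> borel_measurable borel" "\<And>n \<xi>. \<xi> \<notin> \<Omega> \<Longrightarrow> x' n \<xi> = 0"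
        "\<And>n. AE y in lborel. x n y = x' n y"
        "\<And>n. (\<integral>\<^sup>+\<xi>. local_energy s (x' n) \<xi> * indicator \<Omega> \<xi> \<partial>lborel) \<le> ennreal (form \<nu> (x n) (x n) / \<mu>)"
        by blast
      have "form \<nu> (x n) (x n) \<le> b\<^sup>2" for n
        using power_mono[OF b[of n], of 2] form_nonneg[of "x n"] by simp
      then have en: "(\<integral>\<^sup>+\<xi>. local_energy s (x' n) \<xi> * indicator \<Omega> \<xi> \<partial>lborel) \<le> ennreal (b\<^sup>2 / \<mu>)" for n
        using \<mu>(1) by (intro order_trans[OF x'(4)] ennreal_leI divide_right_mono) auto
      have "\<exists>(r::nat \<Rightarrow> nat) l. strict_mono r \<and> l \<in> borel_measurable borel \<and>
        (AE y in lborel. (\<lambda>n. x' (r n) y) \<longlonglongrightarrow> l y)"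
        by (rule heis_compact_borel[OF s Q_eq p_eq \<Omega>(1,2) x'(1,2) _ en]) (use \<mu>(1) in auto)
      then obtain r l where r: "strict_mono (r :: nat \<Rightarrow> nat)" "l \<in> borel_measurable borel"
        "AE y in lborel. (\<lambda>n. x' (r n) y) \<longlonglongrightarrow> l y" by blast
      have "AE y in lborel. \<forall>n. x n y = x' n y" unfolding AE_all_countable using x'(3) by blast
      then have "AE y in lebesgue. (\<lambda>n. x (r n) y) \<longlonglongrightarrow> l y"
        unfolding lebesgue_AE_iff using r(3) by eventually_elim simp
      moreover have "l \<in> borel_measurable lebesgue" using r(2) by (simp add: measurable_completion)
      ultimately show "\<exists>(r::nat \<Rightarrow> nat) l. strict_mono r \<and> l \<in> borel_measurable lebesgue \<and>
          (AE y in lebesgue. (\<lambda>n. x (r n) y) \<longlonglongrightarrow> l y)"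
        using r(1) by blast
    }
  qed
  then show ?thesis by blast
qed

section \<open>Identification with the spaces of the problem\<close>

lemma difference_measurable:
  fixes u :: "'n heis \<Rightarrow> real"
  assumes "u \<in> borel_measurable lebesgue"
  shows "(\<lambda>z. u (fst z) - u (snd z)) \<in> borel_measurable lebesgue"
  using coordinate_measurable[OF assms] by measurable

lemma form_integrand_eq:
  "indicator (S_set \<Omega>) z * kk z * ((u (fst z) - u (snd z)) * (v (fst z) - v (snd z))) =
   indicator (S_set \<Omega>) z *\<^sub>R (case z of (\<xi>, \<eta>) \<Rightarrow> (u \<xi> - u \<eta>) * (v \<xi> - v \<eta>) * K (heis_inv \<eta> \<cdot>\<^sub>H \<xi>))"
proof -
  obtain \<xi> \<eta> where z: "z = (\<xi>, \<eta>)" by (cases z)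
  have "kk (\<xi>, \<eta>) * ((u \<xi> - u \<eta>) * (v \<xi> - v \<eta>)) = (kk (\<xi>, \<eta>) * (u \<xi> - u \<eta>)) * (v \<xi> - v \<eta>)" by simp
  also have "\<dots> = (u \<xi> - u \<eta>) * (v \<xi> - v \<eta>) * K (heis_inv \<eta> \<cdot>\<^sub>H \<xi>)" unfolding kk_diff by simp
  finally show ?thesis by (simp add: z mult.assoc)
qed

lemma form_eq:
  assumes "u \<in> borel_measurable lebesgue" "v \<in> borel_measurable lebesgue"
  shows "integrable \<nu> (\<lambda>z. (u (fst z) - u (snd z)) * (v (fst z) - v (snd z))) \<longleftrightarrow>
      set_integrable lebesgue (S_set \<Omega>) (\<lambda>(\<xi>, \<eta>). (u \<xi> - u \<eta>) * (v \<xi> - v \<eta>) * K (heis_inv \<eta> \<cdot>\<^sub>H \<xi>))"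
    and "form \<nu> u v =
      set_lebesgue_integral lebesgue (S_set \<Omega>) (\<lambda>(\<xi>, \<eta>). (u \<xi> - u \<eta>) * (v \<xi> - v \<eta>) * K (heis_inv \<eta> \<cdot>\<^sub>H \<xi>))"
proof -
  have m: "(\<lambda>z. (u (fst z) - u (snd z)) * (v (fst z) - v (snd z))) \<in> borel_measurable lebesgue"
    by (intro borel_measurable_times difference_measurable assms)
  show "integrable \<nu> (\<lambda>z. (u (fst z) - u (snd z)) * (v (fst z) - v (snd z))) \<longleftrightarrow>
      set_integrable lebesgue (S_set \<Omega>) (\<lambda>(\<xi>, \<eta>). (u \<xi> - u \<eta>) * (v \<xi> - v \<eta>) * K (heis_inv \<eta> \<cdot>\<^sub>H \<xi>))"
    unfolding integrable_\<nu>[OF m] set_integrable_def form_integrand_eq ..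
  show "form \<nu> u v =
      set_lebesgue_integral lebesgue (S_set \<Omega>) (\<lambda>(\<xi>, \<eta>). (u \<xi> - u \<eta>) * (v \<xi> - v \<eta>) * K (heis_inv \<eta> \<cdot>\<^sub>H \<xi>))"
    unfolding form_def integral_\<nu>[OF m] set_lebesgue_integral_def form_integrand_eq ..
qed

lemma Z0_norm_eq:
  assumes "u \<in> borel_measurable lebesgue"
  shows "Z0_norm K \<Omega> u = sqrt (form \<nu> u u)"
proof -
  have "(\<lambda>(\<xi>, \<eta>). \<bar>u \<xi> - u \<eta>\<bar>\<^sup>2 * K (heis_inv \<eta> \<cdot>\<^sub>H \<xi>)) = (\<lambda>(\<xi>, \<eta>). (u \<xi> - u \<eta>) * (u \<xi> - u \<eta>) * K (heis_inv \<eta> \<cdot>\<^sub>H \<xi>))"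
    by (simp add: power2_eq_square flip: abs_mult)
  then show ?thesis unfolding Z0_norm_def form_eq(2)[OF assms assms] by simp
qed

lemma Z_integrand_eq:
  "(case z of (\<xi>, \<eta>) \<Rightarrow> (u \<xi> - u \<eta>) * sqrt (K (heis_inv \<eta> \<cdot>\<^sub>H \<xi>))) = (u (fst z) - u (snd z)) * sqrt (kk z)"
proof -
  obtain \<xi> \<eta> where z: "z = (\<xi>, \<eta>)" by (cases z)
  show ?thesis
  proof (cases "\<xi> = \<eta>")
    case False
    then have "heis_inv \<eta> \<cdot>\<^sub>H \<xi> \<noteq> 0" by (simp add: heis_diff_eq_zero_iff)
    then show ?thesis by (simp add: z kk_def k0_def)
  qed (simp add: z)
qed

text \<open>Integrating against \<nu> encodes the condition on \<open>S_set \<Omega>\<close>; square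
  integrability on \<Omega> is supplied by the Sobolev inequality.\<close>

lemma Z0_space_eq: "Z0_space K \<Omega> = form_space lebesgue \<Omega> \<nu>"
proof -
  have S: "in_L2_on (S_set \<Omega>) (\<lambda>(\<xi>, \<eta>). (u \<xi> - u \<eta>) * sqrt (K (heis_inv \<eta> \<cdot>\<^sub>H \<xi>))) \<longleftrightarrow>
      integrable \<nu> (\<lambda>z. (u (fst z) - u (snd z))\<^sup>2)" if um: "u \<in> borel_measurable lebesgue" for u
  proof -
    note [measurable] = difference_measurable[OF um]
    have "set_borel_measurable lebesgue (S_set \<Omega>) (\<lambda>(\<xi>, \<eta>). (u \<xi> - u \<eta>) * sqrt (K (heis_inv \<eta> \<cdot>\<^sub>H \<xi>)))"
      unfolding set_borel_measurable_def Z_integrand_eq by measurable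
    moreover have "set_integrable lebesgue (S_set \<Omega>) (\<lambda>z. (case z of (\<xi>, \<eta>) \<Rightarrow> (u \<xi> - u \<eta>) * sqrt (K (heis_inv \<eta> \<cdot>\<^sub>H \<xi>)))\<^sup>2)
        \<longleftrightarrow> integrable \<nu> (\<lambda>z. (u (fst z) - u (snd z))\<^sup>2)"
    proof -
      have m: "(\<lambda>z. (u (fst z) - u (snd z))\<^sup>2) \<in> borel_measurable lebesgue" by measurable
      have "(\<lambda>z. indicator (S_set \<Omega>) z *\<^sub>R (case z of (\<xi>, \<eta>) \<Rightarrow> (u \<xi> - u \<eta>) * sqrt (K (heis_inv \<eta> \<cdot>\<^sub>H \<xi>)))\<^sup>2)
          = (\<lambda>z. indicator (S_set \<Omega>) z * kk z * (u (fst z) - u (snd z))\<^sup>2)"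
        unfolding Z_integrand_eq by (simp add: power_mult_distrib kk_nonneg mult_ac fun_eq_iff)
      then show ?thesis unfolding integrable_\<nu>[OF m] set_integrable_def by simp
    qed
    ultimately show ?thesis by (simp add: in_L2_on_def)
  qed
  obtain CS where CS: "\<And>G. G \<in> sets lebesgue \<Longrightarrow> G \<subseteq> \<Omega> \<Longrightarrow> (AE x in lebesgue. x \<in> \<Omega> \<longrightarrow> x \<in> G) \<Longrightarrow>
      dirichlet_form lebesgue G \<nu> p CS"
    using dirichlet_form_kernel by blast
  have "dirichlet_form lebesgue \<Omega> \<nu> p CS" by (rule CS) auto
  then interpret dirichlet_form lebesgue \<Omega> \<nu> p CS .
  have L2: "in_L2_on \<Omega> u" if u: "u \<in> form_space lebesgue \<Omega> \<nu>" for u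
  proof -
    have [measurable]: "u \<in> borel_measurable lebesgue" using u by (rule V_measurable)
    have "integrable lebesgue (\<lambda>x. indicator \<Omega> x *\<^sub>R (u x)\<^sup>2)"
      using square_integral_le(1)[OF u] by (intro integrable_mult_indicator) auto
    then show ?thesis by (simp add: in_L2_on_def set_borel_measurable_def set_integrable_def)
  qed
  show ?thesis
  proof (intro subset_antisym subsetI)
    fix u assume "u \<in> Z0_space K \<Omega>"
    then show "u \<in> form_space lebesgue \<Omega> \<nu>"
      unfolding Z0_space_def Z_space_def form_space_def using S[of u] by simp
  next
    fix u assume u: "u \<in> form_space lebesgue \<Omega> \<nu>"
    then show "u \<in> Z0_space K \<Omega>"
      unfolding Z0_space_def Z_space_def using S[of u] L2[OF u] by (simp add: form_space_def)
  qed
qed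

text \<open>If one of the two points lies in \<Omega>, the squared difference is at most a constant
  times \<open>min 1 ((heis_norm \<zeta>)\<^sup>2)\<close> for their group difference \<zeta>.
  Integrability of this function times \<open>K\<close>, left invariance and the finite measure of
  \<Omega> then bound the energy.\<close>

lemma lipschitz_in_form_space:
  assumes lip: "\<And>\<xi> \<eta>. \<bar>\<phi> \<xi> - \<phi> \<eta>\<bar> \<le> dist \<xi> \<eta>" and bd: "\<And>\<xi>. 0 \<le> \<phi> \<xi>" "\<And>\<xi>. \<phi> \<xi> \<le> r"
    and out: "\<And>\<xi>. \<xi> \<notin> \<Omega> \<Longrightarrow> \<phi> \<xi> = (0 :: real)"
  shows "\<phi> \<in> form_space lebesgue \<Omega> \<nu>"
proof -
  obtain R where R: "R > 0" "\<And>\<xi>. \<xi> \<in> \<Omega> \<Longrightarrow> norm \<xi> \<le> R" using \<Omega>(2) by (auto simp: bounded_pos)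
  \<comment> \<open>The first summand is for close points, where \<phi> is Lipschitz; the second is
    for distant ones, where \<open>\<phi> \<le> r\<close> is used.\<close>
  define C where "C = (3 + 4 * R)\<^sup>2 + r\<^sup>2"
  have C: "C \<ge> 0" by (simp add: C_def)
  define th where "th \<zeta> = min 1 ((heis_norm \<zeta>)\<^sup>2)" for \<zeta> :: "'n heis"
  have th0: "0 \<le> th \<zeta>" for \<zeta> by (simp add: th_def)
  have th_borel [measurable]: "th \<in> borel_measurable borel" unfolding th_def by measurable
  have one: "(\<phi> \<xi> - \<phi> \<eta>)\<^sup>2 \<le> C * th (heis_inv \<eta> \<cdot>\<^sub>H \<xi>)" if \<eta>: "\<eta> \<in> \<Omega>" for \<xi> \<eta>
  proof -
    define \<zeta> where "\<zeta> = heis_inv \<eta> \<cdot>\<^sub>H \<xi>"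
    have \<xi>: "\<xi> = \<eta> \<cdot>\<^sub>H \<zeta>" by (simp add: \<zeta>_def)
    show ?thesis
    proof (cases "heis_norm \<zeta> \<le> 1")
      case True
      have "\<bar>\<phi> \<xi> - \<phi> \<eta>\<bar> \<le> (3 + 4 * R) * heis_norm \<zeta>"
        using lip[of \<xi> \<eta>] heis_dist_mult_le[OF R(2)[OF \<eta>] True] unfolding \<xi> by linarith
      then have "\<bar>\<phi> \<xi> - \<phi> \<eta>\<bar>\<^sup>2 \<le> ((3 + 4 * R) * heis_norm \<zeta>)\<^sup>2" by (intro power_mono) auto
      also have "\<dots> \<le> C * (heis_norm \<zeta>)\<^sup>2"
        unfolding power_mult_distrib by (intro mult_right_mono) (auto simp: C_def)
      also have "(heis_norm \<zeta>)\<^sup>2 = th \<zeta>"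
        using power_le_one[OF heis_norm_nonneg True, of 2] by (simp add: th_def)
      finally show ?thesis by (simp add: \<zeta>_def)
    next
      case False
      then have "1 \<le> (heis_norm \<zeta>)\<^sup>2" by (intro one_le_power) simp
      then have "th \<zeta> = 1" by (simp add: th_def)
      moreover have "\<bar>\<phi> \<xi> - \<phi> \<eta>\<bar> \<le> r" using bd(1)[of \<xi>] bd(1)[of \<eta>] bd(2)[of \<xi>] bd(2)[of \<eta>] by linarith
      then have "\<bar>\<phi> \<xi> - \<phi> \<eta>\<bar>\<^sup>2 \<le> r\<^sup>2" by (intro power_mono) auto
      ultimately show ?thesis by (simp add: \<zeta>_def C_def add_increasing)
    qed
  qed
  obtain k' where k': "k' \<in> borel_measurable borel" "AE \<zeta> in lborel. k0 \<zeta> = k' \<zeta>"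
    using k0_measurable by (rule lebesgue_measurable_obtain_borel)
  note [measurable] = k'(1)
  define T where "T \<zeta> = ennreal (th \<zeta> * k' \<zeta>)" for \<zeta>
  have Tm [measurable]: "T \<in> borel_measurable borel" unfolding T_def by measurable
  have Tfin: "(\<integral>\<^sup>+\<zeta>. T \<zeta> \<partial>lborel) < \<infinity>"
  proof -
    have I: "integrable lebesgue (\<lambda>\<zeta>. indicator (- {0}) \<zeta> *\<^sub>R (th \<zeta> * K \<zeta>))"
      using K unfolding admissible_kernel_def set_integrable_def th_def by blast
    have eq: "indicator (- {0}) \<zeta> *\<^sub>R (th \<zeta> * K \<zeta>) = th \<zeta> * k0 \<zeta>" for \<zeta>
      by (cases "\<zeta> = 0") (simp_all add: k0_def)
    have "integrable lebesgue (\<lambda>\<zeta>. th \<zeta> * k0 \<zeta>)" using I unfolding eq .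
    then have "(\<integral>\<^sup>+\<zeta>. ennreal (norm (th \<zeta> * k0 \<zeta>)) \<partial>lebesgue) < \<infinity>" unfolding integrable_iff_bounded by blast
    also have "(\<integral>\<^sup>+\<zeta>. ennreal (norm (th \<zeta> * k0 \<zeta>)) \<partial>lebesgue) = (\<integral>\<^sup>+\<zeta>. T \<zeta> \<partial>lborel)"
      unfolding nn_integral_completion
    proof (rule nn_integral_cong_AE)
      show "AE \<zeta> in lborel. ennreal (norm (th \<zeta> * k0 \<zeta>)) = T \<zeta>" using k'(2)
      proof eventually_elim
        case (elim \<zeta>)
        have "0 \<le> th \<zeta> * k0 \<zeta>" using th0 k0_nonneg by simp
        then show ?case using elim by (simp add: T_def)
      qed
    qed
    finally show ?thesis .
  qed
  have \<Omega>i: "(\<lambda>x. indicator \<Omega> x :: ennreal) \<in> borel_measurable borel" by measurable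
  have m1: "(\<lambda>z. indicator \<Omega> (snd z) * T (heis_inv (snd z) \<cdot>\<^sub>H fst z)) \<in> borel_measurable (borel :: ('n heis \<times> 'n heis) measure)"
    by (intro borel_measurable_times_ennreal measurable_compose[OF _ Tm] measurable_compose[OF _ \<Omega>i]
        borel_measurable_continuous_onI continuous_intros)
  have m2: "(\<lambda>z. indicator \<Omega> (fst z) * T (heis_inv (fst z) \<cdot>\<^sub>H snd z)) \<in> borel_measurable (borel :: ('n heis \<times> 'n heis) measure)"
    by (intro borel_measurable_times_ennreal measurable_compose[OF _ Tm] measurable_compose[OF _ \<Omega>i]
        borel_measurable_continuous_onI continuous_intros)
  have Tl: "(\<integral>\<^sup>+\<xi>. indicator \<Omega> \<eta> * T (heis_inv \<eta> \<cdot>\<^sub>H \<xi>) \<partial>lborel) = (\<integral>\<^sup>+\<zeta>. T \<zeta> \<partial>lborel) * indicator \<Omega> \<eta>" for \<eta>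
    using nn_integral_heis_left[OF Tm, of "heis_inv \<eta>"] by (cases "\<eta> \<in> \<Omega>") simp_all
  have i1: "(\<integral>\<^sup>+z. indicator \<Omega> (snd z) * T (heis_inv (snd z) \<cdot>\<^sub>H fst z) \<partial>lborel) = (\<integral>\<^sup>+\<zeta>. T \<zeta> \<partial>lborel) * emeasure lborel \<Omega>"
    unfolding nn_integral_lborel_snd[OF m1] fst_conv snd_conv Tl by (rule nn_integral_cmult_indicator) simp
  have i2: "(\<integral>\<^sup>+z. indicator \<Omega> (fst z) * T (heis_inv (fst z) \<cdot>\<^sub>H snd z) \<partial>lborel) = (\<integral>\<^sup>+\<zeta>. T \<zeta> \<partial>lborel) * emeasure lborel \<Omega>"
    unfolding nn_integral_lborel_fst[OF m2] fst_conv snd_conv Tl by (rule nn_integral_cmult_indicator) simp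
  have pm: "\<phi> \<in> borel_measurable borel"
  proof (intro borel_measurable_continuous_onI)
    show "continuous_on UNIV \<phi>" unfolding continuous_on_iff
    proof (intro ballI allI impI)
      fix \<xi> and e :: real assume "e > 0"
      then show "\<exists>d>0. \<forall>\<eta>\<in>UNIV. dist \<eta> \<xi> < d \<longrightarrow> dist (\<phi> \<eta>) (\<phi> \<xi>) < e"
        using le_less_trans[OF lip] by (intro exI[of _ e]) (simp add: dist_real_def)
    qed
  qed
  have pl: "\<phi> \<in> borel_measurable lebesgue" using pm by (simp add: measurable_completion)
  have dm: "(\<lambda>z. (\<phi> (fst z) - \<phi> (snd z))\<^sup>2) \<in> borel_measurable lebesgue"
    by (intro borel_measurable_power difference_measurable[OF pl])
  have "AE z in lborel. k0 (heis_inv (snd z) \<cdot>\<^sub>H fst z) = k' (heis_inv (snd z) \<cdot>\<^sub>H fst z)"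
    by (rule AE_heis_diff[OF k'(2)])
  moreover have "AE z in lborel. k0 (heis_inv (fst z) \<cdot>\<^sub>H snd z) = k' (heis_inv (fst z) \<cdot>\<^sub>H snd z)"
    by (rule AE_heis_diff_swap[OF k'(2)])
  ultimately have le: "AE z in lborel. ennreal (indicator (S_set \<Omega>) z * kk z * (\<phi> (fst z) - \<phi> (snd z))\<^sup>2) \<le>
    ennreal C * (indicator \<Omega> (snd z) * T (heis_inv (snd z) \<cdot>\<^sub>H fst z)) + ennreal C * (indicator \<Omega> (fst z) * T (heis_inv (fst z) \<cdot>\<^sub>H snd z))"
  proof eventually_elim
    case (elim z)
    obtain \<xi> \<eta> where z: "z = (\<xi>, \<eta>)" by (cases z)
    have A: "ennreal (kk z * (\<phi> \<xi> - \<phi> \<eta>)\<^sup>2) \<le> ennreal C * T (heis_inv \<eta> \<cdot>\<^sub>H \<xi>)" if "\<eta> \<in> \<Omega>"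
    proof -
      have "kk z * (\<phi> \<xi> - \<phi> \<eta>)\<^sup>2 \<le> kk z * (C * th (heis_inv \<eta> \<cdot>\<^sub>H \<xi>))"
        by (rule mult_left_mono[OF one[OF that] kk_nonneg])
      also have "\<dots> = C * (th (heis_inv \<eta> \<cdot>\<^sub>H \<xi>) * k' (heis_inv \<eta> \<cdot>\<^sub>H \<xi>))"
        using elim(1) by (simp add: z kk_def mult_ac)
      finally show ?thesis unfolding T_def using C by (simp add: ennreal_mult'[symmetric] ennreal_leI)
    qed
    \<comment> \<open>Here the roles of the two points are exchanged by the symmetry of the
      kernel.\<close>
    have B: "ennreal (kk z * (\<phi> \<xi> - \<phi> \<eta>)\<^sup>2) \<le> ennreal C * T (heis_inv \<xi> \<cdot>\<^sub>H \<eta>)" if "\<xi> \<in> \<Omega>"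
    proof -
      have "kk z = k0 (heis_inv \<xi> \<cdot>\<^sub>H \<eta>)"
        using k0_inv[of "heis_inv \<eta> \<cdot>\<^sub>H \<xi>"] unfolding heis_diff_commute by (simp add: kk_def z)
      moreover have "(\<phi> \<xi> - \<phi> \<eta>)\<^sup>2 \<le> C * th (heis_inv \<xi> \<cdot>\<^sub>H \<eta>)" using one[OF that, of \<eta>] by (simp add: power2_commute)
      then have "kk z * (\<phi> \<xi> - \<phi> \<eta>)\<^sup>2 \<le> kk z * (C * th (heis_inv \<xi> \<cdot>\<^sub>H \<eta>))"
        by (rule mult_left_mono[OF _ kk_nonneg])
      ultimately have "kk z * (\<phi> \<xi> - \<phi> \<eta>)\<^sup>2 \<le> C * (th (heis_inv \<xi> \<cdot>\<^sub>H \<eta>) * k' (heis_inv \<xi> \<cdot>\<^sub>H \<eta>))"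
        using elim(2) by (simp add: z mult_ac)
      then show ?thesis unfolding T_def using C by (simp add: ennreal_mult'[symmetric] ennreal_leI)
    qed
    consider "\<eta> \<in> \<Omega>" | "\<xi> \<in> \<Omega>" | "\<xi> \<notin> \<Omega>" "\<eta> \<notin> \<Omega>" by blast
    then show ?case
    proof cases
      case 1
      then show ?thesis using A[OF 1] by (simp add: z S_set_eq add_increasing2)
    next
      case 2
      then show ?thesis using B[OF 2] by (simp add: z S_set_eq add_increasing)
    next
      case 3
      then show ?thesis by (simp add: z S_set_eq)
    qed
  qed
  have "(\<integral>\<^sup>+z. ennreal (norm (indicator (S_set \<Omega>) z * kk z * (\<phi> (fst z) - \<phi> (snd z))\<^sup>2)) \<partial>lebesgue)
      = (\<integral>\<^sup>+z. ennreal (indicator (S_set \<Omega>) z * kk z * (\<phi> (fst z) - \<phi> (snd z))\<^sup>2) \<partial>lborel)"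
    unfolding nn_integral_completion by (rule nn_integral_cong) (simp add: kk_nonneg)
  also have "\<dots> \<le> (\<integral>\<^sup>+z. ennreal C * (indicator \<Omega> (snd z) * T (heis_inv (snd z) \<cdot>\<^sub>H fst z)) + ennreal C * (indicator \<Omega> (fst z) * T (heis_inv (fst z) \<cdot>\<^sub>H snd z)) \<partial>lborel)"
    by (rule nn_integral_mono_AE[OF le])
  also have "\<dots> = ennreal C * ((\<integral>\<^sup>+\<zeta>. T \<zeta> \<partial>lborel) * emeasure lborel \<Omega>) + ennreal C * ((\<integral>\<^sup>+\<zeta>. T \<zeta> \<partial>lborel) * emeasure lborel \<Omega>)"
    using m1 m2 by (simp add: nn_integral_add nn_integral_cmult i1 i2)
  also have "\<dots> < \<infinity>" using Tfin \<Omega>_finite by (simp add: ennreal_mult_less_top)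
  finally have fin: "(\<integral>\<^sup>+z. ennreal (norm (indicator (S_set \<Omega>) z * kk z * (\<phi> (fst z) - \<phi> (snd z))\<^sup>2)) \<partial>lebesgue) < \<infinity>" .
  have "integrable lebesgue (\<lambda>z. indicator (S_set \<Omega>) z * kk z * (\<phi> (fst z) - \<phi> (snd z))\<^sup>2)"
  proof (rule integrableI_bounded[OF _ fin])
    note [measurable] = dm
    show "(\<lambda>z. indicator (S_set \<Omega>) z * kk z * (\<phi> (fst z) - \<phi> (snd z))\<^sup>2) \<in> borel_measurable lebesgue" by measurable
  qed
  then have "integrable \<nu> (\<lambda>z. (\<phi> (fst z) - \<phi> (snd z))\<^sup>2)" unfolding integrable_\<nu>[OF dm] .
  then show ?thesis using pl out unfolding form_space_def by simp
qed

text \<open>A cone over a ball in \<Omega>: Lipschitz with constant 1 and positive on a set of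
  positive measure.\<close>

lemma bump_exists:
  "\<exists>\<phi> r. \<phi> \<in> form_space lebesgue \<Omega> \<nu> \<and> (\<forall>\<xi>. 0 \<le> \<phi> \<xi>) \<and> (\<forall>\<xi>. \<phi> \<xi> \<le> r) \<and> \<not> (AE \<xi> in lebesgue. \<phi> \<xi> = 0)"
proof -
  obtain x0 where x0: "x0 \<in> \<Omega>" using \<Omega>(3) by blast
  obtain r where r: "r > 0" "ball x0 r \<subseteq> \<Omega>" using \<Omega>(1) x0 open_contains_ball by blast
  define \<phi> where "\<phi> \<xi> = max 0 (r - dist \<xi> x0)" for \<xi>
  have "\<phi> \<in> form_space lebesgue \<Omega> \<nu>"
  proof (rule lipschitz_in_form_space)
    fix \<xi> \<eta>
    show "\<bar>\<phi> \<xi> - \<phi> \<eta>\<bar> \<le> dist \<xi> \<eta>"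
      unfolding \<phi>_def using dist_triangle[of \<xi> x0 \<eta>] dist_triangle[of \<eta> x0 \<xi>] by (simp add: dist_commute)
    show "0 \<le> \<phi> \<xi>" "\<phi> \<xi> \<le> r" using r(1) by (auto simp: \<phi>_def)
    assume "\<xi> \<notin> \<Omega>"
    then have "\<xi> \<notin> ball x0 r" using r(2) by blast
    then show "\<phi> \<xi> = 0" by (simp add: \<phi>_def dist_commute)
  qed
  moreover have "\<not> (AE \<xi> in lebesgue. \<phi> \<xi> = 0)"
  proof
    assume "AE \<xi> in lebesgue. \<phi> \<xi> = 0"
    then have "AE \<xi> in lborel. \<xi> \<notin> ball x0 r"
      unfolding lebesgue_AE_iff
    proof eventually_elim
      case (elim \<xi>)
      then show ?case unfolding \<phi>_def mem_ball by (simp add: dist_commute max_def split: if_splits)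
    qed
    then have "ball x0 r \<in> null_sets lborel" by (subst AE_iff_null_sets) auto
    then have "emeasure lborel (ball x0 r) = 0" by (rule null_setsD1)
    moreover have "emeasure lborel (ball x0 r) \<noteq> 0"
      using r(1) by (simp add: emeasure_ball ennreal_eq_0_iff not_le)
    ultimately show False by simp
  qed
  moreover have "0 \<le> \<phi> \<xi>" "\<phi> \<xi> \<le> r" for \<xi> using r(1) by (auto simp: \<phi>_def)
  ultimately show ?thesis by blast
qed

end

section \<open>From almost everywhere hypotheses to the pointwise problem\<close>

lemma primitive_deriv:
  assumes "continuous_on UNIV (f \<xi>)"
  shows "(primitive f \<xi> has_real_derivative f \<xi> l) (at l)" and "primitive f \<xi> 0 = 0"
proof -
  \<comment> \<open>The margins of 1 put \<open>l\<close> in the interior of an interval that also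
    contains 0, so the one-sided statement at interval ends yields a two-sided derivative.\<close>
  define a b where "a = min 0 l - 1" and "b = max 0 l + 1"
  have "((\<lambda>u. LBINT y=ereal 0..ereal u. f \<xi> y) has_vector_derivative f \<xi> l) (at l within {a..b})"
    by (intro interval_integral_FTC2 continuous_on_subset[OF assms]) (auto simp: a_def b_def)
  then have "((\<lambda>u. LBINT y=ereal 0..ereal u. f \<xi> y) has_vector_derivative f \<xi> l) (at l within {a<..<b})"
    by (rule has_vector_derivative_within_subset) auto
  then have "((\<lambda>u. LBINT y=ereal 0..ereal u. f \<xi> y) has_vector_derivative f \<xi> l) (at l)"
    by (subst (asm) has_vector_derivative_within_open) (auto simp: a_def b_def)
  then show "(primitive f \<xi> has_real_derivative f \<xi> l) (at l)"
    unfolding has_real_derivative_iff_has_vector_derivative primitive_def[abs_def] .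
  show "primitive f \<xi> 0 = 0" by (simp add: primitive_def)
qed

text \<open>Measurability of \<open>g\<close> comes from completeness of Lebesgue measure; it is
  needed because \<open>f\<close> composed with \<open>u\<close> is controlled only almost
  everywhere.\<close>

lemma lebesgue_integral_AE_cong:
  fixes g h :: "'a::euclidean_space \<Rightarrow> real"
  assumes "h \<in> borel_measurable lebesgue" "AE x in lebesgue. g x = h x"
  shows "integral\<^sup>L lebesgue g = integral\<^sup>L lebesgue h" "integrable lebesgue g \<longleftrightarrow> integrable lebesgue h"
proof -
  have "AE x in lebesgue. h x = g x" using assms(2) by eventually_elim simp
  then have "g \<in> borel_measurable lebesgue" by (rule borel_measurable_AE[OF assms(1)])
  then show "integral\<^sup>L lebesgue g = integral\<^sup>L lebesgue h" "integrable lebesgue g \<longleftrightarrow> integrable lebesgue h"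
    using assms by (blast intro: integral_cong_AE, subst integrable_cong_AE) auto
qed

theorem theorem1p2:
  fixes \<Omega> :: "'n::finite heis set"
    and K :: "'n heis \<Rightarrow> real"
    and f :: "'n heis \<Rightarrow> real \<Rightarrow> real"
    and s Qstar :: real
  assumes s: "0 < s" "s < 1"
    and K: "admissible_kernel s K"
    and \<Omega>: "bounded \<Omega>" "extension_domain s \<Omega>"
    and f: "caratheodory \<Omega> f"
    and Qstar: "Qstar = 2 * hom_dim TYPE('n) / (hom_dim TYPE('n) - 2 * s)"
    and growth: "\<exists>a1>0. \<exists>a2>0. \<exists>q\<in>{2<..<Qstar}.
        AE \<xi> in lebesgue. \<xi> \<in> \<Omega> \<longrightarrow> (\<forall>l. \<bar>f \<xi> l\<bar> \<le> a1 + a2 * \<bar>l\<bar> powr (q - 1))"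
    and at_zero: "uniform_limit \<Omega> (\<lambda>l \<xi>. f \<xi> l / \<bar>l\<bar>) (\<lambda>_. 0) (at 0)"
    and AR: "\<exists>\<theta>>2. \<exists>R>0. AE \<xi> in lebesgue. \<xi> \<in> \<Omega> \<longrightarrow>
        (\<forall>l. \<bar>l\<bar> > R \<longrightarrow> 0 < \<theta> * primitive f \<xi> l \<and> \<theta> * primitive f \<xi> l \<le> l * f \<xi> l)"
  shows "\<exists>u\<in>Z0_space K \<Omega>. weak_solution K \<Omega> f u \<and> mountain_pass_type K \<Omega> f u \<and>
           \<not> (AE \<xi> in lebesgue. u \<xi> = 0)"
proof -
  interpret hk: heis_kernel s K \<Omega>
    using s K \<Omega> by unfold_locales (auto simp: extension_domain_def)
  have Qp: "Qstar = hk.p" by (simp add: Qstar hk.p_def hk.Q_def)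
  have \<Omega>_leb: "\<Omega> \<in> sets lebesgue" using hk.\<Omega>_borel by simp
  obtain a1 a2 q where a: "a1 > 0" "a2 > 0" and q: "2 < q" "q < hk.p"
    and gr: "AE \<xi> in lebesgue. \<xi> \<in> \<Omega> \<longrightarrow> (\<forall>l. \<bar>f \<xi> l\<bar> \<le> a1 + a2 * \<bar>l\<bar> powr (q - 1))"
    using growth unfolding Qp by auto
  obtain \<theta> R where \<theta>: "\<theta> > 2" and R: "R > 0"
    and ar: "AE \<xi> in lebesgue. \<xi> \<in> \<Omega> \<longrightarrow>
        (\<forall>l. \<bar>l\<bar> > R \<longrightarrow> 0 < \<theta> * primitive f \<xi> l \<and> \<theta> * primitive f \<xi> l \<le> l * f \<xi> l)"
    using AR by blast
  have cont: "AE \<xi> in lebesgue. \<xi> \<in> \<Omega> \<longrightarrow> continuous_on UNIV (f \<xi>)"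
    and fm: "\<And>l. (\<lambda>\<xi>. f \<xi> l) \<in> borel_measurable (lebesgue_on \<Omega>)"
    using f by (auto simp: caratheodory_def)
  \<comment> \<open>Points where all conditions on \<open>f\<close> that are given almost everywhere
    hold; off the set \<open>G\<close> of such points in \<Omega>, \<open>f\<close> and its
    primitive are replaced by 0.\<close>
  define good where "good \<xi> \<longleftrightarrow> continuous_on UNIV (f \<xi>) \<and> (\<forall>l. \<bar>f \<xi> l\<bar> \<le> a1 + a2 * \<bar>l\<bar> powr (q - 1)) \<and>
    (\<forall>l. \<bar>l\<bar> > R \<longrightarrow> 0 < \<theta> * primitive f \<xi> l \<and> \<theta> * primitive f \<xi> l \<le> l * f \<xi> l)" for \<xi>
  have "AE \<xi> in lebesgue. \<xi> \<in> \<Omega> \<longrightarrow> good \<xi>"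
    using cont gr ar by eventually_elim (simp add: good_def)
  then obtain B where B: "B \<in> null_sets lebesgue" "{\<xi> \<in> space lebesgue. \<not> (\<xi> \<in> \<Omega> \<longrightarrow> good \<xi>)} \<subseteq> B"
    by (auto simp: eventually_ae_filter)
  define G where "G = \<Omega> - B"
  have G_leb [measurable]: "G \<in> sets lebesgue" unfolding G_def using \<Omega>_leb B(1) by blast
  have G_sub: "G \<subseteq> \<Omega>" by (auto simp: G_def)
  have G_good: "good \<xi>" if "\<xi> \<in> G" for \<xi> using subsetD[OF B(2), of \<xi>] that by (simp add: G_def) blast
  have G_ae: "AE \<xi> in lebesgue. \<xi> \<in> \<Omega> \<longrightarrow> \<xi> \<in> G"
    using AE_not_in[OF B(1)] by eventually_elim (simp add: G_def)
  define f0 where "f0 \<xi> l = (if \<xi> \<in> G then f \<xi> l else 0)" for \<xi> l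
  define F0 where "F0 \<xi> l = (if \<xi> \<in> G then primitive f \<xi> l else 0)" for \<xi> l
  obtain CS where CS: "\<And>G. G \<in> sets lebesgue \<Longrightarrow> G \<subseteq> \<Omega> \<Longrightarrow> (AE x in lebesgue. x \<in> \<Omega> \<longrightarrow> x \<in> G) \<Longrightarrow>
      dirichlet_form lebesgue G hk.\<nu> hk.p CS"
    using hk.dirichlet_form_kernel by blast
  obtain \<phi> r where \<phi>: "\<phi> \<in> form_space lebesgue \<Omega> hk.\<nu>" "\<And>\<xi>. 0 \<le> \<phi> \<xi>" "\<And>\<xi>. \<phi> \<xi> \<le> r" "\<not> (AE \<xi> in lebesgue. \<phi> \<xi> = 0)"
    using hk.bump_exists by blast
  note V_eq = hk.form_space_cong[OF G_sub G_ae]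
  interpret nl: nonlinear_problem lebesgue G hk.\<nu> hk.p CS f0 F0 "a1 + a2" q \<theta> R r \<phi>
  proof (intro nonlinear_problem.intro nonlinear_problem_axioms.intro)
    show "dirichlet_form lebesgue G hk.\<nu> hk.p CS" by (rule CS[OF G_leb G_sub G_ae])
    show "\<phi> \<in> form_space lebesgue G hk.\<nu>" using \<phi>(1) by (simp add: V_eq)
    show "0 \<le> \<phi> \<xi>" "\<phi> \<xi> \<le> r" for \<xi> by (rule \<phi>)+
    show "\<not> (AE \<xi> in lebesgue. \<phi> \<xi> = 0)" by (rule \<phi>)
    show "a1 + a2 > 0" "2 < q" "q < hk.p" "\<theta> > 2" "R > 0" using a q \<theta> R by auto
    show "f0 \<xi> l = 0" "F0 \<xi> l = 0" if "\<xi> \<notin> G" for \<xi> l using that by (simp_all add: f0_def F0_def)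
    show "(\<lambda>\<xi>. f0 \<xi> l) \<in> borel_measurable lebesgue" for l
    proof -
      have [measurable]: "(\<lambda>\<xi>. if \<xi> \<in> \<Omega> then f \<xi> l else 0) \<in> borel_measurable lebesgue"
        by (rule borel_measurable_if_I[OF fm \<Omega>_leb])
      have "(\<lambda>\<xi>. f0 \<xi> l) = (\<lambda>\<xi>. indicator G \<xi> * (if \<xi> \<in> \<Omega> then f \<xi> l else 0))"
        using G_sub by (auto simp: f0_def fun_eq_iff indicator_def)
      then show ?thesis by simp
    qed
    show "continuous_on UNIV (f0 \<xi>)" for \<xi>
    proof (cases "\<xi> \<in> G")
      case True
      then have "f0 \<xi> = f \<xi>" by (auto simp: f0_def)
      then show ?thesis using G_good[OF True] by (simp add: good_def)
    next
      case False
      then have "f0 \<xi> = (\<lambda>_. 0)" by (auto simp: f0_def)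
      then show ?thesis by simp
    qed
    show "(F0 \<xi> has_real_derivative f0 \<xi> l) (at l)" "F0 \<xi> 0 = 0" for \<xi> l
    proof -
      have "(F0 \<xi> has_real_derivative f0 \<xi> l) (at l) \<and> F0 \<xi> 0 = 0"
      proof (cases "\<xi> \<in> G")
        case True
        then have "f0 \<xi> = f \<xi>" "F0 \<xi> = primitive f \<xi>" by (auto simp: f0_def F0_def)
        then show ?thesis using G_good[OF True] primitive_deriv[of f \<xi>] by (simp add: good_def)
      next
        case False
        then have "f0 \<xi> = (\<lambda>_. 0)" "F0 \<xi> = (\<lambda>_. 0)" by (auto simp: f0_def F0_def)
        then show ?thesis by simp
      qed
      then show "(F0 \<xi> has_real_derivative f0 \<xi> l) (at l)" "F0 \<xi> 0 = 0" by blast+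
    qed
    show "\<bar>f0 \<xi> l\<bar> \<le> (a1 + a2) * (1 + \<bar>l\<bar>) powr (q - 1)" if \<xi>: "\<xi> \<in> G" for \<xi> l
    proof -
      have "\<bar>f0 \<xi> l\<bar> \<le> a1 + a2 * \<bar>l\<bar> powr (q - 1)" using G_good[OF \<xi>] \<xi> by (simp add: f0_def good_def)
      moreover have "a1 * 1 \<le> a1 * (1 + \<bar>l\<bar>) powr (q - 1)" using a q by (intro mult_left_mono ge_one_powr_ge_zero) auto
      moreover have "a2 * \<bar>l\<bar> powr (q - 1) \<le> a2 * (1 + \<bar>l\<bar>) powr (q - 1)"
        using a q by (intro mult_left_mono powr_mono2) auto
      ultimately show ?thesis by (simp add: distrib_right)
    qed
    show "\<exists>\<delta>>0. \<forall>\<xi>\<in>G. \<forall>l. \<bar>l\<bar> < \<delta> \<longrightarrow> \<bar>f0 \<xi> l\<bar> \<le> \<epsilon> * \<bar>l\<bar>" if \<epsilon>: "\<epsilon> > 0" for \<epsilon>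
    proof -
      have "\<forall>\<^sub>F l in at 0. \<forall>\<xi>\<in>\<Omega>. dist (f \<xi> l / \<bar>l\<bar>) 0 < \<epsilon>"
        using at_zero \<epsilon> by (simp add: uniform_limit_iff)
      then obtain \<delta> where \<delta>: "\<delta> > 0" "\<And>l \<xi>. l \<noteq> 0 \<Longrightarrow> \<bar>l\<bar> < \<delta> \<Longrightarrow> \<xi> \<in> \<Omega> \<Longrightarrow> \<bar>f \<xi> l / \<bar>l\<bar>\<bar> < \<epsilon>"
        by (auto simp: eventually_at dist_real_def)
      have nz: "\<bar>f \<xi> l\<bar> \<le> \<epsilon> * \<bar>l\<bar>" if "l \<noteq> 0" "\<bar>l\<bar> < \<delta>" "\<xi> \<in> G" for \<xi> l
        using \<delta>(2)[OF that(1,2), of \<xi>] that G_sub by (auto simp: abs_divide divide_less_eq)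
      \<comment> \<open>The limit at 0 says nothing about \<open>l = 0\<close> itself; continuity of
        \<open>f \<xi>\<close> supplies that value.\<close>
      have z: "f \<xi> 0 = 0" if \<xi>: "\<xi> \<in> G" for \<xi>
      proof -
        have "isCont (f \<xi>) 0" using G_good[OF \<xi>] by (simp add: good_def continuous_on_eq_continuous_at)
        then have "(f \<xi> \<longlongrightarrow> f \<xi> 0) (at 0)" by (simp add: isCont_def)
        moreover have "(f \<xi> \<longlongrightarrow> 0) (at 0)"
        proof (rule Lim_null_comparison)
          show "\<forall>\<^sub>F l in at 0. norm (f \<xi> l) \<le> \<epsilon> * \<bar>l\<bar>"
            unfolding eventually_at using \<delta>(1) nz[OF _ _ \<xi>] by (intro exI[of _ \<delta>]) (auto simp: dist_real_def)
          have "((\<lambda>l::real. \<epsilon> * \<bar>l\<bar>) \<longlongrightarrow> \<epsilon> * \<bar>0\<bar>) (at 0)" by (intro tendsto_intros)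
          then show "((\<lambda>l::real. \<epsilon> * \<bar>l\<bar>) \<longlongrightarrow> 0) (at 0)" by simp
        qed
        ultimately show ?thesis by (rule tendsto_unique[OF trivial_limit_at])
      qed
      show ?thesis
      proof (intro exI[of _ \<delta>] conjI ballI allI impI)
        fix \<xi> l assume "\<xi> \<in> G" "\<bar>l\<bar> < \<delta>"
        then show "\<bar>f0 \<xi> l\<bar> \<le> \<epsilon> * \<bar>l\<bar>" using nz[of l \<xi>] z[of \<xi>] by (cases "l = 0") (simp_all add: f0_def)
      qed (rule \<delta>(1))
    qed
    show "0 < \<theta> * F0 \<xi> l \<and> \<theta> * F0 \<xi> l \<le> l * f0 \<xi> l" if "\<xi> \<in> G" "\<bar>l\<bar> > R" for \<xi> l
      using G_good[OF that(1)] that by (simp add: good_def f0_def F0_def)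
  qed
  have Z0: "Z0_space K \<Omega> = nl.V" unfolding hk.Z0_space_eq V_eq ..
  have norm_eq: "Z0_norm K \<Omega> u = nl.N u" if "u \<in> nl.V" for u
    unfolding nl.N_def using nl.V_measurable[OF that] by (rule hk.Z0_norm_eq)
  have energy_eq: "energy K \<Omega> f u = (nl.N u)\<^sup>2 / 2 - nl.\<Psi> u" if u: "u \<in> nl.V" for u
  proof -
    have "AE \<xi> in lebesgue. indicator \<Omega> \<xi> *\<^sub>R primitive f \<xi> (u \<xi>) = F0 \<xi> (u \<xi>)"
      using G_ae by eventually_elim (use G_sub in \<open>auto simp: F0_def indicator_def\<close>)
    from lebesgue_integral_AE_cong(1)[OF nl.F_comp_measurable[OF nl.V_measurable[OF u]] this]
    show ?thesis by (simp add: energy_def norm_eq[OF u] nl.\<Psi>_def set_lebesgue_integral_def)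
  qed
  obtain u e \<rho> \<alpha> where u: "u \<in> nl.V" and e: "e \<in> nl.V" "nl.N e > \<rho>" "(nl.N e)\<^sup>2 / 2 - nl.\<Psi> e \<le> 0"
    and \<rho>: "\<rho> > 0" "\<alpha> > 0" "\<And>w. w \<in> nl.V \<Longrightarrow> nl.N w = \<rho> \<Longrightarrow> \<alpha> \<le> (nl.N w)\<^sup>2 / 2 - nl.\<Psi> w"
    and weak: "\<And>v. v \<in> nl.V \<Longrightarrow> form hk.\<nu> u v = (\<integral>x. f0 x (u x) * v x \<partial>lebesgue)"
    and pos: "\<alpha> \<le> (nl.N u)\<^sup>2 / 2 - nl.\<Psi> u"
    and level: "ereal ((nl.N u)\<^sup>2 / 2 - nl.\<Psi> u) =
      (INF \<gamma>\<in>{\<gamma>. nl.cpath \<gamma> \<and> nl.N (\<gamma> 0) = 0 \<and> nl.N (\<gamma> 1 - e) = 0}.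
        SUP \<tau>\<in>{0..1}. ereal ((nl.N (\<gamma> \<tau>))\<^sup>2 / 2 - nl.\<Psi> (\<gamma> \<tau>)))"
    using nl.mountain_pass_solution by blast
  have null_iff: "nl.N v = 0 \<longleftrightarrow> (AE \<xi> in lebesgue. v \<xi> = 0)" if "v \<in> nl.V" for v
    using nl.AE_zero_of_N_zero nl.N_zero_of_AE_zero that by blast
  have "weak_solution K \<Omega> f u"
    unfolding weak_solution_def Let_def
  proof (intro conjI ballI)
    show "u \<in> Z0_space K \<Omega>" using u by (simp add: Z0)
    fix v assume "v \<in> Z0_space K \<Omega>"
    then have v: "v \<in> nl.V" by (simp add: Z0)
    note m = nl.V_measurable[OF u] nl.V_measurable[OF v]
    have ae: "AE \<xi> in lebesgue. indicator \<Omega> \<xi> *\<^sub>R (f \<xi> (u \<xi>) * v \<xi>) = f0 \<xi> (u \<xi>) * v \<xi>"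
      using G_ae by eventually_elim (use G_sub in \<open>auto simp: f0_def indicator_def\<close>)
    have fi: "integrable lebesgue (\<lambda>\<xi>. f0 \<xi> (u \<xi>) * v \<xi>)" by (rule nl.f_mult_integrable[OF u v])
    note cong = lebesgue_integral_AE_cong[OF borel_measurable_integrable[OF fi] ae]
    show "set_integrable lebesgue (S_set \<Omega>) (\<lambda>(\<xi>, \<eta>). (u \<xi> - u \<eta>) * (v \<xi> - v \<eta>) * K (heis_inv \<eta> \<cdot>\<^sub>H \<xi>))"
      using nl.D_integrable[OF u v] unfolding nl.D_def hk.form_eq(1)[OF m] .
    show "set_integrable lebesgue \<Omega> (\<lambda>\<xi>. f \<xi> (u \<xi>) * v \<xi>)"
      unfolding set_integrable_def using cong(2) fi by simp
    show "set_lebesgue_integral lebesgue (S_set \<Omega>) (\<lambda>(\<xi>, \<eta>). (u \<xi> - u \<eta>) * (v \<xi> - v \<eta>) * K (heis_inv \<eta> \<cdot>\<^sub>H \<xi>)) =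
        (LINT \<xi>:\<Omega>|lebesgue. f \<xi> (u \<xi>) * v \<xi>)"
      using hk.form_eq(2)[OF m] weak[OF v] cong(1) by (simp add: set_lebesgue_integral_def)
  qed
  moreover have "mountain_pass_type K \<Omega> f u"
    unfolding mountain_pass_type_def
  proof (intro bexI[of _ e] exI[of _ \<rho>] conjI)
    show "e \<in> Z0_space K \<Omega>" using e by (simp add: Z0)
    show "0 < \<rho>" by (rule \<rho>)
    show "Z0_norm K \<Omega> e > \<rho>" using e norm_eq by simp
    have "energy K \<Omega> f (\<lambda>_. 0) = 0"
    proof -
      have "energy K \<Omega> f 0 = 0" using energy_eq[of 0] nl.F_zero by (simp add: nl.\<Psi>_def)
      then show ?thesis by (simp add: zero_fun_def)
    qed
    \<comment> \<open>Both energies are at most 0, and \<alpha> separates them strictly from the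
      infimum over the sphere, whether or not that infimum is attained.\<close>
    then have "ereal (max (energy K \<Omega> f (\<lambda>_. 0)) (energy K \<Omega> f e)) < ereal \<alpha>"
      using e \<rho> energy_eq[OF e(1)] by simp
    also have "\<dots> \<le> (INF w\<in>{w \<in> Z0_space K \<Omega>. Z0_norm K \<Omega> w = \<rho>}. ereal (energy K \<Omega> f w))"
      by (rule INF_greatest) (use \<rho>(3) in \<open>auto simp: Z0 norm_eq energy_eq\<close>)
    finally show "ereal (max (energy K \<Omega> f (\<lambda>_. 0)) (energy K \<Omega> f e))
        < (INF w\<in>{w \<in> Z0_space K \<Omega>. Z0_norm K \<Omega> w = \<rho>}. ereal (energy K \<Omega> f w))" .
    \<comment> \<open>End points prescribed almost everywhere correspond to seminorm 0 by
      \<open>null_iff\<close>.\<close>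
    have paths: "mp_paths K \<Omega> e = {\<gamma>. nl.cpath \<gamma> \<and> nl.N (\<gamma> 0) = 0 \<and> nl.N (\<gamma> 1 - e) = 0}"
    proof -
      have "\<gamma> \<in> mp_paths K \<Omega> e \<longleftrightarrow> nl.cpath \<gamma> \<and> nl.N (\<gamma> 0) = 0 \<and> nl.N (\<gamma> 1 - e) = 0" for \<gamma>
      proof (cases "\<forall>\<tau>\<in>{0..1}. \<gamma> \<tau> \<in> nl.V")
        case True
        have "((\<lambda>\<sigma>. Z0_norm K \<Omega> (\<lambda>\<xi>. \<gamma> \<sigma> \<xi> - \<gamma> \<tau> \<xi>)) \<longlongrightarrow> 0) (at \<tau> within {0..1}) \<longleftrightarrow>
            ((\<lambda>\<sigma>. nl.N (\<gamma> \<sigma> - \<gamma> \<tau>)) \<longlongrightarrow> 0) (at \<tau> within {0..1})" if \<tau>: "\<tau> \<in> {0..1}" for \<tau>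
        proof (rule tendsto_cong)
          have "Z0_norm K \<Omega> (\<lambda>\<xi>. \<gamma> \<sigma> \<xi> - \<gamma> \<tau> \<xi>) = nl.N (\<gamma> \<sigma> - \<gamma> \<tau>)" if "\<sigma> \<in> {0..1}" for \<sigma>
            using norm_eq[of "\<gamma> \<sigma> - \<gamma> \<tau>"] True \<tau> that nl.V_diff by (simp add: fun_diff_def)
          then show "\<forall>\<^sub>F \<sigma> in at \<tau> within {0..1}. Z0_norm K \<Omega> (\<lambda>\<xi>. \<gamma> \<sigma> \<xi> - \<gamma> \<tau> \<xi>) = nl.N (\<gamma> \<sigma> - \<gamma> \<tau>)"
            by (simp add: eventually_at_filter)
        qed
        moreover have "\<gamma> 0 \<in> nl.V" "\<gamma> 1 - e \<in> nl.V" using True e(1) nl.V_diff by auto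
        then have "(AE \<xi> in lebesgue. \<gamma> 0 \<xi> = 0) \<longleftrightarrow> nl.N (\<gamma> 0) = 0"
          "(AE \<xi> in lebesgue. \<gamma> 1 \<xi> = e \<xi>) \<longleftrightarrow> nl.N (\<gamma> 1 - e) = 0"
          using null_iff[of "\<gamma> 0"] null_iff[of "\<gamma> 1 - e"] by simp_all
        ultimately show ?thesis using True by (simp add: mp_paths_def nl.cpath_def Z0)
      next
        case False
        then show ?thesis unfolding mp_paths_def nl.cpath_def Z0 by blast
      qed
      then show ?thesis by blast
    qed
    show "ereal (energy K \<Omega> f u) = (INF \<gamma>\<in>mp_paths K \<Omega> e. SUP \<tau>\<in>{0..1}. ereal (energy K \<Omega> f (\<gamma> \<tau>)))"
      unfolding paths energy_eq[OF u] level
      by (intro INF_cong SUP_cong refl) (auto simp: energy_eq nl.cpath_in)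
  qed
  \<comment> \<open>A solution vanishing almost everywhere would have energy 0, below the level
    bound \<alpha>.\<close>
  moreover have "\<not> (AE \<xi> in lebesgue. u \<xi> = 0)"
  proof
    assume ae: "AE \<xi> in lebesgue. u \<xi> = 0"
    then have "nl.N u = 0" using null_iff[OF u] by blast
    moreover have "AE \<xi> in lebesgue. F0 \<xi> (u \<xi>) = 0" using ae by eventually_elim (simp add: nl.F_zero)
    then have "nl.\<Psi> u = 0" unfolding nl.\<Psi>_def by (rule integral_eq_zero_AE)
    ultimately show False using pos \<rho> by simp
  qed
  ultimately show ?thesis using u by (auto simp: Z0)
qed

end
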